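(* Let $X,\nu,R,M_p,M_p^*$ be as in the context, with $R\nabla$ closable in $L^p(X,\nu)$ for every $p\in(1,\infty)$, and let $g:X\to\mathbb{R}$ be a Borel function such that, for every $p>1$, $g\in W^{1,p}(X,\nu)$ and $Mg\,\|Mg\|^{-2}\in D(M_p^* )$. Assume in addition that $Mg\in W^{1,q}(X,\nu;X)$ for some $q>2$, and let $q'=q/(q-1)$. Then for every $r\in\mathbb{R}$, every $\varphi\in C_b^1(X)$ with nonnegative values, and any $t\in(q',q)$, $s>q'$, we have $$\int_X\varphi\,T(\|Mg\|)\,d\sigma_r^g=\max\Big\{\int_{\{g<r\}}M_s^*(\varphi F)\,d\nu:\ F\in W^{1,t}(X,\nu;X)\cap D(M_s^* ),\ \|F(x)\|\le1\ \text{for }\nu\text{-a.e. }x\Big\}.$$ The maximum is attained at $F=-Mg/\|Mg\|$.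
   Context: $X$ is a separable infinite-dimensional real Hilbert space with inner product $\langle\cdot,\cdot\rangle$ and norm $\|\cdot\|$, and $\nu$ is a non-degenerate Borel probability measure on $X$ (non-degenerate: not concentrated on any proper closed linear subspace). $C_b(X)$ is the space of bounded continuous real functions; $C_b^1(X)$ is the space of bounded continuously Fréchet differentiable $\varphi:X\to\mathbb{R}$ with bounded gradient $\nabla\varphi$. $R\in\mathcal{L}(X)$ is a bounded linear operator such that for every $p\in(1,\infty)$ the operator $\varphi\mapsto R\nabla\varphi$, with domain $C^1_b(X)\subset L^p(X,\nu)$ and values in $L^p(X,\nu;X)$, is closable. $M_p$ denotes its closure, $W^{1,p}(X,\nu)$ the domain of $M_p$, with norm $\|f\|_{W^{1,p}}=\|f\|_{L^p(X,\nu)}+\|M_pf\|_{L^p(X,\nu;X)}$. With $p'=p/(p-1)$, $M_p^*:D(M_p^* )\subset L^{p'}(X,\nu;X)\to L^{p'}(X,\nu)$ is the adjoint: $\int_X\langle M_p\varphi,F\rangle\,d\nu=\int_X\varphi\,M_p^*F\,d\nu$ for $\varphi\in W^{1,p}(X,\nu)$, $F\in D(M_p^* )$. If $F\in D(M_s^* )$ and $\varphi\in C_b^1(X)$ then $\varphi F\in D(M_s^* )$. One writes $M$, $M^*$ on $\bigcap_{p>1}W^{1,p}(X,\nu)$, $\bigcap_{p>1}D(M_p^* )$, where the operators do not depend on $p$. The condition on $Mg\,\|Mg\|^{-2}$ includes that it is defined $\nu$-a.e. For $p>1$, $W^{1,p}(X,\nu;X)$ is the space of vector fields $F:X\to X$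 such that, for a given orthonormal basis $\{e_i\}_{i\in\mathbb{N}}$ of $X$, $f_i:=\langle F,e_i\rangle\in W^{1,p}(X,\nu)$ for every $i$ and $(\sum_{i}\|M_pf_i\|^2)^{1/2}\in L^p(X,\nu)$ (independent of the basis). For $r\in\mathbb{R}$, $\sigma_r^g$ is the unique finite nonnegative Borel measure on $X$ such that $\int_X\varphi\,d\sigma_r^g=\frac{d}{dr}\int_{\{g\le r\}}\varphi\,d\nu$ for every $\varphi\in C_b(X)$ (the derivatives and the measure exist whenever $R\nabla$ is closable in $L^p(X,\nu)$ for every $p\in(1,\infty)$ and $g:X\to\mathbb{R}$ is a Borel function such that $g\in W^{1,p}(X,\nu)$ and $Mg\,\|Mg\|^{-2}\in D(M_p^* )$ for every $p>1$). Trace: for $f\in W^{1,p}(X,\nu)$, $p>1$, $Tf\in L^1(X,\sigma_r^g)$ is the common limit in $L^1(X,\sigma_r^g)$ of all sequences in $C_b^1(X)$ converging to $f$ in $W^{1,p}(X,\nu)$ (it is well defined). Under the assumption on $Mg$, $\|Mg\|\in W^{1,q}(X,\nu)$. *)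

theory Defs
  imports "HOL-Probability.Probability"
begin

text \<open>
  The Hilbert space is a type of sort \<open>{real_inner, banach, second_countable_topology}\<close>; for
  metric spaces second countability is separability. Elements of Lebesgue and Sobolev spaces are
  represented by functions, so operators that are determined only up to null sets are given by
  their graphs, and a value of such an operator is a chosen representative.
\<close>

definition infinite_dimensional :: "'a::real_vector itself \<Rightarrow> bool" where
  "infinite_dimensional _ \<longleftrightarrow> \<not> (\<exists>B::'a set. finite B \<and> span B = UNIV)"

definition nondegenerate :: "'a::real_normed_vector measure \<Rightarrow> bool" where
  "nondegenerate \<nu> \<longleftrightarrow> (\<forall>S. subspace S \<and> closed S \<and> S \<noteq> UNIV \<longrightarrow> \<not> (AE x in \<nu>. x \<in> S))"

definition orthonormal_basis :: "(nat \<Rightarrow> 'a::real_inner) \<Rightarrow> bool" where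
  "orthonormal_basis e \<longleftrightarrow>
     (\<forall>i j. e i \<bullet> e j = (if i = j then 1 else 0)) \<and> closure (span (range e)) = UNIV"

definition conj_exp :: "real \<Rightarrow> real" where
  "conj_exp p = p / (p - 1)"

subsection \<open>Lebesgue spaces\<close>

definition Lp :: "'a measure \<Rightarrow> real \<Rightarrow> ('a \<Rightarrow> 'b::real_normed_vector) set" where
  "Lp \<nu> p = {f \<in> borel_measurable \<nu>. integrable \<nu> (\<lambda>x. norm (f x) powr p)}"

definition Lp_norm :: "'a measure \<Rightarrow> real \<Rightarrow> ('a \<Rightarrow> 'b::real_normed_vector) \<Rightarrow> real" where
  "Lp_norm \<nu> p f = (LINT x|\<nu>. norm (f x) powr p) powr (1 / p)"

definition Lp_tendsto ::
    "'a measure \<Rightarrow> real \<Rightarrow> (nat \<Rightarrow> 'a \<Rightarrow> 'b::real_normed_vector) \<Rightarrow> ('a \<Rightarrow> 'b) \<Rightarrow> bool" where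
  "Lp_tendsto \<nu> p f l \<longleftrightarrow>
     (\<forall>n. f n \<in> Lp \<nu> p) \<and> l \<in> Lp \<nu> p \<and> (\<lambda>n. Lp_norm \<nu> p (\<lambda>x. f n x - l x)) \<longlonglongrightarrow> 0"

subsection \<open>The gradient and \<open>C\<^sub>b\<^sup>1\<close>\<close>

definition grad :: "('a::real_inner \<Rightarrow> real) \<Rightarrow> 'a \<Rightarrow> 'a" where
  "grad \<phi> x = (THE D. GDERIV \<phi> x :> D)"

definition C1b :: "('a::real_inner \<Rightarrow> real) set" where
  "C1b = {\<phi>. bounded (range \<phi>) \<and> (\<forall>x. GDERIV \<phi> x :> grad \<phi> x) \<and>
            continuous_on UNIV (grad \<phi>) \<and> bounded (range (grad \<phi>))}"

subsection \<open>The closure \<open>M\<^sub>p\<close> of \<open>R \<nabla>\<close> and its adjoint\<close>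

text \<open>The closure in \<open>L\<^sup>p(\<nu>) \<times> L\<^sup>p(\<nu>; X)\<close> of the graph of \<open>R \<nabla>\<close> on \<open>C\<^sub>b\<^sup>1\<close>.\<close>

definition M_graph ::
    "'a::real_inner measure \<Rightarrow> ('a \<Rightarrow> 'a) \<Rightarrow> real \<Rightarrow> (('a \<Rightarrow> real) \<times> ('a \<Rightarrow> 'a)) set" where
  "M_graph \<nu> R p = {(f, G). \<exists>\<phi>. (\<forall>n. \<phi> n \<in> C1b) \<and> Lp_tendsto \<nu> p \<phi> f \<and>
                       Lp_tendsto \<nu> p (\<lambda>n x. R (grad (\<phi> n) x)) G}"

definition closable_grad :: "'a::real_inner measure \<Rightarrow> ('a \<Rightarrow> 'a) \<Rightarrow> real \<Rightarrow> bool" where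
  "closable_grad \<nu> R p \<longleftrightarrow> (\<forall>G. ((\<lambda>_. 0), G) \<in> M_graph \<nu> R p \<longrightarrow> (AE x in \<nu>. G x = 0))"

definition W1 :: "'a::real_inner measure \<Rightarrow> ('a \<Rightarrow> 'a) \<Rightarrow> real \<Rightarrow> ('a \<Rightarrow> real) set" where
  "W1 \<nu> R p = {f. \<exists>G. (f, G) \<in> M_graph \<nu> R p}"

definition M_op ::
    "'a::real_inner measure \<Rightarrow> ('a \<Rightarrow> 'a) \<Rightarrow> real \<Rightarrow> ('a \<Rightarrow> real) \<Rightarrow> 'a \<Rightarrow> 'a" where
  "M_op \<nu> R p f = (SOME G. (f, G) \<in> M_graph \<nu> R p)"

text \<open>The \<open>p\<close>-independent operator \<open>M\<close> on \<open>\<Inter>p>1. W\<^sup>1\<^sup>,\<^sup>p\<close>.\<close>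

definition M_all ::
    "'a::real_inner measure \<Rightarrow> ('a \<Rightarrow> 'a) \<Rightarrow> ('a \<Rightarrow> real) \<Rightarrow> 'a \<Rightarrow> 'a" where
  "M_all \<nu> R f = (SOME G. \<forall>p>1. (f, G) \<in> M_graph \<nu> R p)"

definition W1_norm ::
    "'a::real_inner measure \<Rightarrow> ('a \<Rightarrow> 'a) \<Rightarrow> real \<Rightarrow> ('a \<Rightarrow> real) \<Rightarrow> real" where
  "W1_norm \<nu> R p f = Lp_norm \<nu> p f + Lp_norm \<nu> p (M_op \<nu> R p f)"

definition Mstar_graph ::
    "'a::real_inner measure \<Rightarrow> ('a \<Rightarrow> 'a) \<Rightarrow> real \<Rightarrow> (('a \<Rightarrow> 'a) \<times> ('a \<Rightarrow> real)) set" where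
  "Mstar_graph \<nu> R p = {(F, h). F \<in> Lp \<nu> (conj_exp p) \<and> h \<in> Lp \<nu> (conj_exp p) \<and>
     (\<forall>\<psi> \<in> W1 \<nu> R p. (LINT x|\<nu>. M_op \<nu> R p \<psi> x \<bullet> F x) = (LINT x|\<nu>. \<psi> x * h x))}"

definition Mstar_dom :: "'a::real_inner measure \<Rightarrow> ('a \<Rightarrow> 'a) \<Rightarrow> real \<Rightarrow> ('a \<Rightarrow> 'a) set" where
  "Mstar_dom \<nu> R p = {F. \<exists>h. (F, h) \<in> Mstar_graph \<nu> R p}"

definition Mstar ::
    "'a::real_inner measure \<Rightarrow> ('a \<Rightarrow> 'a) \<Rightarrow> real \<Rightarrow> ('a \<Rightarrow> 'a) \<Rightarrow> 'a \<Rightarrow> real" where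
  "Mstar \<nu> R p F = (SOME h. (F, h) \<in> Mstar_graph \<nu> R p)"

text \<open>
  Sobolev vector fields, relative to a given orthonormal basis \<open>e\<close>. The almost everywhere
  summability is needed because \<open>suminf\<close> is unspecified on divergent series.
\<close>

definition W1_vec ::
    "'a::real_inner measure \<Rightarrow> ('a \<Rightarrow> 'a) \<Rightarrow> (nat \<Rightarrow> 'a) \<Rightarrow> real \<Rightarrow> ('a \<Rightarrow> 'a) set" where
  "W1_vec \<nu> R e p = {F \<in> borel_measurable \<nu>.
     (\<forall>i. (\<lambda>x. F x \<bullet> e i) \<in> W1 \<nu> R p) \<and>
     (AE x in \<nu>. summable (\<lambda>i. (norm (M_op \<nu> R p (\<lambda>y. F y \<bullet> e i) x))\<^sup>2)) \<and>
     (\<lambda>x. sqrt (\<Sum>i. (norm (M_op \<nu> R p (\<lambda>y. F y \<bullet> e i) x))\<^sup>2)) \<in> Lp \<nu> p}"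

subsection \<open>The surface measures and the trace\<close>

definition surface_measure ::
    "'a::real_inner measure \<Rightarrow> ('a \<Rightarrow> real) \<Rightarrow> real \<Rightarrow> 'a measure" where
  "surface_measure \<nu> g r = (THE \<sigma>. sets \<sigma> = sets borel \<and> finite_measure \<sigma> \<and>
     (\<forall>\<phi> \<in> bcontfun. ((\<lambda>\<rho>. LINT x:{x. g x \<le> \<rho>}|\<nu>. \<phi> x)
        has_real_derivative (LINT x|\<sigma>. \<phi> x)) (at r)))"

text \<open>\<open>T f\<close> as an element of \<open>L\<^sup>1(\<sigma>)\<close>, for \<open>f \<in> W\<^sup>1\<^sup>,\<^sup>p\<close>.\<close>

definition trace_op ::
    "'a::real_inner measure \<Rightarrow> ('a \<Rightarrow> 'a) \<Rightarrow> 'a measure \<Rightarrow> real \<Rightarrow> ('a \<Rightarrow> real) \<Rightarrow> 'a \<Rightarrow> real" where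
  "trace_op \<nu> R \<sigma> p f = (SOME \<tau>. integrable \<sigma> \<tau> \<and>
     (\<forall>\<phi>. (\<forall>n. \<phi> n \<in> C1b) \<and> (\<lambda>n. W1_norm \<nu> R p (\<lambda>x. \<phi> n x - f x)) \<longlonglongrightarrow> 0 \<longrightarrow>
        (\<lambda>n. LINT x|\<sigma>. \<bar>\<phi> n x - \<tau> x\<bar>) \<longlonglongrightarrow> 0))"

end

theory Submission
  imports Defs
begin

text \<open>
  Throughout, let \<open>\<Psi> = Mg / \<parallel>Mg\<parallel>\<^sup>2\<close>, so that \<open>\<langle>Mg, \<Psi>\<rangle> = 1\<close>. The chain rule, applied to a function of
  \<open>g\<close> that rises linearly from \<open>0\<close> to \<open>b - a\<close> on \<open>[a, b]\<close>, and the adjoint \<open>M\<^sup>*\<close> give for smooth \<open>u\<close>,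
  that is for \<open>u\<close> in \<open>C1b\<close>, the identity (\<open>slab_identity\<close>)

    \<open>\<integral>\<^bsub>{a < g < b}\<^esub> u d\<nu> = \<integral> ramp a b (g) (u M\<^sup>*\<Psi> - \<langle>R \<nabla>u, \<Psi>\<rangle>) d\<nu>\<close>.

  It shows that level sets are null, that the slab averages of \<open>u\<close>, its integrals over \<open>{a < g \<le> b}\<close>
  divided by \<open>b - a\<close>, converge as the slab shrinks to \<open>{g = r}\<close>, and that the averages of \<open>\<bar>u\<bar>\<close> are at most
  \<open>\<integral> \<bar>u\<bar> \<bar>M\<^sup>*\<Psi>\<bar> + \<parallel>Mu\<parallel> \<parallel>\<Psi>\<parallel> d\<nu>\<close>, whatever the slab (\<open>slab_mean_bound\<close>). This last bound extends to all
  Sobolev functions and carries the rest of the construction.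

  The surface measure. Applied to minima of functions that vanish near the points of a dense
  sequence, the bound shows that slab averages are uniformly tight (\<open>tight_slab_mean\<close>). Together with
  the theorem of Stone and Weierstrass this gives convergence of slab averages for every bounded
  continuous function, and with Dini's theorem it makes the limit a Daniell functional. The theorem of
  Daniell and Stone represents the limit by a finite Borel measure, and this is the surface measure
  (\<open>surface_rep_measure\<close>). By the same bound, the trace exists and slab averages of \<open>\<phi> f\<close> converge to the
  surface integral of \<open>\<phi> T f\<close> for Sobolev functions \<open>f\<close> (\<open>slab_mean_tendsto_trace\<close>).

  The variational formula. Approximating the indicator of \<open>{g < r}\<close> by piecewise linear functions of
  \<open>g\<close> turns the integral of \<open>M\<^sup>*(\<phi> F)\<close> over \<open>{g < r}\<close> into the limit of the slab averages of
  \<open>- \<phi> \<langle>Mg, F\<rangle>\<close> (\<open>sublevel_integral\<close>). If \<open>\<parallel>F\<parallel> \<le> 1\<close>, these are at most the slab averages of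
  \<open>\<phi> \<parallel>Mg\<parallel>\<close>, which converge to the surface integral of \<open>\<phi> T(\<parallel>Mg\<parallel>)\<close>; for \<open>F = - Mg / \<parallel>Mg\<parallel>\<close> both
  coincide. It remains to see that \<open>\<parallel>Mg\<parallel>\<close> is a Sobolev function (\<open>graph_norm_field\<close>) and that
  \<open>- Mg / \<parallel>Mg\<parallel>\<close> is admissible: its components are quotients of Sobolev functions (\<open>graph_quotient\<close>),
  and it equals \<open>- \<parallel>Mg\<parallel> \<Psi>\<close>, to which the product rule for \<open>M\<^sup>*\<close> applies (\<open>direction_Mstar\<close>).

  Sobolev spaces and their gradients are handled through the closed graph \<open>M_graph\<close>, in which a pair
  may be changed on null sets. By closability the second component is determined by the first up to null
  sets, which links the graph to the chosen values of \<open>M_op\<close>.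
\<close>

section \<open>Convergence in Lebesgue spaces\<close>

lemma conj_exp_gt1: "1 < p \<Longrightarrow> 1 < conj_exp p"
  by (simp add: conj_exp_def field_simps)

lemma conj_exp_conj_exp: "1 < p \<Longrightarrow> conj_exp (conj_exp p) = p"
  by (simp add: conj_exp_def field_simps)

lemma conj_exp_less_iff: "1 < p \<Longrightarrow> 1 < q \<Longrightarrow> conj_exp p < q \<longleftrightarrow> conj_exp q < p"
  by (simp add: conj_exp_def field_simps)

lemma powr_add_le:
  fixes a b p :: real
  assumes "0 \<le> a" "0 \<le> b" "0 \<le> p"
  shows "(a + b) powr p \<le> 2 powr p * (a powr p + b powr p)"
proof -
  have "(a + b) powr p \<le> (2 * max a b) powr p"
    using assms by (intro powr_mono2) auto
  also have "\<dots> = 2 powr p * max a b powr p"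
    using assms by (simp add: powr_mult)
  also have "\<dots> \<le> 2 powr p * (a powr p + b powr p)"
    by (intro mult_left_mono) (auto simp: max_def)
  finally show ?thesis .
qed

text \<open>
  A crude form of Young's inequality, which holds because \<open>b \<le> a powr (p - 1)\<close> or
  \<open>a \<le> b powr (1 / (p - 1))\<close>. The parameter \<open>d\<close> trades one summand against the other.
\<close>

lemma crude_Young:
  fixes a b d p :: real
  assumes "0 \<le> a" "0 \<le> b" "1 < p" "0 < d"
  shows "a * b \<le> (1 / d) powr p * a powr p + d powr conj_exp p * b powr conj_exp p"
proof -
  have 1: "a * b \<le> a powr p + b powr conj_exp p" if ab: "0 < a" "0 < b" for a b :: real
  proof (cases "b \<le> a powr (p - 1)")
    case True
    have "a * b \<le> a * a powr (p - 1)" using True ab by (intro mult_left_mono) auto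
    also have "\<dots> = a powr p" using ab by (simp add: powr_mult_base)
    finally show ?thesis using powr_ge_zero[of b "conj_exp p"] by linarith
  next
    case False
    then have "(a powr (p - 1)) powr (1 / (p - 1)) \<le> b powr (1 / (p - 1))"
      using assms ab by (intro powr_mono2) auto
    then have "a \<le> b powr (1 / (p - 1))" using ab assms by (simp add: powr_powr)
    then have "a * b \<le> b powr (1 / (p - 1)) * b" using ab by (intro mult_right_mono) auto
    also have "\<dots> = b powr (1 + 1 / (p - 1))" using ab by (simp add: powr_add)
    also have "1 + 1 / (p - 1) = conj_exp p" using assms by (simp add: conj_exp_def field_simps)
    finally show ?thesis using powr_ge_zero[of a p] by linarith
  qed
  show ?thesis
  proof (cases "a = 0 \<or> b = 0")
    case False
    then have "a * b = ((1/d) * a) * (d * b)" using assms by simp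
    also have "\<dots> \<le> ((1/d) * a) powr p + (d * b) powr conj_exp p"
      using False assms by (intro 1) auto
    also have "\<dots> = (1 / d) powr p * a powr p + d powr conj_exp p * b powr conj_exp p"
      using assms by (simp only: powr_mult)
    finally show ?thesis .
  qed auto
qed

lemma LpD_measurable: "f \<in> Lp M p \<Longrightarrow> f \<in> borel_measurable M"
  by (simp add: Lp_def)

lemma LpD_integrable: "f \<in> Lp M p \<Longrightarrow> integrable M (\<lambda>x. norm (f x) powr p)"
  by (simp add: Lp_def)

lemma Lp_dominated:
  fixes f :: "'a \<Rightarrow> 'b::real_normed_vector" and w :: "'a \<Rightarrow> real"
  assumes f: "f \<in> borel_measurable M" and w: "w \<in> Lp M p"
    and le: "AE x in M. norm (f x) \<le> w x" and p: "0 \<le> p"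
  shows "f \<in> Lp M p"
proof -
  have "integrable M (\<lambda>x. norm (f x) powr p)"
  proof (rule Bochner_Integration.integrable_bound[OF LpD_integrable[OF w]])
    show "(\<lambda>x. norm (f x) powr p) \<in> borel_measurable M" using f by measurable
    show "AE x in M. norm (norm (f x) powr p) \<le> norm (norm (w x) powr p)"
      using le p by (auto intro!: powr_mono2)
  qed
  with f show ?thesis by (simp add: Lp_def)
qed

lemma Lp_norm_fun: "f \<in> Lp M p \<Longrightarrow> (\<lambda>x. norm (f x)) \<in> Lp M p"
  by (auto simp: Lp_def)

lemma Lp_AE_cong:
  assumes "f \<in> Lp M p" "f' \<in> borel_measurable M" "AE x in M. f x = f' x" "0 \<le> p"
  shows "f' \<in> Lp M p"
  by (rule Lp_dominated[OF assms(2) Lp_norm_fun[OF assms(1)] _ assms(4)]) (use assms(3) in auto)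

lemma Lp_scaleR:
  fixes f :: "'a \<Rightarrow> 'b::real_normed_vector"
  assumes "f \<in> Lp M p" shows "(\<lambda>x. c *\<^sub>R f x) \<in> Lp M p"
  using assms by (auto simp: Lp_def powr_mult intro!: borel_measurable_scaleR)

lemma Lp_cmult: "f \<in> Lp M p \<Longrightarrow> (\<lambda>x. c * f x :: real) \<in> Lp M p"
  using Lp_scaleR[of f M p c] by simp

lemma Lp_minus:
  fixes f :: "'a \<Rightarrow> 'b::real_normed_vector"
  shows "f \<in> Lp M p \<Longrightarrow> (\<lambda>x. - f x) \<in> Lp M p"
  using Lp_scaleR[of f M p "-1"] by simp

lemma Lp_add:
  fixes f g :: "'a \<Rightarrow> 'b::{real_normed_vector, second_countable_topology}"
  assumes f: "f \<in> Lp M p" and g: "g \<in> Lp M p" and p: "0 \<le> p"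
  shows "(\<lambda>x. f x + g x) \<in> Lp M p"
proof -
  have m: "f \<in> borel_measurable M" "g \<in> borel_measurable M"
    using f g by (auto dest: LpD_measurable)
  have "integrable M (\<lambda>x. norm (f x + g x) powr p)"
  proof (rule Bochner_Integration.integrable_bound)
    show "integrable M (\<lambda>x. 2 powr p * (norm (f x) powr p + norm (g x) powr p))"
      using LpD_integrable[OF f] LpD_integrable[OF g] by auto
    show "(\<lambda>x. norm (f x + g x) powr p) \<in> borel_measurable M" using m by measurable
    have "norm (f x + g x) powr p \<le> 2 powr p * (norm (f x) powr p + norm (g x) powr p)" for x
      using p by (intro order_trans[OF powr_mono2 powr_add_le]) (auto intro: norm_triangle_ineq)
    then show "AE x in M. norm (norm (f x + g x) powr p)
        \<le> norm (2 powr p * (norm (f x) powr p + norm (g x) powr p))"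
      by auto
  qed
  with m show ?thesis by (simp add: Lp_def)
qed

lemma Lp_diff:
  fixes f g :: "'a \<Rightarrow> 'b::{real_normed_vector, second_countable_topology}"
  assumes "f \<in> Lp M p" "g \<in> Lp M p" "0 \<le> p"
  shows "(\<lambda>x. f x - g x) \<in> Lp M p"
  using Lp_add[OF assms(1) Lp_minus[OF assms(2)] assms(3)] by simp

lemma (in finite_measure) Lp_bounded:
  assumes "f \<in> borel_measurable M" "AE x in M. norm (f x) \<le> C" "0 \<le> p"
  shows "f \<in> Lp M p"
proof (rule Lp_dominated[OF assms(1) _ assms(2,3)])
  show "(\<lambda>_. C) \<in> Lp M p" by (simp add: Lp_def)
qed

lemma (in finite_measure) Lp_mono_exponent:
  fixes f :: "'a \<Rightarrow> 'b::real_normed_vector"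
  assumes f: "f \<in> Lp M p" and "0 \<le> p'" "p' \<le> p"
  shows "f \<in> Lp M p'"
proof -
  have m: "f \<in> borel_measurable M" using f by (auto dest: LpD_measurable)
  have "integrable M (\<lambda>x. norm (f x) powr p')"
  proof (rule Bochner_Integration.integrable_bound)
    show "integrable M (\<lambda>x. 1 + norm (f x) powr p)" using LpD_integrable[OF f] by auto
    show "(\<lambda>x. norm (f x) powr p') \<in> borel_measurable M" using m by measurable
    have "norm (f x) powr p' \<le> 1 + norm (f x) powr p" for x
    proof (cases "norm (f x) \<le> 1")
      case True
      then have "norm (f x) powr p' \<le> 1 powr p'" using assms by (intro powr_mono2) auto
      then show ?thesis by (simp add: add_increasing2)
    next
      case False
      then have "norm (f x) powr p' \<le> norm (f x) powr p" using assms by (intro powr_mono) auto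
      then show ?thesis by simp
    qed
    then show "AE x in M. norm (norm (f x) powr p') \<le> norm (1 + norm (f x) powr p)"
      by (auto simp: add_nonneg_nonneg)
  qed
  with m show ?thesis by (simp add: Lp_def)
qed

lemma (in finite_measure) Lp_integrable:
  fixes f :: "'a \<Rightarrow> 'b::{banach, second_countable_topology}"
  assumes "f \<in> Lp M p" "1 \<le> p"
  shows "integrable M f"
proof -
  have "f \<in> Lp M 1" using assms by (intro Lp_mono_exponent[OF assms(1)]) auto
  then show ?thesis by (auto simp: Lp_def integrable_norm_iff)
qed

lemma integrable_mult_Lp:
  fixes f :: "'a \<Rightarrow> 'b::{real_normed_vector}" and g :: "'a \<Rightarrow> 'c::{real_normed_vector}"
  assumes f: "f \<in> Lp M p" and g: "g \<in> Lp M (conj_exp p)" and p: "1 < p"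
  shows "integrable M (\<lambda>x. norm (f x) * norm (g x))"
proof (rule Bochner_Integration.integrable_bound)
  show "integrable M (\<lambda>x. norm (f x) powr p + norm (g x) powr conj_exp p)"
    using LpD_integrable[OF f] LpD_integrable[OF g] by auto
  show "(\<lambda>x. norm (f x) * norm (g x)) \<in> borel_measurable M"
    using f g by (auto dest!: LpD_measurable)
  show "AE x in M. norm (norm (f x) * norm (g x)) \<le> norm (norm (f x) powr p + norm (g x) powr conj_exp p)"
    using crude_Young[OF norm_ge_zero norm_ge_zero p zero_less_one] by auto
qed

text \<open>
  Hoelder's inequality for the exponents \<open>a / p\<close> and its conjugate; the second factor has every
  integrability that the conjugate exponent may ask for.
\<close>

lemma Lp_mult_exponents:
  fixes f g :: "'a \<Rightarrow> real"
  assumes f: "f \<in> Lp M a" and g: "\<And>b. 1 < b \<Longrightarrow> g \<in> Lp M b" and p: "1 \<le> p" "p < a"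
  shows "(\<lambda>x. f x * g x) \<in> Lp M p"
proof -
  have r: "1 < a / p" using p by (simp add: field_simps)
  have "(\<lambda>x. \<bar>f x\<bar> powr p) \<in> Lp M (a / p)"
    using f p by (auto simp: Lp_def powr_powr)
  moreover have "1 < p * conj_exp (a / p)" 
    using p conj_exp_gt1[OF r] mult_right_mono[of 1 p "conj_exp (a / p)"] by linarith
  then have "(\<lambda>x. \<bar>g x\<bar> powr p) \<in> Lp M (conj_exp (a / p))"
    using g[of "p * conj_exp (a / p)"] by (auto simp: Lp_def powr_powr)
  ultimately have "integrable M (\<lambda>x. \<bar>f x\<bar> powr p * \<bar>g x\<bar> powr p)"
    using integrable_mult_Lp[OF _ _ r] by fastforce
  moreover have "g \<in> borel_measurable M" using g[of 2] by (auto dest: LpD_measurable)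
  ultimately show ?thesis using f by (auto simp: Lp_def abs_mult powr_mult)
qed

lemma integrable_bounded_mult:
  fixes u v :: "'a \<Rightarrow> real"
  assumes u: "u \<in> borel_measurable M" "\<And>x. \<bar>u x\<bar> \<le> A" and v: "integrable M v"
  shows "integrable M (\<lambda>x. u x * v x)"
proof (rule Bochner_Integration.integrable_bound)
  show "integrable M (\<lambda>x. A * v x)" using v by simp
  show "(\<lambda>x. u x * v x) \<in> borel_measurable M" using u(1) borel_measurable_integrable[OF v] by measurable
  have "\<bar>u x\<bar> \<le> \<bar>A\<bar>" for x using u(2)[of x] by linarith
  then show "AE x in M. norm (u x * v x) \<le> norm (A * v x)"
    by (auto simp: abs_mult intro!: mult_right_mono)
qed

lemma Lp_bounded_scaleR:
  fixes f :: "'a \<Rightarrow> 'b::{real_normed_vector, second_countable_topology}"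
  assumes u: "u \<in> borel_measurable M" "\<And>x. \<bar>u x\<bar> \<le> A" and f: "f \<in> Lp M p" and p: "0 \<le> p"
  shows "(\<lambda>x. u x *\<^sub>R f x) \<in> Lp M p"
  using u LpD_measurable[OF f]
  by (intro Lp_dominated[OF _ Lp_cmult[OF Lp_norm_fun[OF f], of A] _ p]) (auto intro!: mult_right_mono)

subsection \<open>Convergence\<close>

text \<open>
  Without the \<open>p\<close>-th root the distances are integrals, to which the limit theorems apply.
\<close>

lemma Lp_tendsto_iff:
  assumes "0 < p"
  shows "Lp_tendsto M p f l \<longleftrightarrow> (\<forall>n. f n \<in> Lp M p) \<and> l \<in> Lp M p \<and>
    (\<lambda>n. LINT x|M. norm (f n x - l x) powr p) \<longlonglongrightarrow> 0"
proof -
  let ?I = "\<lambda>n. LINT x|M. norm (f n x - l x) powr p"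
  have pos: "0 \<le> ?I n" for n by simp
  have "(\<lambda>n. ?I n powr (1/p)) \<longlonglongrightarrow> 0 \<longleftrightarrow> ?I \<longlonglongrightarrow> 0"
  proof
    assume "(\<lambda>n. ?I n powr (1/p)) \<longlonglongrightarrow> 0"
    then have "(\<lambda>n. (?I n powr (1/p)) powr p) \<longlonglongrightarrow> 0 powr p"
      by (rule tendsto_powr2) (use assms in auto)
    then show "?I \<longlonglongrightarrow> 0" using assms pos by (simp add: powr_powr)
  next
    assume "?I \<longlonglongrightarrow> 0"
    then have "(\<lambda>n. ?I n powr (1/p)) \<longlonglongrightarrow> 0 powr (1/p)"
      by (rule tendsto_powr2) (use assms pos in auto)
    then show "(\<lambda>n. ?I n powr (1/p)) \<longlonglongrightarrow> 0" by simp
  qed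
  then show ?thesis by (simp add: Lp_tendsto_def Lp_norm_def)
qed

lemma Lp_tendsto_Lp: "Lp_tendsto M p f l \<Longrightarrow> f n \<in> Lp M p"
  and Lp_tendsto_Lp_limit: "Lp_tendsto M p f l \<Longrightarrow> l \<in> Lp M p"
  by (simp_all add: Lp_tendsto_def)

lemma Lp_tendsto_const: "f \<in> Lp M p \<Longrightarrow> Lp_tendsto M p (\<lambda>_. f) f"
  by (simp add: Lp_tendsto_def Lp_norm_def)

lemma Lp_tendsto_subseq:
  assumes "Lp_tendsto M p f l" "strict_mono s"
  shows "Lp_tendsto M p (\<lambda>n. f (s n)) l"
  using assms LIMSEQ_subseq_LIMSEQ[of _ 0 s] by (fastforce simp: Lp_tendsto_def o_def)

lemma Lp_tendsto_squeeze:
  fixes f :: "nat \<Rightarrow> 'a \<Rightarrow> 'b::{real_normed_vector, second_countable_topology}"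
  assumes f: "\<And>n. f n \<in> borel_measurable M" and l: "l \<in> Lp M p" and p: "0 < p"
    and w: "Lp_tendsto M p w (\<lambda>_. 0::real)"
    and le: "\<And>n. AE x in M. norm (f n x - l x) \<le> w n x"
  shows "Lp_tendsto M p f l"
proof -
  have lm[measurable]: "l \<in> borel_measurable M" using l by (rule LpD_measurable)
  note [measurable] = f
  have d: "(\<lambda>x. f n x - l x) \<in> Lp M p" for n
    by (rule Lp_dominated[OF _ Lp_tendsto_Lp[OF w, of n] le]) (use p in auto)
  have "f n \<in> Lp M p" for n using Lp_add[OF d[of n] l] p by simp
  moreover have "(\<lambda>n. LINT x|M. norm (f n x - l x) powr p) \<longlonglongrightarrow> 0"
  proof (rule tendsto_sandwich[OF _ _ tendsto_const])
    show "(\<lambda>n. LINT x|M. norm (w n x - 0) powr p) \<longlonglongrightarrow> 0"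
      using w Lp_tendsto_iff[OF p, of M w "\<lambda>_. 0"] by auto
    have "(LINT x|M. norm (f n x - l x) powr p) \<le> (LINT x|M. norm (w n x - 0) powr p)" for n
    proof (rule integral_mono_AE)
      show "integrable M (\<lambda>x. norm (f n x - l x) powr p)" by (rule LpD_integrable[OF d])
      show "integrable M (\<lambda>x. norm (w n x - 0) powr p)"
        using LpD_integrable[OF Lp_tendsto_Lp[OF w, of n]] by simp
      show "AE x in M. norm (f n x - l x) powr p \<le> norm (w n x - 0) powr p"
        using le[of n] by eventually_elim (use p in \<open>auto intro!: powr_mono2\<close>)
    qed
    then show "eventually (\<lambda>n. (LINT x|M. norm (f n x - l x) powr p) \<le> (LINT x|M. norm (w n x - 0) powr p)) sequentially"
      by simp
  qed simp
  ultimately show ?thesis using l p by (simp add: Lp_tendsto_iff)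
qed

lemma Lp_tendsto_norm_diff:
  fixes f :: "nat \<Rightarrow> 'a \<Rightarrow> 'b::{real_normed_vector, second_countable_topology}"
  assumes "Lp_tendsto M p f l" "0 < p"
  shows "Lp_tendsto M p (\<lambda>n x. norm (f n x - l x)) (\<lambda>_. 0)"
  using assms Lp_norm_fun[OF Lp_diff[OF Lp_tendsto_Lp[OF assms(1)] Lp_tendsto_Lp_limit[OF assms(1)]]]
  by (auto simp: Lp_tendsto_def Lp_norm_def) (simp add: Lp_def)

lemma Lp_tendsto_scaleR:
  fixes f :: "nat \<Rightarrow> 'a \<Rightarrow> 'b::{real_normed_vector, second_countable_topology}"
  assumes f: "Lp_tendsto M p f l" and p: "0 < p"
  shows "Lp_tendsto M p (\<lambda>n x. c *\<^sub>R f n x) (\<lambda>x. c *\<^sub>R l x)"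
proof -
  have "(\<lambda>n. \<bar>c\<bar> powr p * (LINT x|M. norm (f n x - l x) powr p)) \<longlonglongrightarrow> \<bar>c\<bar> powr p * 0"
    using f p by (intro tendsto_mult_left) (simp add: Lp_tendsto_iff)
  then show ?thesis using f p
    by (simp add: Lp_tendsto_iff Lp_scaleR powr_mult flip: scaleR_diff_right)
qed

lemma Lp_tendsto_add:
  fixes f :: "nat \<Rightarrow> 'a \<Rightarrow> 'b::{real_normed_vector, second_countable_topology}"
  assumes f: "Lp_tendsto M p f l" and g: "Lp_tendsto M p g k" and p: "0 < p"
  shows "Lp_tendsto M p (\<lambda>n x. f n x + g n x) (\<lambda>x. l x + k x)"
proof -
  have fg: "(\<lambda>x. f n x - l x) \<in> Lp M p" "(\<lambda>x. g n x - k x) \<in> Lp M p" for n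
    using p by (auto intro!: Lp_diff Lp_tendsto_Lp[OF f] Lp_tendsto_Lp[OF g]
        Lp_tendsto_Lp_limit[OF f] Lp_tendsto_Lp_limit[OF g])
  have sum: "(\<lambda>x. f n x + g n x) \<in> Lp M p" "(\<lambda>x. l x + k x) \<in> Lp M p" for n
    using p by (auto intro!: Lp_add Lp_tendsto_Lp[OF f] Lp_tendsto_Lp[OF g]
        Lp_tendsto_Lp_limit[OF f] Lp_tendsto_Lp_limit[OF g])
  let ?F = "\<lambda>n. LINT x|M. norm (f n x - l x) powr p" and ?G = "\<lambda>n. LINT x|M. norm (g n x - k x) powr p"
  have "(\<lambda>n. LINT x|M. norm (f n x + g n x - (l x + k x)) powr p) \<longlonglongrightarrow> 0"
  proof (rule tendsto_sandwich[OF _ _ tendsto_const])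
    have "?F \<longlonglongrightarrow> 0" "?G \<longlonglongrightarrow> 0" using f g p by (simp_all add: Lp_tendsto_iff)
    then have "(\<lambda>n. 2 powr p * (?F n + ?G n)) \<longlonglongrightarrow> 2 powr p * (0 + 0)"
      by (intro tendsto_intros)
    then show "(\<lambda>n. 2 powr p * (?F n + ?G n)) \<longlonglongrightarrow> 0" by simp
    have "(LINT x|M. norm (f n x + g n x - (l x + k x)) powr p)
      \<le> (LINT x|M. 2 powr p * (norm (f n x - l x) powr p + norm (g n x - k x) powr p))" for n
    proof (rule integral_mono)
      show "integrable M (\<lambda>x. norm (f n x + g n x - (l x + k x)) powr p)"
        using p by (intro LpD_integrable Lp_diff sum) auto
      show "integrable M (\<lambda>x. 2 powr p * (norm (f n x - l x) powr p + norm (g n x - k x) powr p))"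
        using fg[THEN LpD_integrable] by auto
      show "norm (f n x + g n x - (l x + k x)) powr p
        \<le> 2 powr p * (norm (f n x - l x) powr p + norm (g n x - k x) powr p)" for x
        using p by (intro order_trans[OF powr_mono2 powr_add_le])
          (auto simp: add_diff_add intro: norm_triangle_ineq)
    qed
    also have "\<dots> n = 2 powr p * (?F n + ?G n)" for n
      using fg[THEN LpD_integrable] by simp
    finally show "eventually (\<lambda>n. (LINT x|M. norm (f n x + g n x - (l x + k x)) powr p)
       \<le> 2 powr p * (?F n + ?G n)) sequentially" by simp
  qed simp
  with sum p show ?thesis by (simp add: Lp_tendsto_iff)
qed

text \<open>
  Dominated convergence, applied to \<open>norm (f n x - l x) powr p\<close>.
\<close>

lemma Lp_tendsto_dominated:
  fixes f :: "nat \<Rightarrow> 'a \<Rightarrow> 'b::{real_normed_vector, second_countable_topology}"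
  assumes f: "\<And>n. f n \<in> borel_measurable M" and l: "l \<in> borel_measurable M"
    and w: "w \<in> Lp M p" and p: "0 < p"
    and le: "\<And>n. AE x in M. norm (f n x) \<le> w x"
    and lim: "AE x in M. (\<lambda>n. f n x) \<longlonglongrightarrow> l x"
  shows "Lp_tendsto M p f l"
proof -
  note [measurable] = f l
  have le': "AE x in M. \<forall>n. norm (f n x) \<le> w x" using le by (simp add: AE_all_countable)
  have lel: "AE x in M. norm (l x) \<le> w x"
    using le' lim by eventually_elim (auto intro: LIMSEQ_le_const2[OF tendsto_norm])
  have fl: "f n \<in> Lp M p" "l \<in> Lp M p" for n
    using Lp_dominated[OF f w le] Lp_dominated[OF l w lel] p by auto
  have "(\<lambda>n. LINT x|M. norm (f n x - l x) powr p) \<longlonglongrightarrow> (LINT x|M. 0)"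
  proof (rule integral_dominated_convergence)
    show "integrable M (\<lambda>x. 2 powr p * (\<bar>w x\<bar> powr p + \<bar>w x\<bar> powr p))"
      using LpD_integrable[OF w] by auto
    show "AE x in M. (\<lambda>n. norm (f n x - l x) powr p) \<longlonglongrightarrow> 0"
      using lim
    proof eventually_elim
      case (elim x)
      then have "(\<lambda>n. norm (f n x - l x)) \<longlonglongrightarrow> 0" by (simp add: LIM_zero tendsto_norm_zero)
      then have "(\<lambda>n. norm (f n x - l x) powr p) \<longlonglongrightarrow> 0 powr p"
        by (rule tendsto_powr2) (use p in auto)
      then show ?case by simp
    qed
    show "AE x in M. norm (norm (f n x - l x) powr p) \<le> 2 powr p * (\<bar>w x\<bar> powr p + \<bar>w x\<bar> powr p)" for n
      using le[of n] lel
    proof eventually_elim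
      case (elim x)
      have "norm (f n x - l x) powr p \<le> (\<bar>w x\<bar> + \<bar>w x\<bar>) powr p"
        using elim p by (intro powr_mono2) (auto intro!: order_trans[OF norm_triangle_ineq4] add_mono)
      also have "\<dots> \<le> 2 powr p * (\<bar>w x\<bar> powr p + \<bar>w x\<bar> powr p)"
        using p by (intro powr_add_le) auto
      finally show ?case by simp
    qed
  qed auto
  with fl p show ?thesis by (simp add: Lp_tendsto_iff)
qed

lemma Lp_tendsto_AE_subseq:
  fixes f :: "nat \<Rightarrow> 'a \<Rightarrow> 'b::{real_normed_vector, second_countable_topology}"
  assumes f: "Lp_tendsto M p f l" and p: "0 < p"
  obtains s where "strict_mono s" "AE x in M. (\<lambda>n. f (s n) x) \<longlonglongrightarrow> l x"
proof -
  have fl: "(\<lambda>x. f n x - l x) \<in> Lp M p" for n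
    using p by (auto intro!: Lp_diff Lp_tendsto_Lp[OF f] Lp_tendsto_Lp_limit[OF f])
  have "(\<lambda>n. LINT x|M. norm (norm (f n x - l x) powr p)) \<longlonglongrightarrow> 0"
    using f p by (simp add: Lp_tendsto_iff)
  from tendsto_L1_AE_subseq[OF LpD_integrable[OF fl] this]
  obtain s where s: "strict_mono s" "AE x in M. (\<lambda>n. norm (f (s n) x - l x) powr p) \<longlonglongrightarrow> 0"
    by auto
  have "AE x in M. (\<lambda>n. f (s n) x) \<longlonglongrightarrow> l x" using s(2)
  proof eventually_elim
    case (elim x)
    then have "(\<lambda>n. (norm (f (s n) x - l x) powr p) powr (1/p)) \<longlonglongrightarrow> 0 powr (1/p)"
      by (rule tendsto_powr2) (use p in auto)
    then have "(\<lambda>n. norm (f (s n) x - l x)) \<longlonglongrightarrow> 0" using p by (simp add: powr_powr)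
    then show ?case by (simp add: LIM_zero_iff tendsto_norm_zero_iff)
  qed
  with s(1) show thesis by (rule that)
qed

text \<open>
  Hoelder's inequality for null sequences. In \<open>crude_Young\<close> the parameter is chosen first, so that
  the summand with the fixed factor \<open>w\<close> is small; the other summand then tends to zero.
\<close>

lemma Lp_tendsto_pairing:
  fixes f :: "nat \<Rightarrow> 'a \<Rightarrow> 'b::{real_normed_vector, second_countable_topology}"
    and w :: "'a \<Rightarrow> 'c::real_normed_vector"
  assumes f: "Lp_tendsto M p f l" and w: "w \<in> Lp M (conj_exp p)" and p: "1 < p"
  shows "(\<lambda>n. LINT x|M. norm (f n x - l x) * norm (w x)) \<longlonglongrightarrow> 0"
proof (rule LIMSEQ_I)
  fix e :: real assume e: "0 < e"
  have fl: "(\<lambda>x. f n x - l x) \<in> Lp M p" for n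
    using p by (auto intro!: Lp_diff Lp_tendsto_Lp[OF f] Lp_tendsto_Lp_limit[OF f])
  let ?W = "LINT x|M. norm (w x) powr conj_exp p"
  define I where "I n = (LINT x|M. norm (f n x - l x) powr p)" for n
  have cp: "0 < conj_exp p" using conj_exp_gt1[OF p] by simp
  have W: "0 \<le> ?W" by simp
  define d where "d = (e / (2 * (?W + 1))) powr (1 / conj_exp p)"
  have d: "0 < d" using e W by (simp add: d_def add_nonneg_eq_0_iff)
  have "d powr conj_exp p = e / (2 * (?W + 1))" using cp e W by (simp add: d_def powr_powr)
  also have "\<dots> * ?W < e / 2"
  proof -
    have "e / (2 * (V + 1)) * V < e / 2" if "0 \<le> V" for V :: real
      using that e by (simp add: field_simps)
    from this[OF W] show ?thesis .
  qed
  finally have dW: "d powr conj_exp p * ?W < e / 2" .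
  have "I \<longlonglongrightarrow> 0" using f p unfolding I_def by (simp add: Lp_tendsto_iff)
  then have "(\<lambda>n. (1/d) powr p * I n) \<longlonglongrightarrow> (1/d) powr p * 0" by (rule tendsto_mult_left)
  then have "eventually (\<lambda>n. (1/d) powr p * I n < e / 2) sequentially"
    using e by (intro order_tendstoD) auto
  then obtain N where N: "\<And>n. n \<ge> N \<Longrightarrow> (1/d) powr p * I n < e / 2"
    by (auto simp: eventually_sequentially)
  have "(LINT x|M. norm (f n x - l x) * norm (w x)) < e" if "n \<ge> N" for n
  proof -
    have "(LINT x|M. norm (f n x - l x) * norm (w x))
      \<le> (LINT x|M. (1/d) powr p * norm (f n x - l x) powr p + d powr conj_exp p * norm (w x) powr conj_exp p)"
    proof (rule integral_mono)
      show "integrable M (\<lambda>x. norm (f n x - l x) * norm (w x))"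
        by (rule integrable_mult_Lp[OF fl w p])
      show "integrable M (\<lambda>x. (1/d) powr p * norm (f n x - l x) powr p + d powr conj_exp p * norm (w x) powr conj_exp p)"
        using LpD_integrable[OF fl] LpD_integrable[OF w] by auto
    qed (use crude_Young d p in auto)
    also have "\<dots> = (1/d) powr p * I n + d powr conj_exp p * ?W"
      using LpD_integrable[OF fl] LpD_integrable[OF w] by (simp add: I_def)
    also have "\<dots> < e" using dW N[OF that] by simp
    finally show ?thesis .
  qed
  then show "\<exists>N. \<forall>n\<ge>N. norm ((LINT x|M. norm (f n x - l x) * norm (w x)) - 0) < e"
    by (auto intro!: exI[of _ N])
qed

text \<open>
  The powers \<open>norm (f n x - l x) powr p'\<close> tend to zero with exponent \<open>p / p'\<close>, and are paired
  with the constant \<open>1\<close>.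
\<close>

lemma (in finite_measure) Lp_tendsto_mono_exponent:
  fixes f :: "nat \<Rightarrow> 'a \<Rightarrow> 'b::{real_normed_vector, second_countable_topology}"
  assumes f: "Lp_tendsto M p f l" and p: "0 < p'" "p' \<le> p"
  shows "Lp_tendsto M p' f l"
proof (cases "p' = p")
  case False
  then have r: "1 < p / p'" using p by simp
  have 0: "(\<lambda>x. f n x - l x) \<in> Lp M p" for n
    using p by (auto intro!: Lp_diff Lp_tendsto_Lp[OF f] Lp_tendsto_Lp_limit[OF f])
  have "Lp_tendsto M (p / p') (\<lambda>n x. norm (f n x - l x) powr p') (\<lambda>_. 0)"
  proof -
    have "(\<lambda>x. norm (f n x - l x) powr p') \<in> Lp M (p / p')" for n
      using 0[of n] p by (auto simp: Lp_def powr_powr)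
    moreover have "(\<lambda>_. 0::real) \<in> Lp M (p / p')" by (simp add: Lp_def)
    ultimately show ?thesis using f r p by (simp add: Lp_tendsto_iff powr_powr)
  qed
  from Lp_tendsto_pairing[OF this _ r, of "\<lambda>_. 1::real"]
  have "(\<lambda>n. LINT x|M. norm (f n x - l x) powr p') \<longlonglongrightarrow> 0"
    by (simp add: Lp_def)
  moreover have "f n \<in> Lp M p'" "l \<in> Lp M p'" for n
    using p by (auto intro!: Lp_mono_exponent[OF Lp_tendsto_Lp[OF f]]
        Lp_mono_exponent[OF Lp_tendsto_Lp_limit[OF f]])
  ultimately show ?thesis using p by (simp add: Lp_tendsto_iff)
qed (use f in simp)

section \<open>Bounded functions with continuous bounded gradient\<close>

lemma grad_eqI:
  assumes "GDERIV f x :> D" shows "grad f x = D"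
proof -
  have "D' = D" if "GDERIV f x :> D'" for D'
  proof -
    have "(\<lambda>h. inner h D') = (\<lambda>h. inner h D)"
      using that assms unfolding gderiv_def by (rule has_derivative_unique)
    then have "inner (D' - D) D' = inner (D' - D) D" by metis
    then have "inner (D' - D) (D' - D) = 0" by (simp add: inner_diff_right)
    then show ?thesis by simp
  qed
  with assms show ?thesis unfolding grad_def by (intro the_equality)
qed

lemma C1bI:
  assumes "\<And>x. GDERIV f x :> D x" "continuous_on UNIV D" "\<And>x. \<bar>f x\<bar> \<le> A" "\<And>x. norm (D x) \<le> B"
  shows "f \<in> C1b" and "grad f = D"
proof -
  show g: "grad f = D" using grad_eqI[OF assms(1)] by (rule ext)
  show "f \<in> C1b" using assms by (auto simp: C1b_def g bounded_iff)
qed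

lemma C1b_GDERIV: "f \<in> C1b \<Longrightarrow> GDERIV f x :> grad f x"
  and C1b_continuous_grad: "f \<in> C1b \<Longrightarrow> continuous_on UNIV (grad f)"
  by (simp_all add: C1b_def)

lemma C1b_continuous: "f \<in> C1b \<Longrightarrow> continuous_on UNIV f"
  by (meson C1b_GDERIV continuous_at_imp_continuous_on gderiv_def has_derivative_continuous)

lemma C1b_bounded:
  assumes "f \<in> C1b"
  obtains A B where "\<And>x. \<bar>f x\<bar> \<le> A" "\<And>x. norm (grad f x) \<le> B"
  using assms by (auto simp: C1b_def bounded_iff)

lemma C1b_const: "(\<lambda>x. c) \<in> C1b" and grad_const: "grad (\<lambda>x. c) = (\<lambda>x. 0)"
  using C1bI[of "\<lambda>x. c" "\<lambda>x. 0" "\<bar>c\<bar>" 0] GDERIV_const by auto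

lemma
  assumes f: "f \<in> C1b" and g: "g \<in> C1b"
  shows C1b_mult: "(\<lambda>x. f x * g x) \<in> C1b"
    and grad_mult: "grad (\<lambda>x. f x * g x) = (\<lambda>x. f x *\<^sub>R grad g x + g x *\<^sub>R grad f x)"
proof -
  obtain A B where f': "\<And>x. \<bar>f x\<bar> \<le> A" "\<And>x. norm (grad f x) \<le> B" using f by (rule C1b_bounded) auto
  obtain C D where g': "\<And>x. \<bar>g x\<bar> \<le> C" "\<And>x. norm (grad g x) \<le> D" using g by (rule C1b_bounded) auto
  have nn: "0 \<le> A" "0 \<le> B" "0 \<le> C" "0 \<le> D"
    using order_trans[OF abs_ge_zero f'(1)] order_trans[OF norm_ge_zero f'(2)]
      order_trans[OF abs_ge_zero g'(1)] order_trans[OF norm_ge_zero g'(2)] by auto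
  have "\<bar>f x * g x\<bar> \<le> A * C" for x
    using f'(1)[of x] g'(1)[of x] nn by (auto simp: abs_mult intro!: mult_mono)
  moreover have "norm (f x *\<^sub>R grad g x + g x *\<^sub>R grad f x) \<le> A * D + C * B" for x
    using f'[of x] g'[of x] nn by (intro norm_triangle_mono) (auto intro!: mult_mono)
  ultimately show "(\<lambda>x. f x * g x) \<in> C1b" "grad (\<lambda>x. f x * g x) = (\<lambda>x. f x *\<^sub>R grad g x + g x *\<^sub>R grad f x)"
    using f g by (auto intro!: C1bI GDERIV_mult C1b_GDERIV continuous_intros C1b_continuous C1b_continuous_grad)
qed

text \<open>
  A continuously differentiable function of two real variables with bounded partial derivatives
  \<open>K1\<close>, \<open>K2\<close>; such functions operate on every Sobolev space.
\<close>

definition C1_Lip2 where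
  "C1_Lip2 K K1 K2 \<longleftrightarrow>
     (\<forall>a b. ((\<lambda>z. K (fst z) (snd z)) has_derivative (\<lambda>z. fst z * K1 a b + snd z * K2 a b)) (at (a, b))) \<and>
     continuous_on UNIV (\<lambda>z. K1 (fst z) (snd z)) \<and> continuous_on UNIV (\<lambda>z. K2 (fst z) (snd z)) \<and>
     (\<exists>L. \<forall>a b. \<bar>K1 a b\<bar> \<le> L \<and> \<bar>K2 a b\<bar> \<le> (L::real))"

lemma C1_Lip2_Lipschitz:
  assumes K: "C1_Lip2 K K1 K2" and L: "\<And>a b. \<bar>K1 a b\<bar> \<le> L" "\<And>a b. \<bar>K2 a b\<bar> \<le> L"
  shows "\<bar>K a b - K c d\<bar> \<le> L * \<bar>a - c\<bar> + L * \<bar>b - d\<bar>"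
proof -
  let ?\<gamma> = "\<lambda>t. (c + t * (a - c), d + t * (b - d))"
  let ?D = "\<lambda>t h. (h * (a - c)) * K1 (fst (?\<gamma> t)) (snd (?\<gamma> t)) + (h * (b - d)) * K2 (fst (?\<gamma> t)) (snd (?\<gamma> t))"
  have "((\<lambda>t. K (fst (?\<gamma> t)) (snd (?\<gamma> t))) has_derivative ?D t) (at t within {0..1})" for t
  proof -
    have "(?\<gamma> has_derivative (\<lambda>h. (h * (a - c), h * (b - d)))) (at t within {0..1})"
      by (auto intro!: derivative_eq_intros)
    moreover have "((\<lambda>z. K (fst z) (snd z)) has_derivative
      (\<lambda>z. fst z * K1 (fst (?\<gamma> t)) (snd (?\<gamma> t)) + snd z * K2 (fst (?\<gamma> t)) (snd (?\<gamma> t)))) (at (?\<gamma> t))"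
      using K by (simp add: C1_Lip2_def)
    ultimately show ?thesis by (auto dest: has_derivative_compose)
  qed
  then obtain t where "K (fst (?\<gamma> 1)) (snd (?\<gamma> 1)) - K (fst (?\<gamma> 0)) (snd (?\<gamma> 0)) = ?D t (1 - 0)"
    using mvt_simple[of 0 1 "\<lambda>t. K (fst (?\<gamma> t)) (snd (?\<gamma> t))" ?D] by auto
  then have "\<bar>K a b - K c d\<bar> = \<bar>(a - c) * K1 (fst (?\<gamma> t)) (snd (?\<gamma> t)) + (b - d) * K2 (fst (?\<gamma> t)) (snd (?\<gamma> t))\<bar>"
    by simp
  also have "\<dots> \<le> \<bar>a - c\<bar> * L + \<bar>b - d\<bar> * L"
    using L by (intro order_trans[OF abs_triangle_ineq] add_mono) (auto simp: abs_mult intro!: mult_left_mono)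
  finally show ?thesis by (simp add: mult.commute)
qed

lemma
  assumes K: "C1_Lip2 K K1 K2" and f: "f \<in> C1b" and g: "g \<in> C1b"
  shows C1b_chain: "(\<lambda>x. K (f x) (g x)) \<in> C1b"
    and grad_chain: "grad (\<lambda>x. K (f x) (g x)) = (\<lambda>x. K1 (f x) (g x) *\<^sub>R grad f x + K2 (f x) (g x) *\<^sub>R grad g x)"
proof -
  obtain L where L: "\<And>a b. \<bar>K1 a b\<bar> \<le> L" "\<And>a b. \<bar>K2 a b\<bar> \<le> L"
    using K unfolding C1_Lip2_def by blast
  obtain A B where f': "\<And>x. \<bar>f x\<bar> \<le> A" "\<And>x. norm (grad f x) \<le> B" using f by (rule C1b_bounded) auto
  obtain C D where g': "\<And>x. \<bar>g x\<bar> \<le> C" "\<And>x. norm (grad g x) \<le> D" using g by (rule C1b_bounded) auto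
  have L0: "0 \<le> L" using order_trans[OF abs_ge_zero L(1)] by auto
  have 1: "GDERIV (\<lambda>x. K (f x) (g x)) x :> K1 (f x) (g x) *\<^sub>R grad f x + K2 (f x) (g x) *\<^sub>R grad g x" for x
  proof -
    have "((\<lambda>x. (f x, g x)) has_derivative (\<lambda>h. (inner h (grad f x), inner h (grad g x)))) (at x)"
      using C1b_GDERIV[OF f, of x] C1b_GDERIV[OF g, of x] unfolding gderiv_def
      by (rule has_derivative_Pair)
    moreover have "((\<lambda>z. K (fst z) (snd z)) has_derivative
      (\<lambda>z. fst z * K1 (f x) (g x) + snd z * K2 (f x) (g x))) (at (f x, g x))"
      using K by (simp add: C1_Lip2_def)
    ultimately have "((\<lambda>x. K (fst (f x, g x)) (snd (f x, g x))) has_derivative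
      (\<lambda>h. fst (inner h (grad f x), inner h (grad g x)) * K1 (f x) (g x) +
        snd (inner h (grad f x), inner h (grad g x)) * K2 (f x) (g x))) (at x)"
      by (rule has_derivative_compose)
    then show ?thesis by (simp add: gderiv_def inner_add_right mult.commute)
  qed
  have "continuous_on UNIV (\<lambda>x. (f x, g x))"
    using f g by (intro continuous_intros C1b_continuous)
  then have 2: "continuous_on UNIV (\<lambda>x. K1 (f x) (g x))" "continuous_on UNIV (\<lambda>x. K2 (f x) (g x))"
    using K continuous_on_compose2[of UNIV "\<lambda>z. K1 (fst z) (snd z)" UNIV "\<lambda>x. (f x, g x)"]
      continuous_on_compose2[of UNIV "\<lambda>z. K2 (fst z) (snd z)" UNIV "\<lambda>x. (f x, g x)"]
    by (auto simp: C1_Lip2_def)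
  have 3: "\<bar>K (f x) (g x)\<bar> \<le> \<bar>K 0 0\<bar> + (L * A + L * C)" for x
  proof -
    have "\<bar>K (f x) (g x) - K 0 0\<bar> \<le> L * \<bar>f x\<bar> + L * \<bar>g x\<bar>"
      using C1_Lip2_Lipschitz[OF K L, of "f x" "g x" 0 0] by simp
    also have "\<dots> \<le> L * A + L * C" using L0 f' g' by (intro add_mono mult_left_mono) auto
    finally show ?thesis by linarith
  qed
  have 4: "norm (K1 (f x) (g x) *\<^sub>R grad f x + K2 (f x) (g x) *\<^sub>R grad g x) \<le> L * B + L * D" for x
    using L f' g' L0 by (intro norm_triangle_mono) (auto intro!: mult_mono)
  have 5: "continuous_on UNIV (\<lambda>x. K1 (f x) (g x) *\<^sub>R grad f x + K2 (f x) (g x) *\<^sub>R grad g x)"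
    using 2 f g by (intro continuous_intros C1b_continuous_grad)
  show "(\<lambda>x. K (f x) (g x)) \<in> C1b" 
    "grad (\<lambda>x. K (f x) (g x)) = (\<lambda>x. K1 (f x) (g x) *\<^sub>R grad f x + K2 (f x) (g x) *\<^sub>R grad g x)"
    using C1bI[OF 1 5 3 4] by auto
qed

lemma C1_Lip2_linear: "C1_Lip2 (\<lambda>a b. c * a + d * b) (\<lambda>_ _. c) (\<lambda>_ _. d)"
proof -
  have "((\<lambda>z. c * fst z + d * snd z) has_derivative (\<lambda>z. fst z * c + snd z * d)) (at (a, b))" for a b
    by (auto intro!: derivative_eq_intros)
  moreover have "\<bar>c\<bar> \<le> \<bar>c\<bar> + \<bar>d\<bar> \<and> \<bar>d\<bar> \<le> \<bar>c\<bar> + \<bar>d\<bar>" by simp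
  ultimately show ?thesis unfolding C1_Lip2_def by (auto intro!: exI[of _ "\<bar>c\<bar> + \<bar>d\<bar>"])
qed

lemma
  assumes "f \<in> C1b" "g \<in> C1b"
  shows C1b_add: "(\<lambda>x. f x + g x) \<in> C1b"
    and grad_add: "grad (\<lambda>x. f x + g x) = (\<lambda>x. grad f x + grad g x)"
  using C1b_chain[OF C1_Lip2_linear[of 1 1] assms] grad_chain[OF C1_Lip2_linear[of 1 1] assms] by simp_all

lemma
  assumes f: "f \<in> C1b"
  shows C1b_cmult: "(\<lambda>x. c * f x) \<in> C1b"
    and grad_cmult: "grad (\<lambda>x. c * f x) = (\<lambda>x. c *\<^sub>R grad f x)"
  using C1b_mult[OF C1b_const[of c] f] grad_mult[OF C1b_const[of c] f] by (simp_all add: grad_const)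

section \<open>Calculus for the closed gradient\<close>

locale closed_gradient = prob_space \<nu>
  for \<nu> :: "'a::{real_inner, banach, second_countable_topology} measure" +
  fixes R :: "'a \<Rightarrow> 'a"
  assumes sets_nu: "sets \<nu> = sets borel"
    and linear_R: "bounded_linear R"
    and closable: "\<And>p. 1 < p \<Longrightarrow> closable_grad \<nu> R p"
begin

lemma measurable_nu_cong: "measurable \<nu> N = measurable borel N"
  by (rule measurable_cong_sets[OF sets_nu refl])

lemma continuous_measurable: "continuous_on UNIV f \<Longrightarrow> f \<in> borel_measurable \<nu>"
  by (simp add: measurable_nu_cong borel_measurable_continuous_onI)

lemma C1b_measurable: "f \<in> C1b \<Longrightarrow> f \<in> borel_measurable \<nu>"
  by (intro continuous_measurable C1b_continuous)

lemma R_grad_measurable: "f \<in> C1b \<Longrightarrow> (\<lambda>x. R (grad f x)) \<in> borel_measurable \<nu>"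
  using linear_R by (intro continuous_measurable bounded_linear.continuous_on[OF linear_R] C1b_continuous_grad)

lemma R_grad_bounded:
  assumes "f \<in> C1b" obtains B where "\<And>x. norm (R (grad f x)) \<le> B" "0 \<le> B"
proof -
  obtain A B where f: "\<And>x. \<bar>f x\<bar> \<le> A" "\<And>x. norm (grad f x) \<le> B" using assms by (rule C1b_bounded) auto
  have "norm (R (grad f x)) \<le> onorm R * B" for x
    using onorm[OF linear_R, of "grad f x"] mult_left_mono[OF f(2) onorm_pos_le[OF linear_R]]
    by (rule order_trans)
  moreover have "0 \<le> B" using order_trans[OF norm_ge_zero f(2)] by auto
  then have "0 \<le> onorm R * B" using onorm_pos_le[OF linear_R] by simp
  ultimately show thesis by (rule that)
qed

lemma R_add: "R (x + y) = R x + R y" and R_scaleR: "R (c *\<^sub>R x) = c *\<^sub>R R x"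
  using linear_R by (simp_all add: linear_simps)

lemma R_zero: "R 0 = 0"
  using linear_R by (simp add: linear_simps)

lemma C1b_Lp: assumes "f \<in> C1b" "0 \<le> p" shows "f \<in> Lp \<nu> p"
proof -
  obtain A B where "\<And>x. \<bar>f x\<bar> \<le> A" "\<And>x. norm (grad f x) \<le> B" using assms(1) by (rule C1b_bounded) auto
  then show ?thesis using assms by (intro Lp_bounded[where C=A] C1b_measurable) auto
qed

lemma R_grad_Lp: assumes "f \<in> C1b" "0 \<le> p" shows "(\<lambda>x. R (grad f x)) \<in> Lp \<nu> p"
proof -
  obtain B where "\<And>x. norm (R (grad f x)) \<le> B" "0 \<le> B" using assms(1) by (rule R_grad_bounded) auto
  then show ?thesis using assms by (intro Lp_bounded[where C=B] R_grad_measurable) auto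
qed

lemma graph_Lp:
  assumes "(f, F) \<in> M_graph \<nu> R p" shows "f \<in> Lp \<nu> p" "F \<in> Lp \<nu> p"
  using assms by (auto simp: M_graph_def Lp_tendsto_def)

lemma graph_measurable:
  assumes "(f, F) \<in> M_graph \<nu> R p" shows "f \<in> borel_measurable \<nu>" "F \<in> borel_measurable \<nu>"
  using graph_Lp[OF assms] by (auto dest: LpD_measurable)

lemma graph_C1b: "f \<in> C1b \<Longrightarrow> 0 \<le> p \<Longrightarrow> (f, \<lambda>x. R (grad f x)) \<in> M_graph \<nu> R p"
  by (auto simp: M_graph_def intro!: exI[of _ "\<lambda>_. f"] Lp_tendsto_const C1b_Lp R_grad_Lp)

lemma graph_const: "0 \<le> p \<Longrightarrow> ((\<lambda>x. c), (\<lambda>x. 0)) \<in> M_graph \<nu> R p"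
  using graph_C1b[OF C1b_const[of c]] by (simp add: grad_const R_zero)

text \<open>
  Coefficients that converge only almost everywhere may be multiplied to a convergent sequence if they
  are uniformly bounded: \<open>a n *\<^sub>R (F n - G)\<close> is controlled by the bound and \<open>(a n - b) *\<^sub>R G\<close> by
  dominated convergence.
\<close>

lemma Lp_tendsto_scaleR_AE:
  fixes F :: "nat \<Rightarrow> 'a \<Rightarrow> 'b::{real_normed_vector, second_countable_topology}"
  assumes F: "Lp_tendsto \<nu> p F G" and p: "0 < p"
    and a: "\<And>n. a n \<in> borel_measurable \<nu>" "\<And>n x. \<bar>a n x\<bar> \<le> L"
    and b: "b \<in> borel_measurable \<nu>" "AE x in \<nu>. (\<lambda>n. a n x) \<longlonglongrightarrow> b x"
  shows "Lp_tendsto \<nu> p (\<lambda>n x. a n x *\<^sub>R F n x) (\<lambda>x. b x *\<^sub>R G x)"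
proof -
  have G: "G \<in> Lp \<nu> p" by (rule Lp_tendsto_Lp_limit[OF F])
  note [measurable] = a(1) b(1) LpD_measurable[OF G] LpD_measurable[OF Lp_tendsto_Lp[OF F]]
  have "Lp_tendsto \<nu> p (\<lambda>n x. a n x *\<^sub>R G x) (\<lambda>x. b x *\<^sub>R G x)"
  proof (rule Lp_tendsto_dominated[OF _ _ Lp_cmult[OF Lp_norm_fun[OF G], of L] p])
    show "AE x in \<nu>. norm (a n x *\<^sub>R G x) \<le> L * norm (G x)" for n
      using a(2) by (auto intro!: mult_right_mono)
    show "AE x in \<nu>. (\<lambda>n. a n x *\<^sub>R G x) \<longlonglongrightarrow> b x *\<^sub>R G x"
      using b(2) by eventually_elim (intro tendsto_intros)
  qed auto
  moreover from this have bG: "(\<lambda>x. b x *\<^sub>R G x) \<in> Lp \<nu> p" by (rule Lp_tendsto_Lp_limit)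
  ultimately have "Lp_tendsto \<nu> p (\<lambda>n x. L *\<^sub>R norm (F n x - G x) + norm (a n x *\<^sub>R G x - b x *\<^sub>R G x))
    (\<lambda>x. L *\<^sub>R 0 + 0)"
    using p by (intro Lp_tendsto_add Lp_tendsto_scaleR Lp_tendsto_norm_diff F) auto
  then have w: "Lp_tendsto \<nu> p (\<lambda>n x. L * norm (F n x - G x) + norm (a n x *\<^sub>R G x - b x *\<^sub>R G x)) (\<lambda>x. 0)"
    by simp
  show ?thesis
  proof (rule Lp_tendsto_squeeze[OF _ bG p w])
    have "norm (a n x *\<^sub>R F n x - b x *\<^sub>R G x) \<le> L * norm (F n x - G x) + norm (a n x *\<^sub>R G x - b x *\<^sub>R G x)" for n x
    proof -
      have "a n x *\<^sub>R F n x - b x *\<^sub>R G x = a n x *\<^sub>R (F n x - G x) + (a n x *\<^sub>R G x - b x *\<^sub>R G x)"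
        by (simp add: scaleR_diff_right)
      also have "norm \<dots> \<le> L * norm (F n x - G x) + norm (a n x *\<^sub>R G x - b x *\<^sub>R G x)"
        using a(2) by (intro norm_triangle_mono) (auto intro!: mult_right_mono)
      finally show ?thesis .
    qed
    then show "AE x in \<nu>. norm (a n x *\<^sub>R F n x - b x *\<^sub>R G x)
      \<le> L * norm (F n x - G x) + norm (a n x *\<^sub>R G x - b x *\<^sub>R G x)" for n by simp
  qed auto
qed

text \<open>
  Along a common subsequence both approximating sequences converge almost everywhere. The values then
  converge because \<open>K\<close> is Lipschitz, the gradients because the partial derivatives of \<open>K\<close> are
  continuous and bounded.
\<close>

lemma graph_chain:
  assumes f: "(f, F) \<in> M_graph \<nu> R p" and g: "(g, G) \<in> M_graph \<nu> R p" and K: "C1_Lip2 K K1 K2" and p: "0 < p"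
  shows "((\<lambda>x. K (f x) (g x)), (\<lambda>x. K1 (f x) (g x) *\<^sub>R F x + K2 (f x) (g x) *\<^sub>R G x)) \<in> M_graph \<nu> R p"
proof -
  obtain \<phi>' where \<phi>': "\<And>n. \<phi>' n \<in> C1b" "Lp_tendsto \<nu> p \<phi>' f" "Lp_tendsto \<nu> p (\<lambda>n x. R (grad (\<phi>' n) x)) F"
    using f by (auto simp: M_graph_def)
  obtain \<psi>' where \<psi>': "\<And>n. \<psi>' n \<in> C1b" "Lp_tendsto \<nu> p \<psi>' g" "Lp_tendsto \<nu> p (\<lambda>n x. R (grad (\<psi>' n) x)) G"
    using g by (auto simp: M_graph_def)
  obtain s1 where s1: "strict_mono s1" "AE x in \<nu>. (\<lambda>n. \<phi>' (s1 n) x) \<longlonglongrightarrow> f x"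
    by (rule Lp_tendsto_AE_subseq[OF \<phi>'(2) p])
  obtain s2 where s2: "strict_mono s2" "AE x in \<nu>. (\<lambda>n. \<psi>' (s1 (s2 n)) x) \<longlonglongrightarrow> g x"
    using Lp_tendsto_AE_subseq[OF Lp_tendsto_subseq[OF \<psi>'(2) s1(1)] p] by auto
  define s where "s n = s1 (s2 n)" for n
  have s: "strict_mono s" using s1(1) s2(1) by (auto simp: s_def strict_mono_def)
  define \<phi> where "\<phi> = (\<lambda>n. \<phi>' (s n))"
  define \<psi> where "\<psi> = (\<lambda>n. \<psi>' (s n))"
  have \<phi>: "\<And>n. \<phi> n \<in> C1b" "Lp_tendsto \<nu> p \<phi> f" "Lp_tendsto \<nu> p (\<lambda>n x. R (grad (\<phi> n) x)) F"
    using \<phi>'(1) Lp_tendsto_subseq[OF \<phi>'(2) s] Lp_tendsto_subseq[OF \<phi>'(3) s] by (auto simp: \<phi>_def)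
  have \<psi>: "\<And>n. \<psi> n \<in> C1b" "Lp_tendsto \<nu> p \<psi> g" "Lp_tendsto \<nu> p (\<lambda>n x. R (grad (\<psi> n) x)) G"
    using \<psi>'(1) Lp_tendsto_subseq[OF \<psi>'(2) s] Lp_tendsto_subseq[OF \<psi>'(3) s] by (auto simp: \<psi>_def)
  have AE: "AE x in \<nu>. (\<lambda>n. \<phi> n x) \<longlonglongrightarrow> f x" "AE x in \<nu>. (\<lambda>n. \<psi> n x) \<longlonglongrightarrow> g x"
  proof -
    show "AE x in \<nu>. (\<lambda>n. \<phi> n x) \<longlonglongrightarrow> f x" using s1(2)
    proof eventually_elim
      case (elim x)
      from LIMSEQ_subseq_LIMSEQ[OF this s2(1)] show ?case by (simp add: \<phi>_def s_def o_def)
    qed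
    show "AE x in \<nu>. (\<lambda>n. \<psi> n x) \<longlonglongrightarrow> g x" using s2(2) by (simp add: \<psi>_def s_def)
  qed
  obtain L where L: "\<And>a b. \<bar>K1 a b\<bar> \<le> L" "\<And>a b. \<bar>K2 a b\<bar> \<le> L"
    using K unfolding C1_Lip2_def by blast
  note lip = C1_Lip2_Lipschitz[OF K L]
  have cont: "isCont (\<lambda>z. K (fst z) (snd z)) z" "isCont (\<lambda>z. K1 (fst z) (snd z)) z" "isCont (\<lambda>z. K2 (fst z) (snd z)) z" for z
  proof -
    have "((\<lambda>z. K (fst z) (snd z)) has_derivative
      (\<lambda>w. fst w * K1 (fst z) (snd z) + snd w * K2 (fst z) (snd z))) (at (fst z, snd z))"
      using K unfolding C1_Lip2_def by blast
    then show "isCont (\<lambda>z. K (fst z) (snd z)) z" by (auto dest: has_derivative_continuous)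
    show "isCont (\<lambda>z. K1 (fst z) (snd z)) z" "isCont (\<lambda>z. K2 (fst z) (snd z)) z"
      using K unfolding C1_Lip2_def by (meson UNIV_I continuous_on_eq_continuous_at open_UNIV)+
  qed
  have [measurable]: "(\<lambda>z. K (fst z) (snd z)) \<in> borel_measurable borel"
    "(\<lambda>z. K1 (fst z) (snd z)) \<in> borel_measurable borel" "(\<lambda>z. K2 (fst z) (snd z)) \<in> borel_measurable borel"
    using cont by (auto intro!: borel_measurable_continuous_onI simp: continuous_on_eq_continuous_at)
  note [measurable] = graph_measurable[OF f] graph_measurable[OF g]
    C1b_measurable[OF \<phi>(1)] R_grad_measurable[OF \<phi>(1)] C1b_measurable[OF \<psi>(1)] R_grad_measurable[OF \<psi>(1)]
  have meas: "(\<lambda>x. H (u x) (v x)) \<in> borel_measurable \<nu>"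
    if "(\<lambda>z. H (fst z) (snd z)) \<in> borel_measurable borel" "u \<in> borel_measurable \<nu>" "v \<in> borel_measurable \<nu>"
    for H :: "real \<Rightarrow> real \<Rightarrow> real" and u v
  proof -
    note [measurable] = that(2,3)
    have "(\<lambda>x. (u x, v x)) \<in> borel_measurable \<nu>" by simp
    from measurable_compose[OF this that(1)] show ?thesis by simp
  qed
  have mK: "(\<lambda>x. K (\<phi> n x) (\<psi> n x)) \<in> borel_measurable \<nu>" "(\<lambda>x. K (f x) (g x)) \<in> borel_measurable \<nu>"
    "(\<lambda>x. K1 (\<phi> n x) (\<psi> n x)) \<in> borel_measurable \<nu>" "(\<lambda>x. K1 (f x) (g x)) \<in> borel_measurable \<nu>"
    "(\<lambda>x. K2 (\<phi> n x) (\<psi> n x)) \<in> borel_measurable \<nu>" "(\<lambda>x. K2 (f x) (g x)) \<in> borel_measurable \<nu>" for n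
    by (rule meas[of K] meas[of K1] meas[of K2]; measurable)+
  have conv: "AE x in \<nu>. (\<lambda>n. H (\<phi> n x) (\<psi> n x)) \<longlonglongrightarrow> H (f x) (g x)"
    if "\<And>z. isCont (\<lambda>z. H (fst z) (snd z)) z" for H :: "real \<Rightarrow> real \<Rightarrow> real"
    using AE
  proof eventually_elim
    case (elim x)
    then have "(\<lambda>n. (\<phi> n x, \<psi> n x)) \<longlonglongrightarrow> (f x, g x)" by (intro tendsto_Pair)
    from isCont_tendsto_compose[OF that this] show ?case by simp
  qed
  have 1: "Lp_tendsto \<nu> p (\<lambda>n x. K (\<phi> n x) (\<psi> n x)) (\<lambda>x. K (f x) (g x))"
  proof (rule Lp_tendsto_squeeze)
    have "Lp_tendsto \<nu> p (\<lambda>n x. L *\<^sub>R norm (\<phi> n x - f x) + L *\<^sub>R norm (\<psi> n x - g x)) (\<lambda>_. L *\<^sub>R 0 + L *\<^sub>R 0)"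
      using p \<phi>(2) \<psi>(2) by (intro Lp_tendsto_add Lp_tendsto_scaleR Lp_tendsto_norm_diff) auto
    then show "Lp_tendsto \<nu> p (\<lambda>n x. L * \<bar>\<phi> n x - f x\<bar> + L * \<bar>\<psi> n x - g x\<bar>) (\<lambda>_. 0)" by simp
    show "(\<lambda>x. K (f x) (g x)) \<in> Lp \<nu> p"
    proof (rule Lp_dominated)
      show "(\<lambda>x. \<bar>K 0 0\<bar> + (L * norm (f x) + L * norm (g x))) \<in> Lp \<nu> p"
        using p by (intro Lp_add Lp_cmult Lp_norm_fun graph_Lp(1)[OF f] graph_Lp(1)[OF g] Lp_bounded[where C="\<bar>K 0 0\<bar>"]) auto
      have "norm (K (f x) (g x)) \<le> \<bar>K 0 0\<bar> + (L * norm (f x) + L * norm (g x))" for x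
        using lip[of "f x" "g x" 0 0] by simp
      then show "AE x in \<nu>. norm (K (f x) (g x)) \<le> \<bar>K 0 0\<bar> + (L * norm (f x) + L * norm (g x))" by simp
    qed (use p mK in auto)
    show "AE x in \<nu>. norm (K (\<phi> n x) (\<psi> n x) - K (f x) (g x)) \<le> L * \<bar>\<phi> n x - f x\<bar> + L * \<bar>\<psi> n x - g x\<bar>" for n
      using lip[of "\<phi> n x" "\<psi> n x" "f x" "g x" for x] by simp
  qed (use p mK in auto)
  have 2: "Lp_tendsto \<nu> p (\<lambda>n x. K1 (\<phi> n x) (\<psi> n x) *\<^sub>R R (grad (\<phi> n) x)) (\<lambda>x. K1 (f x) (g x) *\<^sub>R F x)"
    by (rule Lp_tendsto_scaleR_AE[OF \<phi>(3) p, of _ L]) (use L mK conv[of K1] conv[of K2] cont in auto)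
  have 3: "Lp_tendsto \<nu> p (\<lambda>n x. K2 (\<phi> n x) (\<psi> n x) *\<^sub>R R (grad (\<psi> n) x)) (\<lambda>x. K2 (f x) (g x) *\<^sub>R G x)"
    by (rule Lp_tendsto_scaleR_AE[OF \<psi>(3) p, of _ L]) (use L mK conv[of K1] conv[of K2] cont in auto)
  show ?thesis unfolding M_graph_def
    using 1 Lp_tendsto_add[OF 2 3 p] \<phi>(1) \<psi>(1)
    by (auto intro!: exI[of _ "\<lambda>n x. K (\<phi> n x) (\<psi> n x)"]
        simp: C1b_chain[OF K] grad_chain[OF K] R_add R_scaleR)
qed

lemma
  assumes f: "(f, F) \<in> M_graph \<nu> R p" and g: "(g, G) \<in> M_graph \<nu> R p" and p: "0 < p"
  shows graph_add: "((\<lambda>x. f x + g x), (\<lambda>x. F x + G x)) \<in> M_graph \<nu> R p"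
    and graph_diff: "((\<lambda>x. f x - g x), (\<lambda>x. F x - G x)) \<in> M_graph \<nu> R p"
  using graph_chain[OF f g C1_Lip2_linear[of 1 1] p] graph_chain[OF f g C1_Lip2_linear[of 1 "-1"] p] by simp_all

lemma graph_cmult:
  assumes f: "(f, F) \<in> M_graph \<nu> R p" and p: "0 < p"
  shows "((\<lambda>x. c * f x), (\<lambda>x. c *\<^sub>R F x)) \<in> M_graph \<nu> R p"
  using graph_chain[OF f f C1_Lip2_linear[of c 0] p] by simp

lemma graph_mono:
  assumes "(f, F) \<in> M_graph \<nu> R p" "0 < p'" "p' \<le> p"
  shows "(f, F) \<in> M_graph \<nu> R p'"
  using assms unfolding M_graph_def by (auto dest: Lp_tendsto_mono_exponent)

lemma Lp_tendsto_AE_cong: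
  fixes l :: "'a \<Rightarrow> 'b::{real_normed_vector, second_countable_topology}"
  assumes f: "Lp_tendsto \<nu> p f l" and l': "l' \<in> borel_measurable \<nu>" and eq: "AE x in \<nu>. l x = l' x"
    and p: "0 < p"
  shows "Lp_tendsto \<nu> p f l'"
proof (rule Lp_tendsto_squeeze[OF _ _ p Lp_tendsto_norm_diff[OF f p]])
  show "l' \<in> Lp \<nu> p" using Lp_AE_cong[OF Lp_tendsto_Lp_limit[OF f] l' eq] p by simp
  show "f n \<in> borel_measurable \<nu>" for n using Lp_tendsto_Lp[OF f, of n] by (rule LpD_measurable)
qed (use eq in auto)

lemma graph_AE_cong:
  assumes f: "(f, F) \<in> M_graph \<nu> R p" and p: "0 < p"
    and "f' \<in> borel_measurable \<nu>" "AE x in \<nu>. f x = f' x"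
    and "F' \<in> borel_measurable \<nu>" "AE x in \<nu>. F x = F' x"
  shows "(f', F') \<in> M_graph \<nu> R p"
  using assms unfolding M_graph_def by (auto intro: Lp_tendsto_AE_cong)

lemma graph_unique:
  assumes f: "(f, F) \<in> M_graph \<nu> R p" and g: "(g, G) \<in> M_graph \<nu> R p"
    and eq: "AE x in \<nu>. f x = g x" and p: "1 < p"
  shows "AE x in \<nu>. F x = G x"
proof -
  have d: "((\<lambda>x. f x - g x), (\<lambda>x. F x - G x)) \<in> M_graph \<nu> R p" using graph_diff[OF f g] p by simp
  have "((\<lambda>x. 0), (\<lambda>x. F x - G x)) \<in> M_graph \<nu> R p"
    by (rule graph_AE_cong[OF d]) (use graph_measurable[OF d] eq p in auto)
  with closable[OF p] have "AE x in \<nu>. F x - G x = 0" unfolding closable_grad_def by blast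
  then show ?thesis by simp
qed

lemma graph_M_op: "f \<in> W1 \<nu> R p \<Longrightarrow> (f, M_op \<nu> R p f) \<in> M_graph \<nu> R p"
  unfolding W1_def M_op_def by (force intro: someI[of "\<lambda>G. (f, G) \<in> M_graph \<nu> R p"])

lemma graph_W1: "(f, F) \<in> M_graph \<nu> R p \<Longrightarrow> f \<in> W1 \<nu> R p"
  by (auto simp: W1_def)

lemma M_op_eq: "(f, F) \<in> M_graph \<nu> R p \<Longrightarrow> 1 < p \<Longrightarrow> AE x in \<nu>. M_op \<nu> R p f x = F x"
  by (rule graph_unique[OF graph_M_op[OF graph_W1]]) auto

text \<open>A graph that is a closure is closed: a diagonal sequence of smooth functions.\<close>

lemma graph_closed:
  assumes g: "\<And>n. (f n, F n) \<in> M_graph \<nu> R p" and f: "Lp_tendsto \<nu> p f l" and F: "Lp_tendsto \<nu> p F G"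
    and p: "0 < p"
  shows "(l, G) \<in> M_graph \<nu> R p"
proof -
  have "\<exists>\<psi>. \<psi> \<in> C1b \<and> Lp_norm \<nu> p (\<lambda>x. \<psi> x - f n x) < 1 / real (Suc n) \<and>
    Lp_norm \<nu> p (\<lambda>x. R (grad \<psi> x) - F n x) < 1 / real (Suc n)" for n
  proof -
    obtain \<phi> where \<phi>: "\<And>k. \<phi> k \<in> C1b" "Lp_tendsto \<nu> p \<phi> (f n)" "Lp_tendsto \<nu> p (\<lambda>k x. R (grad (\<phi> k) x)) (F n)"
      using g[of n] by (auto simp: M_graph_def)
    have "eventually (\<lambda>k. Lp_norm \<nu> p (\<lambda>x. \<phi> k x - f n x) < 1 / real (Suc n)) sequentially"
      "eventually (\<lambda>k. Lp_norm \<nu> p (\<lambda>x. R (grad (\<phi> k) x) - F n x) < 1 / real (Suc n)) sequentially"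
      using \<phi>(2,3) unfolding Lp_tendsto_def by (auto intro!: order_tendstoD(2)[of _ 0])
    then have "eventually (\<lambda>k. Lp_norm \<nu> p (\<lambda>x. \<phi> k x - f n x) < 1 / real (Suc n) \<and>
      Lp_norm \<nu> p (\<lambda>x. R (grad (\<phi> k) x) - F n x) < 1 / real (Suc n)) sequentially" by eventually_elim auto
    then show ?thesis using \<phi>(1) by (auto simp: eventually_sequentially)
  qed
  then obtain \<psi> where \<psi>: "\<And>n. \<psi> n \<in> C1b" "\<And>n. Lp_norm \<nu> p (\<lambda>x. \<psi> n x - f n x) < 1 / real (Suc n)"
    "\<And>n. Lp_norm \<nu> p (\<lambda>x. R (grad (\<psi> n) x) - F n x) < 1 / real (Suc n)" by metis
  have lim: "(\<lambda>n. 1 / real (Suc n)) \<longlonglongrightarrow> 0" by (rule LIMSEQ_Suc[OF lim_1_over_n])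
  have 1: "Lp_tendsto \<nu> p (\<lambda>n x. \<psi> n x - f n x) (\<lambda>_. 0)"
  proof -
    have "(\<lambda>n. Lp_norm \<nu> p (\<lambda>x. \<psi> n x - f n x)) \<longlonglongrightarrow> 0"
      by (rule tendsto_sandwich[OF _ _ tendsto_const lim])
        (use \<psi>(2)[THEN less_imp_le] in \<open>auto simp: Lp_norm_def\<close>)
    moreover have "(\<lambda>x. \<psi> n x - f n x) \<in> Lp \<nu> p" for n
      using p by (intro Lp_diff C1b_Lp \<psi>(1) Lp_tendsto_Lp[OF f]) auto
    moreover have "(\<lambda>_. 0::real) \<in> Lp \<nu> p" by (simp add: Lp_def)
    ultimately show ?thesis by (simp add: Lp_tendsto_def)
  qed
  have 2: "Lp_tendsto \<nu> p (\<lambda>n x. R (grad (\<psi> n) x) - F n x) (\<lambda>_. 0)"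
  proof -
    have "(\<lambda>n. Lp_norm \<nu> p (\<lambda>x. R (grad (\<psi> n) x) - F n x)) \<longlonglongrightarrow> 0"
      by (rule tendsto_sandwich[OF _ _ tendsto_const lim])
        (use \<psi>(3)[THEN less_imp_le] in \<open>auto simp: Lp_norm_def\<close>)
    moreover have "(\<lambda>x. R (grad (\<psi> n) x) - F n x) \<in> Lp \<nu> p" for n
      using p by (intro Lp_diff R_grad_Lp \<psi>(1) Lp_tendsto_Lp[OF F]) auto
    moreover have "(\<lambda>_. 0::'a) \<in> Lp \<nu> p" by (simp add: Lp_def)
    ultimately show ?thesis by (simp add: Lp_tendsto_def)
  qed
  show ?thesis
    using Lp_tendsto_add[OF 1 f p] Lp_tendsto_add[OF 2 F p] \<psi>(1)
    unfolding M_graph_def by auto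
qed

lemma graph_mult:
  assumes f: "(f, F) \<in> M_graph \<nu> R p" and u: "u \<in> C1b" and p: "0 < p"
  shows "((\<lambda>x. u x * f x), (\<lambda>x. u x *\<^sub>R F x + f x *\<^sub>R R (grad u x))) \<in> M_graph \<nu> R p"
proof -
  obtain \<phi> where \<phi>: "\<And>n. \<phi> n \<in> C1b" "Lp_tendsto \<nu> p \<phi> f" "Lp_tendsto \<nu> p (\<lambda>n x. R (grad (\<phi> n) x)) F"
    using f by (auto simp: M_graph_def)
  obtain A A' where A: "\<And>x. \<bar>u x\<bar> \<le> A" "\<And>x. norm (grad u x) \<le> A'" using u by (rule C1b_bounded) auto
  obtain B where B: "\<And>x. norm (R (grad u x)) \<le> B" "0 \<le> B" using u by (rule R_grad_bounded) auto
  note [measurable] = C1b_measurable[OF u] R_grad_measurable[OF u] graph_measurable[OF f]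
    C1b_measurable[OF \<phi>(1)] R_grad_measurable[OF \<phi>(1)]
  have 1: "Lp_tendsto \<nu> p (\<lambda>n x. u x *\<^sub>R \<phi> n x) (\<lambda>x. u x *\<^sub>R f x)"
    by (rule Lp_tendsto_scaleR_AE[OF \<phi>(2) p]) (use A(1) in auto)
  have 2: "Lp_tendsto \<nu> p (\<lambda>n x. u x *\<^sub>R R (grad (\<phi> n) x)) (\<lambda>x. u x *\<^sub>R F x)"
    by (rule Lp_tendsto_scaleR_AE[OF \<phi>(3) p]) (use A(1) in auto)
  have le: "norm (c *\<^sub>R R (grad u x)) \<le> B * norm c" for c x
    using mult_left_mono[OF B(1) abs_ge_zero, of c x] by (simp add: mult.commute)
  have 3: "Lp_tendsto \<nu> p (\<lambda>n x. \<phi> n x *\<^sub>R R (grad u x)) (\<lambda>x. f x *\<^sub>R R (grad u x))"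
  proof (rule Lp_tendsto_squeeze)
    show "Lp_tendsto \<nu> p (\<lambda>n x. B * norm (\<phi> n x - f x)) (\<lambda>_. 0)"
      using Lp_tendsto_scaleR[OF Lp_tendsto_norm_diff[OF \<phi>(2) p] p, of B] by simp
    show "(\<lambda>x. f x *\<^sub>R R (grad u x)) \<in> Lp \<nu> p"
      by (rule Lp_dominated[OF _ Lp_cmult[OF Lp_norm_fun[OF graph_Lp(1)[OF f]], of B]])
        (use p le in auto)
    show "AE x in \<nu>. norm (\<phi> n x *\<^sub>R R (grad u x) - f x *\<^sub>R R (grad u x)) \<le> B * norm (\<phi> n x - f x)" for n
      using le[of "\<phi> n x - f x" x for x] by (simp add: scaleR_diff_left)
  qed (use p in auto)
  show ?thesis unfolding M_graph_def
    using 1 Lp_tendsto_add[OF 2 3 p] \<phi>(1) u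
    by (auto intro!: exI[of _ "\<lambda>n x. u x * \<phi> n x"] simp: C1b_mult grad_mult R_add R_scaleR)
qed

text \<open>
  A smooth version of the Euclidean norm of the plane. With \<open>b = 0\<close> it regularises the absolute value;
  iterated, it builds up the norm of a vector field from its components.
\<close>

lemma C1_Lip2_sqrt:
  assumes d: "0 < d"
  shows "C1_Lip2 (\<lambda>a b. sqrt (d + a\<^sup>2 + b\<^sup>2)) (\<lambda>a b. a / sqrt (d + a\<^sup>2 + b\<^sup>2)) (\<lambda>a b. b / sqrt (d + a\<^sup>2 + b\<^sup>2))"
proof -
  have pos: "0 < d + a\<^sup>2 + b\<^sup>2" for a b :: real using d by (simp add: add_pos_nonneg)
  have "((\<lambda>z. sqrt (d + (fst z)\<^sup>2 + (snd z)\<^sup>2)) has_derivative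
     (\<lambda>z. fst z * (a / sqrt (d + a\<^sup>2 + b\<^sup>2)) + snd z * (b / sqrt (d + a\<^sup>2 + b\<^sup>2)))) (at (a, b))" for a b
    using pos[of a b] by (auto intro!: derivative_eq_intros simp: field_simps)
  moreover have "\<bar>a / sqrt (d + a\<^sup>2 + b\<^sup>2)\<bar> \<le> 1 \<and> \<bar>b / sqrt (d + a\<^sup>2 + b\<^sup>2)\<bar> \<le> 1" for a b
  proof -
    have "\<bar>a\<bar> \<le> sqrt (d + a\<^sup>2 + b\<^sup>2)" "\<bar>b\<bar> \<le> sqrt (d + a\<^sup>2 + b\<^sup>2)"
      using d by (auto intro!: real_le_rsqrt)
    then show ?thesis using pos[of a b] by (auto simp: divide_le_eq)
  qed
  moreover have "continuous_on UNIV (\<lambda>z. fst z / sqrt (d + (fst z)\<^sup>2 + (snd z)\<^sup>2))"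
    "continuous_on UNIV (\<lambda>z. snd z / sqrt (d + (fst z)\<^sup>2 + (snd z)\<^sup>2))"
    using pos by (auto intro!: continuous_intros simp: less_imp_neq[symmetric])
  ultimately show ?thesis unfolding C1_Lip2_def by blast
qed

text \<open>
  The limit of \<open>sqrt (d + f\<^sup>2)\<close> as \<open>d\<close> tends to zero. The approximating gradients vanish on
  \<open>{f = 0}\<close>, which is why \<open>sgn 0 = 0\<close> is the right value there.
\<close>

lemma graph_abs:
  assumes f: "(f, F) \<in> M_graph \<nu> R p" and p: "0 < p"
  shows "((\<lambda>x. \<bar>f x\<bar>), (\<lambda>x. sgn (f x) *\<^sub>R F x)) \<in> M_graph \<nu> R p"
proof -
  define d where "d n = 1 / real (Suc n)" for n
  have d: "0 < d n" "d n \<le> 1" for n by (auto simp: d_def)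
  have dlim: "d \<longlonglongrightarrow> 0" unfolding d_def by (rule LIMSEQ_Suc[OF lim_1_over_n])
  note [measurable] = graph_measurable[OF f]
  have g: "((\<lambda>x. sqrt (d n + (f x)\<^sup>2)), (\<lambda>x. (f x / sqrt (d n + (f x)\<^sup>2)) *\<^sub>R F x)) \<in> M_graph \<nu> R p" for n
    using graph_chain[OF f graph_const[of p 0] C1_Lip2_sqrt[OF d(1)[of n]] p] p by simp
  have lim1: "(\<lambda>n. sqrt (d n + a\<^sup>2)) \<longlonglongrightarrow> \<bar>a\<bar>" for a
  proof -
    have "(\<lambda>n. sqrt (d n + a\<^sup>2)) \<longlonglongrightarrow> sqrt (0 + a\<^sup>2)" by (intro tendsto_intros dlim)
    then show ?thesis by simp
  qed
  have lim2: "(\<lambda>n. a / sqrt (d n + a\<^sup>2)) \<longlonglongrightarrow> sgn a" for a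
  proof (cases "a = 0")
    case False
    then have "(\<lambda>n. a / sqrt (d n + a\<^sup>2)) \<longlonglongrightarrow> a / \<bar>a\<bar>" by (intro tendsto_intros lim1) auto
    then show ?thesis by (simp add: real_sgn_eq)
  qed simp
  show ?thesis
  proof (rule graph_closed[OF g _ _ p])
    show "Lp_tendsto \<nu> p (\<lambda>n x. sqrt (d n + (f x)\<^sup>2)) (\<lambda>x. \<bar>f x\<bar>)"
    proof (rule Lp_tendsto_dominated[OF _ _ _ p])
      show "(\<lambda>x. 1 + norm (f x)) \<in> Lp \<nu> p"
        using p by (intro Lp_add Lp_norm_fun graph_Lp(1)[OF f] Lp_bounded[where C=1]) auto
      have "sqrt (d n + a\<^sup>2) \<le> 1 + \<bar>a\<bar>" for n a
      proof (rule real_le_lsqrt)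
        show "d n + a\<^sup>2 \<le> (1 + \<bar>a\<bar>)\<^sup>2" using d(2)[of n] by (simp add: power2_sum)
      qed (use d(1)[of n] in auto)
      then show "AE x in \<nu>. norm (sqrt (d n + (f x)\<^sup>2)) \<le> 1 + norm (f x)" for n
        using d(1)[of n] by (simp add: less_imp_le)
    qed (use lim1 in auto)
    show "Lp_tendsto \<nu> p (\<lambda>n x. (f x / sqrt (d n + (f x)\<^sup>2)) *\<^sub>R F x) (\<lambda>x. sgn (f x) *\<^sub>R F x)"
    proof (rule Lp_tendsto_dominated[OF _ _ Lp_norm_fun[OF graph_Lp(2)[OF f]] p])
      have "\<bar>a / sqrt (d n + a\<^sup>2)\<bar> \<le> 1" for n a
      proof -
        have "\<bar>a\<bar> \<le> sqrt (d n + a\<^sup>2)" using d(1)[of n] by (auto intro!: real_le_rsqrt)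
        moreover have "0 < sqrt (d n + a\<^sup>2)" using d(1)[of n] by (simp add: add_pos_nonneg)
        ultimately show ?thesis by (simp add: divide_le_eq)
      qed
      then show "AE x in \<nu>. norm ((f x / sqrt (d n + (f x)\<^sup>2)) *\<^sub>R F x) \<le> norm (F x)" for n
        using mult_right_mono[OF _ norm_ge_zero, of "\<bar>f x / sqrt (d n + (f x)\<^sup>2)\<bar>" 1 "F x" for x] by simp
      show "AE x in \<nu>. (\<lambda>n. (f x / sqrt (d n + (f x)\<^sup>2)) *\<^sub>R F x) \<longlonglongrightarrow> sgn (f x) *\<^sub>R F x"
        using lim2 by (auto intro!: tendsto_intros)
    qed auto
  qed
qed

text \<open>
  From \<open>min a b = (a + b - \<bar>a - b\<bar>) / 2\<close>; this explains the arithmetic mean on the set where both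
  functions agree.
\<close>

lemma graph_min:
  assumes f: "(f, F) \<in> M_graph \<nu> R p" and g: "(g, G) \<in> M_graph \<nu> R p" and p: "0 < p"
  shows "((\<lambda>x. min (f x) (g x)), (\<lambda>x. if f x < g x then F x else if g x < f x then G x else (1/2) *\<^sub>R (F x + G x)))
    \<in> M_graph \<nu> R p"
proof -
  have "((\<lambda>x. (1/2) * (f x + g x - \<bar>f x - g x\<bar>)), (\<lambda>x. (1/2) *\<^sub>R (F x + G x - sgn (f x - g x) *\<^sub>R (F x - G x))))
    \<in> M_graph \<nu> R p"
    by (intro graph_cmult graph_diff graph_add graph_abs f g p)
  moreover have "(1/2) * (a + b - \<bar>a - b\<bar>) = min a b" for a b :: real by (auto simp: min_def)
  moreover have "(1/2) *\<^sub>R (x + y - sgn (a - b) *\<^sub>R (x - y))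
      = (if a < b then x else if b < a then y else (1/2) *\<^sub>R (x + y))" for a b :: real and x y :: 'a
    by (auto simp: sgn_if scaleR_2[symmetric])
  ultimately show ?thesis by simp
qed

lemma adjoint_eq:
  assumes F: "(F, h) \<in> Mstar_graph \<nu> R p" and f: "(f, G) \<in> M_graph \<nu> R p" and p: "1 < p"
  shows "(LINT x|\<nu>. G x \<bullet> F x) = (LINT x|\<nu>. f x * h x)"
proof -
  have m: "F \<in> borel_measurable \<nu>" using F by (auto simp: Mstar_graph_def dest: LpD_measurable)
  note [measurable] = m graph_measurable[OF f] graph_measurable[OF graph_M_op[OF graph_W1[OF f]]]
  have "(LINT x|\<nu>. G x \<bullet> F x) = (LINT x|\<nu>. M_op \<nu> R p f x \<bullet> F x)"
    using M_op_eq[OF f p] by (intro integral_cong_AE) auto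
  then show ?thesis using F graph_W1[OF f] by (auto simp: Mstar_graph_def)
qed

lemma Mstar_graph_Mstar: "F \<in> Mstar_dom \<nu> R p \<Longrightarrow> (F, Mstar \<nu> R p F) \<in> Mstar_graph \<nu> R p"
  unfolding Mstar_dom_def Mstar_def by (force intro: someI[of "\<lambda>h. (F, h) \<in> Mstar_graph \<nu> R p"])

lemma Lp_tendsto_inner:
  fixes f :: "nat \<Rightarrow> 'b \<Rightarrow> 'c::{real_inner, second_countable_topology}"
  assumes f: "Lp_tendsto M p f l" and w: "w \<in> Lp M (conj_exp p)" and p: "1 < p"
  shows "(\<lambda>n. LINT x|M. f n x \<bullet> w x) \<longlonglongrightarrow> (LINT x|M. l x \<bullet> w x)"
proof (rule LIM_zero_cancel, rule Lim_null_comparison)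
  have int: "integrable M (\<lambda>x. u x \<bullet> w x)" if u: "u \<in> Lp M p" for u
  proof (rule Bochner_Integration.integrable_bound[OF integrable_mult_Lp[OF u w p]])
    show "(\<lambda>x. u x \<bullet> w x) \<in> borel_measurable M"
      using LpD_measurable[OF u] LpD_measurable[OF w] by measurable
  qed (simp add: Cauchy_Schwarz_ineq2)
  note fL = Lp_tendsto_Lp[OF f] Lp_tendsto_Lp_limit[OF f]
  show "(\<lambda>n. LINT x|M. norm (f n x - l x) * norm (w x)) \<longlonglongrightarrow> 0" by (rule Lp_tendsto_pairing[OF f w p])
  have "norm ((LINT x|M. f n x \<bullet> w x) - (LINT x|M. l x \<bullet> w x)) \<le> (LINT x|M. norm (f n x - l x) * norm (w x))" for n
  proof -
    have d: "(\<lambda>x. f n x - l x) \<in> Lp M p" using p by (intro Lp_diff fL) auto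
    have "norm ((LINT x|M. f n x \<bullet> w x) - (LINT x|M. l x \<bullet> w x)) = norm (LINT x|M. (f n x - l x) \<bullet> w x)"
      using int[OF fL(1)] int[OF fL(2)] by (simp add: inner_diff_left)
    also have "\<dots> \<le> (LINT x|M. norm ((f n x - l x) \<bullet> w x))" by (rule integral_norm_bound)
    also have "\<dots> \<le> (LINT x|M. norm (f n x - l x) * norm (w x))"
      using int[OF d] integrable_mult_Lp[OF d w p] by (intro integral_mono) (auto simp: Cauchy_Schwarz_ineq2)
    finally show ?thesis .
  qed
  then show "eventually (\<lambda>n. norm ((LINT x|M. f n x \<bullet> w x) - (LINT x|M. l x \<bullet> w x))
      \<le> (LINT x|M. norm (f n x - l x) * norm (w x))) sequentially" by simp
qed

text \<open>
  Both sides of the adjoint identity are continuous in the graph norm, so that it suffices to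
  check it on smooth functions.
\<close>

lemma Mstar_graphI:
  assumes p: "1 < p" and F: "F \<in> Lp \<nu> (conj_exp p)" and h: "h \<in> Lp \<nu> (conj_exp p)"
    and eq: "\<And>u. u \<in> C1b \<Longrightarrow> (LINT x|\<nu>. R (grad u x) \<bullet> F x) = (LINT x|\<nu>. u x * h x)"
  shows "(F, h) \<in> Mstar_graph \<nu> R p"
proof -
  have "(LINT x|\<nu>. G x \<bullet> F x) = (LINT x|\<nu>. f x * h x)" if fG: "(f, G) \<in> M_graph \<nu> R p" for f G
  proof -
    obtain \<phi> where \<phi>: "\<And>n. \<phi> n \<in> C1b" "Lp_tendsto \<nu> p \<phi> f" "Lp_tendsto \<nu> p (\<lambda>n x. R (grad (\<phi> n) x)) G"
      using fG by (auto simp: M_graph_def)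
    have "(\<lambda>n. LINT x|\<nu>. R (grad (\<phi> n) x) \<bullet> F x) \<longlonglongrightarrow> (LINT x|\<nu>. G x \<bullet> F x)"
      by (rule Lp_tendsto_inner[OF \<phi>(3) F p])
    moreover have "(\<lambda>n. LINT x|\<nu>. \<phi> n x * h x) \<longlonglongrightarrow> (LINT x|\<nu>. f x * h x)"
      using Lp_tendsto_inner[OF \<phi>(2) h p] by simp
    ultimately show ?thesis using eq[OF \<phi>(1)] LIMSEQ_unique by fastforce
  qed
  then show ?thesis using F h graph_M_op by (fastforce simp: Mstar_graph_def)
qed

text \<open>
  The product rule of the adjoint, obtained by duality from the product rule of the closed gradient.
\<close>

lemma Mstar_graph_mult:
  assumes F: "(F, h) \<in> Mstar_graph \<nu> R p" and u: "u \<in> C1b" and p: "1 < p"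
  shows "((\<lambda>x. u x *\<^sub>R F x), (\<lambda>x. u x * h x - R (grad u x) \<bullet> F x)) \<in> Mstar_graph \<nu> R p"
proof (rule Mstar_graphI[OF p])
  have Fh: "F \<in> Lp \<nu> (conj_exp p)" "h \<in> Lp \<nu> (conj_exp p)" using F by (auto simp: Mstar_graph_def)
  have p': "0 < conj_exp p" using conj_exp_gt1[OF p] by simp
  obtain A A' where A: "\<And>x. \<bar>u x\<bar> \<le> A" "\<And>x. norm (grad u x) \<le> A'" using u by (rule C1b_bounded) auto
  obtain B where B: "\<And>x. norm (R (grad u x)) \<le> B" "0 \<le> B" using u by (rule R_grad_bounded) auto
  note [measurable] = Fh[THEN LpD_measurable] C1b_measurable[OF u] R_grad_measurable[OF u]
  show "(\<lambda>x. u x *\<^sub>R F x) \<in> Lp \<nu> (conj_exp p)" using p' A(1) by (intro Lp_bounded_scaleR[OF _ _ Fh(1), of _ A]) auto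
  have 1: "(\<lambda>x. u x * h x) \<in> Lp \<nu> (conj_exp p)" using Lp_bounded_scaleR[OF _ A(1) Fh(2)] p' by simp
  have 2: "(\<lambda>x. R (grad u x) \<bullet> F x) \<in> Lp \<nu> (conj_exp p)"
    by (rule Lp_dominated[OF _ Lp_cmult[OF Lp_norm_fun[OF Fh(1)], of B]])
      (use p' B(1) in \<open>auto intro!: order_trans[OF Cauchy_Schwarz_ineq2] mult_right_mono\<close>)
  show "(\<lambda>x. u x * h x - R (grad u x) \<bullet> F x) \<in> Lp \<nu> (conj_exp p)"
    using p' by (intro Lp_diff 1 2) auto
  fix v :: "'a \<Rightarrow> real" assume v: "v \<in> C1b"
  obtain C C' where C: "\<And>x. \<bar>v x\<bar> \<le> C" "\<And>x. norm (grad v x) \<le> C'" using v by (rule C1b_bounded) auto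
  have int: "integrable \<nu> F" "integrable \<nu> h"
    using Lp_integrable[OF Fh(1)] Lp_integrable[OF Fh(2)] conj_exp_gt1[OF p] by auto
  have Rw: "integrable \<nu> (\<lambda>x. R (grad w x) \<bullet> F x)" if w: "w \<in> C1b" for w
  proof -
    obtain D where D: "\<And>x. norm (R (grad w x)) \<le> D" "0 \<le> D" using w by (rule R_grad_bounded) auto
    show ?thesis
    proof (rule Bochner_Integration.integrable_bound)
      show "integrable \<nu> (\<lambda>x. D * norm (F x))" using int by simp
      show "(\<lambda>x. R (grad w x) \<bullet> F x) \<in> borel_measurable \<nu>" using R_grad_measurable[OF w] by measurable
      show "AE x in \<nu>. norm (R (grad w x) \<bullet> F x) \<le> norm (D * norm (F x))"
        using D by (auto intro!: order_trans[OF Cauchy_Schwarz_ineq2] mult_right_mono)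
    qed
  qed
  have i1: "integrable \<nu> (\<lambda>x. R (grad v x) \<bullet> (u x *\<^sub>R F x))"
    using integrable_bounded_mult[OF C1b_measurable[OF u] A(1) Rw[OF v]] by simp
  have i2: "integrable \<nu> (\<lambda>x. v x * (u x * h x))"
    by (intro integrable_bounded_mult[OF _ C(1)] integrable_bounded_mult[OF _ A(1)] C1b_measurable u v int)
  have i3: "integrable \<nu> (\<lambda>x. v x * (R (grad u x) \<bullet> F x))"
    by (intro integrable_bounded_mult[OF _ C(1)] C1b_measurable v Rw u)
  have "(LINT x|\<nu>. (u x *\<^sub>R R (grad v x) + v x *\<^sub>R R (grad u x)) \<bullet> F x) = (LINT x|\<nu>. (u x * v x) * h x)"
    using adjoint_eq[OF F graph_mult[OF graph_C1b[OF v] u] p] p by simp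
  moreover have "(LINT x|\<nu>. (u x *\<^sub>R R (grad v x) + v x *\<^sub>R R (grad u x)) \<bullet> F x)
     = (LINT x|\<nu>. R (grad v x) \<bullet> (u x *\<^sub>R F x) + v x * (R (grad u x) \<bullet> F x))"
    by (simp add: inner_add_left)
  moreover have "(LINT x|\<nu>. (u x * v x) * h x) = (LINT x|\<nu>. v x * (u x * h x))"
    by (simp add: mult_ac)
  ultimately show "(LINT x|\<nu>. R (grad v x) \<bullet> (u x *\<^sub>R F x)) = (LINT x|\<nu>. v x * (u x * h x - R (grad u x) \<bullet> F x))"
    using i1 i2 i3 by (simp add: right_diff_distrib)
qed

end

section \<open>The Daniell--Stone theorem on a metric space\<close>

lemma bcontfunI':
  assumes "continuous_on UNIV f" "\<And>x. \<bar>f x\<bar> \<le> (C::real)" shows "f \<in> bcontfun"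
  using assms by (auto simp: bcontfun_def bounded_iff)

lemma bcontfunD:
  assumes "f \<in> bcontfun"
  obtains C :: real where "continuous_on UNIV f" "\<And>x. \<bar>f x\<bar> \<le> C" "0 \<le> C"
proof -
  obtain C where C: "\<And>x. \<bar>f x\<bar> \<le> C" using assms by (auto simp: bcontfun_def bounded_iff)
  then have "0 \<le> C" using order_trans[OF abs_ge_zero C] by auto
  with C show thesis using assms by (intro that) (auto simp: bcontfun_def)
qed

lemma bcontfun_continuous: "f \<in> bcontfun \<Longrightarrow> continuous_on UNIV f"
  by (simp add: bcontfun_def)

lemma
  fixes f g :: "'a::topological_space \<Rightarrow> real"
  assumes f: "f \<in> bcontfun" and g: "g \<in> bcontfun"
  shows bcontfun_add: "(\<lambda>x. f x + g x) \<in> bcontfun"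
    and bcontfun_diff: "(\<lambda>x. f x - g x) \<in> bcontfun"
    and bcontfun_mult: "(\<lambda>x. f x * g x) \<in> bcontfun"
    and bcontfun_max: "(\<lambda>x. max (f x) (g x)) \<in> bcontfun"
    and bcontfun_min: "(\<lambda>x. min (f x) (g x)) \<in> bcontfun"
proof -
  obtain A where A: "continuous_on UNIV f" "\<And>x. \<bar>f x\<bar> \<le> A" "0 \<le> A" using f by (rule bcontfunD) auto
  obtain B where B: "continuous_on UNIV g" "\<And>x. \<bar>g x\<bar> \<le> B" "0 \<le> B" using g by (rule bcontfunD) auto
  have 1: "\<bar>f x + g x\<bar> \<le> A + B" "\<bar>f x - g x\<bar> \<le> A + B" "\<bar>max (f x) (g x)\<bar> \<le> A + B" "\<bar>min (f x) (g x)\<bar> \<le> A + B" for x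
    using A(2)[of x] A(3) B(2)[of x] B(3) by (auto simp: max_def min_def)
  have 2: "\<bar>f x * g x\<bar> \<le> A * B" for x
    using A(2)[of x] A(3) B(2)[of x] B(3) by (auto simp: abs_mult intro!: mult_mono)
  show "(\<lambda>x. f x + g x) \<in> bcontfun" using A(1) B(1) by (intro bcontfunI'[where C="A + B"] 1 continuous_intros)
  show "(\<lambda>x. f x - g x) \<in> bcontfun" using A(1) B(1) by (intro bcontfunI'[where C="A + B"] 1 continuous_intros)
  show "(\<lambda>x. f x * g x) \<in> bcontfun" using A(1) B(1) by (intro bcontfunI'[where C="A * B"] 2 continuous_intros)
  show "(\<lambda>x. max (f x) (g x)) \<in> bcontfun" using A(1) B(1) by (intro bcontfunI'[where C="A + B"] 1 continuous_intros)
  show "(\<lambda>x. min (f x) (g x)) \<in> bcontfun" using A(1) B(1) by (intro bcontfunI'[where C="A + B"] 1 continuous_intros)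
qed

lemma bcontfun_sum:
  fixes f :: "'i \<Rightarrow> 'a::topological_space \<Rightarrow> real"
  assumes "\<And>i. i \<in> S \<Longrightarrow> f i \<in> bcontfun"
  shows "(\<lambda>x. \<Sum>i\<in>S. f i x) \<in> bcontfun"
  using assms by (induction S rule: infinite_finite_induct) (auto intro!: bcontfun_add const_bcontfun)

lemma bcontfun_approx_open:
  fixes U :: "'a::metric_space set"
  assumes U: "open U"
  obtains \<eta> :: "nat \<Rightarrow> 'a \<Rightarrow> real" where "\<And>n. \<eta> n \<in> bcontfun" "\<And>n x. 0 \<le> \<eta> n x" "\<And>n x. \<eta> n x \<le> indicator U x"
    "\<And>m n x. m \<le> n \<Longrightarrow> \<eta> m x \<le> \<eta> n x" "\<And>x. (\<lambda>n. \<eta> n x) \<longlonglongrightarrow> indicator U x"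
proof (cases "U = UNIV")
  \<comment> \<open>The distance to the empty complement is \<open>0\<close> by convention.\<close>
  case True
  then show thesis by (intro that[of "\<lambda>_ _. 1"]) (auto intro!: const_bcontfun)
next
  case False
  then have ne: "- U \<noteq> {}" by auto
  define \<eta> where "\<eta> n x = min 1 (real n * infdist x (- U))" for n x
  have zero: "infdist x (- U) = 0 \<longleftrightarrow> x \<notin> U" for x
    using in_closed_iff_infdist_zero[of "- U" x] U ne by (auto simp: closed_Compl)
  show thesis
  proof (rule that[of \<eta>])
    show "\<eta> n \<in> bcontfun" for n
      by (rule bcontfunI'[where C=1]) (auto simp: \<eta>_def[abs_def] infdist_nonneg intro!: continuous_intros)
    show "0 \<le> \<eta> n x" for n x by (simp add: \<eta>_def infdist_nonneg)
    show "\<eta> n x \<le> indicator U x" for n x using zero[of x] by (auto simp: \<eta>_def indicator_def)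
    show "\<eta> m x \<le> \<eta> n x" if "m \<le> n" for m n x
      using mult_right_mono[of "real m" "real n" "infdist x (- U)"] that infdist_nonneg[of x "- U"]
      by (simp add: \<eta>_def min_def)
    show "(\<lambda>n. \<eta> n x) \<longlonglongrightarrow> indicator U x" for x
    proof (cases "x \<in> U")
      case True
      then have pos: "0 < infdist x (- U)" using zero[of x] infdist_nonneg[of x "- U"] by linarith
      then obtain N where N: "1 < real N * infdist x (- U)" using reals_Archimedean3 by blast
      have "\<eta> n x = 1" if "n \<ge> N" for n
      proof -
        have "real N * infdist x (- U) \<le> real n * infdist x (- U)" using that pos by simp
        with N show ?thesis by (simp add: \<eta>_def)
      qed
      then show ?thesis using True by (intro tendsto_eventually) (auto simp: eventually_sequentially)
    qed (use zero[of x] in \<open>simp add: \<eta>_def\<close>)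
  qed
qed

text \<open>
  A positive linear functional on the bounded continuous functions which is continuous along decreasing
  sequences. This continuity is what replaces countable additivity; it yields a representing measure by
  Caratheodory's construction, starting from the open sets.
\<close>

locale daniell_functional =
  fixes I :: "('a::metric_space \<Rightarrow> real) \<Rightarrow> real"
  assumes I_add: "\<And>f g. f \<in> bcontfun \<Longrightarrow> g \<in> bcontfun \<Longrightarrow> I (\<lambda>x. f x + g x) = I f + I g"
    and I_cmult: "\<And>f c. f \<in> bcontfun \<Longrightarrow> I (\<lambda>x. c * f x) = c * I f"
    and I_nonneg: "\<And>f. f \<in> bcontfun \<Longrightarrow> (\<And>x. 0 \<le> f x) \<Longrightarrow> 0 \<le> I f"
    and I_decreasing: "\<And>f. (\<And>n::nat. f n \<in> bcontfun) \<Longrightarrow> (\<And>n x. f (Suc n) x \<le> f n x) \<Longrightarrow>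
      (\<And>x. (\<lambda>n. f n x) \<longlonglongrightarrow> 0) \<Longrightarrow> (\<lambda>n. I (f n)) \<longlonglongrightarrow> 0"
begin

lemma I_diff:
  assumes f: "f \<in> bcontfun" and g: "g \<in> bcontfun" shows "I (\<lambda>x. f x - g x) = I f - I g"
  using I_add[OF f bcontfun_mult[OF const_bcontfun[of "-1"] g]] I_cmult[OF g, of "-1"] by simp

lemma I_mono:
  assumes "f \<in> bcontfun" "g \<in> bcontfun" "\<And>x. f x \<le> g x" shows "I f \<le> I g"
  using I_nonneg[OF bcontfun_diff[OF assms(2,1)]] I_diff[OF assms(2,1)] assms(3) by simp

lemma I_const: "I (\<lambda>_. c) = c * I (\<lambda>_. 1)"
  using I_cmult[OF const_bcontfun[of 1], of c] by simp

lemma I_sum: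
  assumes "\<And>i. i \<in> S \<Longrightarrow> f i \<in> bcontfun"
  shows "I (\<lambda>x. \<Sum>i\<in>S. f i x) = (\<Sum>i\<in>S. I (f i))"
  using assms
proof (induction S rule: infinite_finite_induct)
  case (insert i S)
  then show ?case by (simp add: I_add bcontfun_sum)
qed (use I_const[of 0] in auto)

text \<open>
  Monotone convergence from below: the parts \<open>max (g - f n) 0\<close> of \<open>g\<close> that are not yet covered decrease
  to zero.
\<close>

lemma I_le_increasing:
  assumes g: "g \<in> bcontfun" and f: "\<And>n::nat. f n \<in> bcontfun" and inc: "\<And>n x. f n x \<le> f (Suc n) x"
    and above: "\<And>x e. 0 < e \<Longrightarrow> \<exists>n. g x - e < f n x" and le: "\<And>n. I (f n) \<le> c"
  shows "I g \<le> c"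
proof -
  define h where "h n x = max (g x - f n x) 0" for n x
  have h: "h n \<in> bcontfun" for n
    unfolding h_def[abs_def] by (intro bcontfun_max bcontfun_diff g f const_bcontfun)
  have dec: "h (Suc n) x \<le> h n x" for n x using inc[of n x] by (auto simp: h_def)
  have "(\<lambda>n. I (h n)) \<longlonglongrightarrow> 0"
  proof (rule I_decreasing)
    show "h n \<in> bcontfun" "h (Suc n) x \<le> h n x" for n x by (rule h, rule dec)
    fix x show "(\<lambda>n. h n x) \<longlonglongrightarrow> 0"
    proof (rule LIMSEQ_I)
      fix e :: real assume e: "0 < e"
      from above[OF this, of x] obtain N where N: "g x - e < f N x" by auto
      have "h n x \<le> h N x" if "n \<ge> N" for n
        using that lift_Suc_antimono_le[of "\<lambda>n. h n x"] dec by auto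
      moreover have "h N x < e" using N e by (auto simp: h_def)
      moreover have "0 \<le> h n x" for n by (simp add: h_def)
      ultimately show "\<exists>N. \<forall>n\<ge>N. norm (h n x - 0) < e" by (auto intro!: exI[of _ N] intro: le_less_trans)
    qed
  qed
  then have "(\<lambda>n. c + I (h n)) \<longlonglongrightarrow> c + 0" by (intro tendsto_intros)
  moreover have "I g \<le> c + I (h n)" for n
  proof -
    have "I g \<le> I (\<lambda>x. f n x + h n x)"
      by (intro I_mono g bcontfun_add f h) (auto simp: h_def)
    also have "\<dots> \<le> c + I (h n)" using le[of n] by (simp add: I_add f h)
    finally show ?thesis .
  qed
  ultimately show ?thesis by (auto intro: LIMSEQ_le_const)
qed

definition vol :: "'a set \<Rightarrow> real" where
  "vol U = Sup {I f |f. f \<in> bcontfun \<and> (\<forall>x. 0 \<le> f x \<and> f x \<le> indicator U x)}"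

lemma vol_upper:
  assumes "f \<in> bcontfun" "\<And>x. 0 \<le> f x" "\<And>x. f x \<le> indicator U x"
  shows "I f \<le> vol U"
  unfolding vol_def
proof (rule cSup_upper)
  show "bdd_above {I f |f. f \<in> bcontfun \<and> (\<forall>x. 0 \<le> f x \<and> f x \<le> indicator U x)}"
  proof (rule bdd_aboveI[of _ "I (\<lambda>_. 1)"], clarify)
    fix f :: "'a \<Rightarrow> real" assume f: "f \<in> bcontfun" "\<forall>x. 0 \<le> f x \<and> f x \<le> indicator U x"
    have "f x \<le> 1" for x using f(2)[rule_format, of x] by (cases "x \<in> U") auto
    with f(1) show "I f \<le> I (\<lambda>_. 1)" by (intro I_mono const_bcontfun)
  qed
qed (use assms in auto)

lemma vol_least:
  assumes "\<And>f. f \<in> bcontfun \<Longrightarrow> (\<And>x. 0 \<le> f x) \<Longrightarrow> (\<And>x. f x \<le> indicator U x) \<Longrightarrow> I f \<le> c"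
  shows "vol U \<le> c"
  unfolding vol_def
proof (rule cSup_least)
  have "(\<lambda>_. 0) \<in> bcontfun \<and> (\<forall>x. (0::real) \<le> 0 \<and> 0 \<le> (indicator U x :: real))"
    by (simp add: const_bcontfun)
  then show "{I f |f. f \<in> bcontfun \<and> (\<forall>x. 0 \<le> f x \<and> f x \<le> indicator U x)} \<noteq> {}" by blast
qed (use assms in auto)

lemma vol_nonneg: "0 \<le> vol U"
  using vol_upper[of "\<lambda>_. 0" U] I_const[of 0] by (simp add: const_bcontfun)

lemma vol_mono: "U \<subseteq> V \<Longrightarrow> vol U \<le> vol V"
  by (intro vol_least vol_upper) (auto intro: order_trans[OF _ indicator_leI])

lemma vol_empty: "vol {} = 0"
proof (rule antisym[OF vol_least vol_nonneg])
  fix f :: "'a \<Rightarrow> real" assume f: "f \<in> bcontfun" "\<And>x. 0 \<le> f x" "\<And>x. f x \<le> indicator {} x"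
  then have "f = (\<lambda>_. 0)" by (auto intro!: antisym ext)
  then show "I f \<le> 0" using I_const[of 0] by simp
qed

text \<open>
  A function below the indicator of the union is exhausted by finite sums of functions that exhaust the
  individual sets.
\<close>

lemma vol_Union_le:
  fixes U :: "nat \<Rightarrow> 'a set"
  assumes U: "\<And>i. open (U i)" and c: "\<And>n. (\<Sum>i<n. vol (U i)) \<le> c"
  shows "vol (\<Union>i. U i) \<le> c"
proof (rule vol_least)
  fix g :: "'a \<Rightarrow> real" assume g: "g \<in> bcontfun" "\<And>x. 0 \<le> g x" "\<And>x. g x \<le> indicator (\<Union>i. U i) x"
  have "\<exists>\<eta>. (\<forall>n. \<eta> n \<in> bcontfun) \<and> (\<forall>n x. 0 \<le> \<eta> n x \<and> \<eta> n x \<le> indicator (U i) x) \<and>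
    (\<forall>m n x. m \<le> n \<longrightarrow> \<eta> m x \<le> \<eta> n x) \<and> (\<forall>x. (\<lambda>n. \<eta> n x) \<longlonglongrightarrow> (indicator (U i) x::real))" for i
    by (rule bcontfun_approx_open[OF U[of i]]) blast
  then obtain \<eta> :: "nat \<Rightarrow> nat \<Rightarrow> 'a \<Rightarrow> real" where \<eta>: "\<And>i n. \<eta> i n \<in> bcontfun" "\<And>i n x. 0 \<le> \<eta> i n x" "\<And>i n x. \<eta> i n x \<le> indicator (U i) x"
    "\<And>i m n x. m \<le> n \<Longrightarrow> \<eta> i m x \<le> \<eta> i n x" "\<And>i x. (\<lambda>n. \<eta> i n x) \<longlonglongrightarrow> indicator (U i) x"
    by metis
  show "I g \<le> c"
  proof (rule I_le_increasing[OF g(1), of "\<lambda>n x. \<Sum>i<n. \<eta> i n x"])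
    show "(\<lambda>x. \<Sum>i<n. \<eta> i n x) \<in> bcontfun" for n by (intro bcontfun_sum \<eta>)
    show "(\<Sum>i<n. \<eta> i n x) \<le> (\<Sum>i<Suc n. \<eta> i (Suc n) x)" for n x
    proof -
      have "(\<Sum>i<n. \<eta> i n x) \<le> (\<Sum>i<n. \<eta> i (Suc n) x)" by (intro sum_mono \<eta>) auto
      also have "\<dots> \<le> (\<Sum>i<Suc n. \<eta> i (Suc n) x)" using \<eta>(2) by simp
      finally show ?thesis .
    qed
    show "I (\<lambda>x. \<Sum>i<n. \<eta> i n x) \<le> c" for n
    proof -
      have "I (\<lambda>x. \<Sum>i<n. \<eta> i n x) = (\<Sum>i<n. I (\<eta> i n))" by (intro I_sum \<eta>)
      also have "\<dots> \<le> (\<Sum>i<n. vol (U i))" by (intro sum_mono vol_upper \<eta>)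
      finally show ?thesis using c[of n] by simp
    qed
    fix x and e :: real assume e: "0 < e"
    show "\<exists>n. g x - e < (\<Sum>i<n. \<eta> i n x)"
    proof (cases "x \<in> (\<Union>i. U i)")
      case True
      then obtain j where j: "x \<in> U j" by auto
      have "eventually (\<lambda>n. 1 - e < \<eta> j n x) sequentially"
        using \<eta>(5)[of j x] j e by (intro order_tendstoD(1)) auto
      then obtain N where N: "\<And>n. n \<ge> N \<Longrightarrow> 1 - e < \<eta> j n x" by (auto simp: eventually_sequentially)
      let ?n = "max N (Suc j)"
      have "g x - e < \<eta> j ?n x" using N[of ?n] g(3)[of x] True by (simp add: indicator_def)
      also have "\<dots> \<le> (\<Sum>i<?n. \<eta> i ?n x)" using \<eta>(2) by (intro member_le_sum) auto
      finally show ?thesis by blast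
    next
      case False
      then show ?thesis using g(3)[of x] e by (auto intro!: exI[of _ 0])
    qed
  qed
qed

text \<open>
  The outer measure that extends \<open>vol\<close> from the open sets.
\<close>

definition outer_vol :: "'a set \<Rightarrow> ennreal" where
  "outer_vol A = (INF U\<in>{U. open U \<and> A \<subseteq> U}. ennreal (vol U))"

lemma outer_vol_le: "open U \<Longrightarrow> A \<subseteq> U \<Longrightarrow> outer_vol A \<le> ennreal (vol U)"
  unfolding outer_vol_def by (rule INF_lower) simp

lemma outer_vol_mono: "A \<subseteq> B \<Longrightarrow> outer_vol A \<le> outer_vol B"
  unfolding outer_vol_def by (rule INF_superset_mono) auto

lemma outer_vol_open: "open U \<Longrightarrow> outer_vol U = ennreal (vol U)"
  unfolding outer_vol_def by (intro antisym INF_lower INF_greatest ennreal_leI vol_mono) auto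

text \<open>
  Open supersets whose volumes exceed the outer measures by a geometric series reduce the claim to
  \<open>vol_Union_le\<close>.
\<close>

lemma outer_vol_Union_le: "outer_vol (\<Union>i::nat. A i) \<le> (\<Sum>i. outer_vol (A i))"
proof (rule ennreal_le_epsilon)
  fix e :: real assume e: "0 < e" and fin: "(\<Sum>i. outer_vol (A i)) < top"
  have "\<exists>U. open U \<and> A i \<subseteq> U \<and> ennreal (vol U) \<le> outer_vol (A i) + ennreal (e * (1/2) ^ Suc i)" for i
  proof -
    have "outer_vol (A i) < top" using fin by (rule ennreal_suminf_lessD)
    then have "outer_vol (A i) < outer_vol (A i) + ennreal (e * (1/2) ^ Suc i)"
      using e by (cases "outer_vol (A i)") (auto simp: ennreal_less_iff simp flip: ennreal_plus)
    then obtain U where "open U" "A i \<subseteq> U" "ennreal (vol U) < outer_vol (A i) + ennreal (e * (1/2) ^ Suc i)"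
      unfolding outer_vol_def[of "A i"] INF_less_iff by auto
    then show ?thesis by (auto intro: less_imp_le)
  qed
  then obtain U where U: "\<And>i. open (U i)" "\<And>i. A i \<subseteq> U i"
    "\<And>i. ennreal (vol (U i)) \<le> outer_vol (A i) + ennreal (e * (1/2) ^ Suc i)" by metis
  have geo: "(\<Sum>i. ennreal (e * (1/2) ^ Suc i)) = ennreal e"
  proof -
    have "(\<lambda>i. e * (1/2) ^ Suc i) sums (e * 1)" by (intro sums_mult power_half_series)
    then show ?thesis using e by (intro suminf_ennreal_eq) auto
  qed
  have S: "(\<Sum>i. ennreal (vol (U i))) \<le> (\<Sum>i. outer_vol (A i)) + ennreal e"
  proof -
    have "(\<Sum>i. ennreal (vol (U i))) \<le> (\<Sum>i. outer_vol (A i) + ennreal (e * (1/2) ^ Suc i))"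
      by (intro suminf_le U) auto
    also have "\<dots> = (\<Sum>i. outer_vol (A i)) + (\<Sum>i. ennreal (e * (1/2) ^ Suc i))"
      by (intro suminf_add[symmetric]) auto
    finally show ?thesis by (simp only: geo)
  qed
  then have Sfin: "(\<Sum>i. ennreal (vol (U i))) < top" using fin by (auto intro: le_less_trans)
  define c where "c = enn2real (\<Sum>i. ennreal (vol (U i)))"
  have c: "ennreal c = (\<Sum>i. ennreal (vol (U i)))" using Sfin by (simp add: c_def less_top)
  have "(\<Sum>i<n. vol (U i)) \<le> c" for n
  proof -
    have "ennreal (\<Sum>i<n. vol (U i)) = (\<Sum>i<n. ennreal (vol (U i)))"
      by (simp add: sum_ennreal vol_nonneg)
    also have "\<dots> \<le> ennreal c" unfolding c by (rule sum_le_suminf) auto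
    finally show ?thesis by (simp add: c_def)
  qed
  then have "vol (\<Union>i. U i) \<le> c" by (rule vol_Union_le[OF U(1)])
  have "outer_vol (\<Union>i. A i) \<le> ennreal (vol (\<Union>i. U i))" using U by (intro outer_vol_le) auto
  also have "\<dots> \<le> ennreal c" using \<open>vol (\<Union>i. U i) \<le> c\<close> by (rule ennreal_leI)
  also have "\<dots> \<le> (\<Sum>i. outer_vol (A i)) + ennreal e" unfolding c by (rule S)
  finally show "outer_vol (\<Union>i. A i) \<le> (\<Sum>i. outer_vol (A i)) + ennreal e" .
qed

lemma outer_vol_outer: "outer_measure_space (Pow UNIV) outer_vol"
  unfolding outer_measure_space_def positive_def increasing_def countably_subadditive_def
  using outer_vol_open[of "{}"] by (auto simp: vol_empty outer_vol_mono outer_vol_Union_le)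

text \<open>
  Open sets split every set additively: a function that almost exhausts \<open>W \<inter> U\<close>, lowered by
  \<open>\<delta>\<close>, lives where it is \<open>> \<delta>\<close>, and the complement of \<open>U\<close> in \<open>W\<close> has the disjoint open
  neighbourhood where it is \<open>< \<delta>\<close>.
\<close>

lemma outer_vol_split_open:
  assumes W: "open W" and U: "open U"
  shows "outer_vol (W \<inter> U) + outer_vol (W - U) \<le> ennreal (vol W)"
proof -
  obtain \<eta> :: "nat \<Rightarrow> 'a \<Rightarrow> real" where \<eta>: "\<And>n. \<eta> n \<in> bcontfun" "\<And>n x. 0 \<le> \<eta> n x" "\<And>n x. \<eta> n x \<le> indicator (W \<inter> U) x"
    "\<And>m n x. m \<le> n \<Longrightarrow> \<eta> m x \<le> \<eta> n x" "\<And>x. (\<lambda>n. \<eta> n x) \<longlonglongrightarrow> indicator (W \<inter> U) x"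
    by (rule bcontfun_approx_open[OF open_Int[OF W U]]) blast
  define w where "w = enn2real (outer_vol (W - U))"
  have "outer_vol (W - U) \<le> ennreal (vol W)" by (intro outer_vol_le W) auto
  then have w: "outer_vol (W - U) = ennreal w" "0 \<le> w" by (auto simp: w_def le_less_trans less_top)
  have step: "I (\<eta> n) - d * I (\<lambda>_. 1) + w \<le> vol W" if d: "0 < d" "d < 1" for n d
  proof -
    define V where "V = W \<inter> {x. \<eta> n x < d}"
    define g where "g x = max (\<eta> n x - d) 0" for x
    have gb: "g \<in> bcontfun" unfolding g_def[abs_def] by (intro bcontfun_max bcontfun_diff \<eta> const_bcontfun)
    have "open {x. \<eta> n x < d}"
      using bcontfun_continuous[OF \<eta>(1)[of n]] by (intro open_Collect_less continuous_intros)
    then have V: "open V" unfolding V_def using W by auto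
    have "W - U \<subseteq> V"
    proof
      fix x assume "x \<in> W - U"
      then show "x \<in> V" using \<eta>(3)[of n x] d by (auto simp: V_def)
    qed
    then have "ennreal w \<le> ennreal (vol V)" unfolding w(1)[symmetric] by (rule outer_vol_le[OF V])
    then have "w \<le> vol V" using vol_nonneg by simp
    also have "vol V \<le> vol W - I g"
    proof (rule vol_least)
      fix h :: "'a \<Rightarrow> real" assume h: "h \<in> bcontfun" "\<And>x. 0 \<le> h x" "\<And>x. h x \<le> indicator V x"
      have "g x + h x \<le> indicator W x" for x
      proof (cases "\<eta> n x < d")
        case True
        then have "g x = 0" by (simp add: g_def)
        then show ?thesis using h(3)[of x] by (cases "x \<in> W"; simp add: V_def True)
      next
        case False
        then have "x \<in> W" "\<eta> n x \<le> 1" using \<eta>(3)[of n x] d False by (cases "x \<in> W"; cases "x \<in> U"; simp)+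
        moreover have "h x = 0" using h(2,3)[of x] False by (auto simp: V_def)
        ultimately show ?thesis using d by (simp add: g_def)
      qed
      then have "I (\<lambda>x. g x + h x) \<le> vol W"
        using h by (intro vol_upper bcontfun_add gb) (auto simp: g_def)
      then show "I h \<le> vol W - I g" by (simp add: I_add gb h)
    qed
    also have "I (\<lambda>x. \<eta> n x - d) \<le> I g"
      by (intro I_mono bcontfun_diff \<eta> const_bcontfun gb) (auto simp: g_def)
    then have "vol W - I g \<le> vol W - (I (\<eta> n) - d * I (\<lambda>_. 1))"
      using I_diff[OF \<eta>(1) const_bcontfun[of d], of n] I_const[of d] by simp
    finally show ?thesis by simp
  qed
  have "I (\<eta> n) \<le> vol W - w" for n
  proof (rule field_le_epsilon)
    fix e :: real assume e: "0 < e"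
    have I1: "0 \<le> I (\<lambda>_. 1)" by (intro I_nonneg const_bcontfun) auto
    define d where "d = min (1/2) (e / (I (\<lambda>_. 1) + 1))"
    have d: "0 < d" "d < 1" using e I1 by (auto simp: d_def)
    have "d * I (\<lambda>_. 1) \<le> (e / (I (\<lambda>_. 1) + 1)) * I (\<lambda>_. 1)" using I1 by (intro mult_right_mono) (auto simp: d_def)
    also have "\<dots> \<le> e" using I1 e by (simp add: field_simps)
    finally show "I (\<eta> n) \<le> vol W - w + e" using step[OF d, of n] by linarith
  qed
  then have "vol (W \<inter> U) \<le> vol W - w"
  proof (intro vol_least)
    fix g :: "'a \<Rightarrow> real" assume le: "\<And>n. I (\<eta> n) \<le> vol W - w" and g: "g \<in> bcontfun" "\<And>x. 0 \<le> g x" "\<And>x. g x \<le> indicator (W \<inter> U) x"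
    show "I g \<le> vol W - w"
    proof (rule I_le_increasing[OF g(1) \<eta>(1) \<eta>(4) _ le])
      fix x and e :: real assume e: "0 < e"
      have "eventually (\<lambda>n. indicator (W \<inter> U) x - e < \<eta> n x) sequentially"
        using \<eta>(5)[of x] e by (intro order_tendstoD(1)) auto
      then obtain n where "indicator (W \<inter> U) x - e < \<eta> n x" by (auto simp: eventually_sequentially)
      then have "g x - e < \<eta> n x" using g(3)[of x] by linarith
      then show "\<exists>n. g x - e < \<eta> n x" ..
    qed simp
  qed
  then have "ennreal (vol (W \<inter> U)) + ennreal w \<le> ennreal (vol W)"
    using w(2) vol_nonneg by (simp flip: ennreal_plus)
  then show ?thesis using w(1) outer_vol_open[OF open_Int[OF W U]] by simp
qed

lemma outer_vol_lambda: "open U \<Longrightarrow> U \<in> lambda_system UNIV (Pow UNIV) outer_vol"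
  unfolding lambda_system_def
proof (clarsimp, rule antisym)
  fix A assume U: "open U"
  show "outer_vol (U \<inter> A) + outer_vol ((UNIV - U) \<inter> A) \<le> outer_vol A"
    unfolding outer_vol_def[of A]
  proof (rule INF_greatest)
    fix W assume "W \<in> {W. open W \<and> A \<subseteq> W}"
    then have W: "open W" "A \<subseteq> W" by auto
    have "outer_vol (U \<inter> A) + outer_vol ((UNIV - U) \<inter> A) \<le> outer_vol (W \<inter> U) + outer_vol (W - U)"
      using W by (intro add_mono outer_vol_mono) auto
    also have "\<dots> \<le> ennreal (vol W)" by (rule outer_vol_split_open[OF W(1) U])
    finally show "outer_vol (U \<inter> A) + outer_vol ((UNIV - U) \<inter> A) \<le> ennreal (vol W)" .
  qed
  define B where "B i = (if i = 0 then U \<inter> A else if i = Suc 0 then (UNIV - U) \<inter> A else {})" for i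
  have "outer_vol A \<le> outer_vol (\<Union>i. B i)" by (rule outer_vol_mono) (force simp: B_def)
  also have "\<dots> \<le> (\<Sum>i. outer_vol (B i))" by (rule outer_vol_Union_le)
  also have "\<dots> = (\<Sum>i<2. outer_vol (B i))"
    using outer_vol_open[of "{}"] by (intro suminf_finite) (auto simp: B_def vol_empty)
  also have "\<dots> = outer_vol (U \<inter> A) + outer_vol ((UNIV - U) \<inter> A)" by (simp add: B_def numeral_2_eq_2)
  finally show "outer_vol A \<le> outer_vol (U \<inter> A) + outer_vol ((UNIV - U) \<inter> A)" .
qed

definition rep_measure :: "'a measure" where
  "rep_measure = measure_of UNIV (sets borel) outer_vol"

lemma sets_rep_measure: "sets rep_measure = sets borel"
  unfolding rep_measure_def by (metis sets.sets_measure_of_eq space_borel)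

lemma space_rep_measure: "space rep_measure = UNIV"
  using sets_eq_imp_space_eq[OF sets_rep_measure] by simp

lemma emeasure_rep_measure: "A \<in> sets borel \<Longrightarrow> emeasure rep_measure A = outer_vol A"
proof -
  assume A: "A \<in> sets borel"
  have 1: "measure_space UNIV (lambda_system UNIV (Pow UNIV) outer_vol) outer_vol"
    by (rule sigma_algebra.caratheodory_lemma[OF sigma_algebra_Pow outer_vol_outer])
  then have sa: "sigma_algebra UNIV (lambda_system UNIV (Pow UNIV) outer_vol)" by (simp add: measure_space_def)
  have "sets borel \<subseteq> lambda_system UNIV (Pow UNIV) outer_vol"
  proof -
    have "sets borel = sigma_sets UNIV {S :: 'a set. open S}" by (simp add: borel_def)
    moreover have "{S. open S} \<subseteq> lambda_system UNIV (Pow UNIV) outer_vol" using outer_vol_lambda by auto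
    ultimately show ?thesis using sigma_algebra.sigma_sets_subset[OF sa] by metis
  qed
  then have "measure_space UNIV (sets borel) outer_vol"
    using measure_down[OF 1, of "sets borel"] sets.sigma_algebra_axioms[of borel] by simp
  then show ?thesis
    unfolding rep_measure_def using A sets.sigma_algebra_axioms[of "borel :: 'a measure"]
    by (intro emeasure_measure_of_sigma) (auto simp: measure_space_def)
qed

lemma measure_rep_measure_open: "open U \<Longrightarrow> measure rep_measure U = vol U"
  by (simp add: measure_def emeasure_rep_measure outer_vol_open vol_nonneg)

lemma finite_measure_rep_measure: "finite_measure rep_measure"
  by (rule finite_measureI) (simp add: space_rep_measure emeasure_rep_measure outer_vol_open)

text \<open>
  A nonnegative function is cut into horizontal slices of height \<open>\<delta>\<close>. Each slice is squeezed
  between multiples of the indicators of two consecutive superlevel sets, for \<open>I\<close> as well as for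
  the integral, and the resulting errors telescope.
\<close>

lemma integral_rep_measure_nonneg:
  assumes f: "f \<in> bcontfun" and nn: "\<And>x. 0 \<le> f x"
  shows "(LINT x|rep_measure. f x) = I f"
proof -
  interpret fin: finite_measure rep_measure by (rule finite_measure_rep_measure)
  have meas: "h \<in> borel_measurable rep_measure" if "h \<in> bcontfun" for h :: "'a \<Rightarrow> real"
    using borel_measurable_continuous_onI[OF bcontfun_continuous[OF that]]
    by (simp add: measurable_cong_sets[OF sets_rep_measure refl])
  have int: "integrable rep_measure h" if hb: "h \<in> bcontfun" for h :: "'a \<Rightarrow> real"
  proof -
    obtain C where "continuous_on UNIV h" "\<And>x. \<bar>h x\<bar> \<le> C" "0 \<le> C" using hb by (rule bcontfunD) auto
    then show ?thesis by (intro fin.integrable_const_bound[of _ C] meas hb) auto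
  qed
  obtain C where C: "continuous_on UNIV f" "\<And>x. \<bar>f x\<bar> \<le> C" "0 \<le> C" using f by (rule bcontfunD) auto
  define v where "v t = vol {x. t < f x}" for t
  have op: "open {x. t < f x}" for t using C(1) by (intro open_Collect_less continuous_intros)
  then have [measurable]: "{x. t < f x} \<in> sets rep_measure" for t by (simp add: sets_rep_measure)
  have est: "\<bar>(LINT x|rep_measure. f x) - I f\<bar> \<le> vol UNIV * \<delta>" if \<delta>: "0 < \<delta>" for \<delta>
  proof -
    obtain m where m: "C \<le> real m * \<delta>" using reals_Archimedean3[OF \<delta>] by (meson less_imp_le)
    \<comment> \<open>The slice of \<open>f\<close> between the heights \<open>k \<delta>\<close> and \<open>(k + 1) \<delta>\<close>; the first \<open>m\<close> slices exhaust \<open>f\<close>.\<close>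
    define s where "s k x = min (max (f x - real k * \<delta>) 0) \<delta>" for k x
    have s: "s k \<in> bcontfun" for k
      unfolding s_def[abs_def] by (intro bcontfun_min bcontfun_max bcontfun_diff f const_bcontfun)
    have "(\<Sum>k<m. s k x) = min (f x) (real m * \<delta>)" for x
    proof (induction m)
      case (Suc m)
      then show ?case using \<delta> by (auto simp: s_def min_def max_def algebra_simps)
    qed (use nn[of x] in simp)
    then have fs: "f = (\<lambda>x. \<Sum>k<m. s k x)"
      using m C(2) by (auto simp: fun_eq_iff min_def) (smt (verit, best))
    have s_le: "s k x \<le> \<delta> * indicator {x. real k * \<delta> < f x} x"
      and s_ge: "\<delta> * indicator {x. real (Suc k) * \<delta> < f x} x \<le> s k x" for k x
      using \<delta> by (auto simp: s_def indicator_def algebra_simps)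
    have I_s: "\<delta> * v (real (Suc k) * \<delta>) \<le> I (s k)" "I (s k) \<le> \<delta> * v (real k * \<delta>)" for k
    proof -
      have sd: "(\<lambda>x. (1/\<delta>) * s k x) \<in> bcontfun" by (intro bcontfun_mult const_bcontfun s)
      have "v (real (Suc k) * \<delta>) \<le> I (\<lambda>x. (1/\<delta>) * s k x)"
        unfolding v_def
      proof (rule vol_least, rule I_mono[OF _ sd])
        fix h :: "'a \<Rightarrow> real" and x assume "\<And>x. h x \<le> indicator {x. real (Suc k) * \<delta> < f x} x"
        then have "h x \<le> indicator {x. real (Suc k) * \<delta> < f x} x" .
        also have "\<dots> \<le> (1/\<delta>) * s k x" using s_ge[of k x] \<delta> by (simp add: field_simps)
        finally show "h x \<le> (1/\<delta>) * s k x" .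
      qed
      then show "\<delta> * v (real (Suc k) * \<delta>) \<le> I (s k)" using \<delta> by (simp only: I_cmult[OF s]) (simp add: field_simps)
      have "I (\<lambda>x. (1/\<delta>) * s k x) \<le> v (real k * \<delta>)"
        unfolding v_def using s_le[of k] \<delta> by (intro vol_upper sd) (auto simp: field_simps s_def)
      then show "I (s k) \<le> \<delta> * v (real k * \<delta>)" using \<delta> by (simp only: I_cmult[OF s]) (simp add: field_simps)
    qed
    have L_s: "\<delta> * v (real (Suc k) * \<delta>) \<le> (LINT x|rep_measure. s k x)" "(LINT x|rep_measure. s k x) \<le> \<delta> * v (real k * \<delta>)" for k
    proof -
      have ind: "(LINT x|rep_measure. \<delta> * indicator {x. t < f x} x) = \<delta> * v t"
        "integrable rep_measure (\<lambda>x. \<delta> * indicator {x. t < f x} x)" for t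
        using measure_rep_measure_open[OF op] by (auto simp: v_def fin.emeasure_finite less_top[symmetric] space_rep_measure)
      show "\<delta> * v (real (Suc k) * \<delta>) \<le> (LINT x|rep_measure. s k x)" "(LINT x|rep_measure. s k x) \<le> \<delta> * v (real k * \<delta>)"
        unfolding ind(1)[symmetric] using s_le s_ge by (intro integral_mono ind int s; simp)+
    qed
    have "\<bar>(LINT x|rep_measure. f x) - I f\<bar> = \<bar>\<Sum>k<m. ((LINT x|rep_measure. s k x) - I (s k))\<bar>"
      by (subst (1 2) fs) (simp add: I_sum[OF s] Bochner_Integration.integral_sum[OF int[OF s]] sum_subtractf)
    also have "\<dots> \<le> (\<Sum>k<m. \<bar>(LINT x|rep_measure. s k x) - I (s k)\<bar>)" by (rule sum_abs)
    also have "\<dots> \<le> (\<Sum>k<m. \<delta> * v (real k * \<delta>) - \<delta> * v (real (Suc k) * \<delta>))"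
    proof (rule sum_mono)
      fix k show "\<bar>(LINT x|rep_measure. s k x) - I (s k)\<bar> \<le> \<delta> * v (real k * \<delta>) - \<delta> * v (real (Suc k) * \<delta>)"
        using I_s[of k] L_s[of k] by linarith
    qed
    also have "\<dots> = \<delta> * v 0 - \<delta> * v (real m * \<delta>)"
      by (subst sum_lessThan_telescope') simp
    also have "\<dots> \<le> vol UNIV * \<delta>"
    proof -
      have "0 \<le> v (real m * \<delta>)" "v 0 \<le> vol UNIV" by (auto simp: v_def vol_nonneg intro: vol_mono)
      then have "0 \<le> \<delta> * v (real m * \<delta>)" "\<delta> * v 0 \<le> \<delta> * vol UNIV" using \<delta> by auto
      then show ?thesis by (simp add: mult.commute)
    qed
    finally show ?thesis .
  qed
  have "\<bar>(LINT x|rep_measure. f x) - I f\<bar> \<le> 0"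
  proof (rule field_le_epsilon)
    fix e :: real assume e: "0 < e"
    have "\<bar>(LINT x|rep_measure. f x) - I f\<bar> \<le> vol UNIV * (e / (vol UNIV + 1))"
      using e vol_nonneg[of UNIV] by (intro est) auto
    also have "\<dots> \<le> 0 + e" using e vol_nonneg[of UNIV] by (simp add: field_simps)
    finally show "\<bar>(LINT x|rep_measure. f x) - I f\<bar> \<le> 0 + e" .
  qed
  then show ?thesis by simp
qed

theorem integral_rep_measure:
  assumes f: "f \<in> bcontfun" shows "(LINT x|rep_measure. f x) = I f"
proof -
  interpret fin: finite_measure rep_measure by (rule finite_measure_rep_measure)
  obtain C where C: "continuous_on UNIV f" "\<And>x. \<bar>f x\<bar> \<le> C" "0 \<le> C" using f by (rule bcontfunD) auto
  have "f \<in> borel_measurable rep_measure"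
    using borel_measurable_continuous_onI[OF C(1)] by (simp add: measurable_cong_sets[OF sets_rep_measure refl])
  then have int: "integrable rep_measure f" using C(2) by (intro fin.integrable_const_bound[of _ C]) auto
  have nn: "0 \<le> f x + C" for x using C(2)[of x] by linarith
  have "(LINT x|rep_measure. f x + C) = I (\<lambda>x. f x + C)"
    by (intro integral_rep_measure_nonneg bcontfun_add f const_bcontfun nn)
  moreover have "(LINT x|rep_measure. C) = I (\<lambda>x. C)"
    by (intro integral_rep_measure_nonneg const_bcontfun C)
  ultimately show ?thesis using int I_add[OF f const_bcontfun[of C]] by simp
qed

end

text \<open>
  The indicator of an open set is an increasing limit of bounded continuous functions, and the open
  sets generate the Borel sets and are closed under intersection.
\<close>

lemma finite_borel_measure_eqI:
  fixes \<mu> \<sigma> :: "'a::metric_space measure"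
  assumes sets: "sets \<mu> = sets borel" "sets \<sigma> = sets borel" and fin: "finite_measure \<mu>" "finite_measure \<sigma>"
    and eq: "\<And>f :: 'a \<Rightarrow> real. f \<in> bcontfun \<Longrightarrow> (LINT x|\<mu>. f x) = (LINT x|\<sigma>. f x)"
  shows "\<mu> = \<sigma>"
proof -
  interpret \<mu>: finite_measure \<mu> by fact
  interpret \<sigma>: finite_measure \<sigma> by fact
  have open_lim: "(\<lambda>n. LINT x|\<rho>. \<eta> n x) \<longlonglongrightarrow> measure \<rho> U"
    if "finite_measure \<rho>" "sets \<rho> = sets borel" "open U" "\<And>n. \<eta> n \<in> bcontfun" "\<And>n x. 0 \<le> \<eta> n x"
      "\<And>n x. \<eta> n x \<le> indicator U x" "\<And>x. (\<lambda>n. \<eta> n x) \<longlonglongrightarrow> (indicator U x::real)"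
    for \<rho> :: "'a measure" and U and \<eta> :: "nat \<Rightarrow> 'a \<Rightarrow> real"
  proof -
    interpret \<rho>: finite_measure \<rho> by fact
    have sp: "space \<rho> = UNIV" using sets_eq_imp_space_eq[OF that(2)] by simp
    have U: "U \<in> sets \<rho>" using that by auto
    have "(\<lambda>n. LINT x|\<rho>. \<eta> n x) \<longlonglongrightarrow> (LINT x|\<rho>. indicator U x)"
    proof (rule integral_dominated_convergence[where w="\<lambda>_. 1"])
      show "\<eta> n \<in> borel_measurable \<rho>" for n
        using borel_measurable_continuous_onI[OF bcontfun_continuous[OF that(4)]]
        by (simp add: measurable_cong_sets[OF that(2) refl])
      have "norm (\<eta> n x) \<le> 1" for n x
        using that(5)[of n x] that(6)[of n x] by (cases "x \<in> U") auto
      then show "AE x in \<rho>. norm (\<eta> n x) \<le> 1" for n by simp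
    qed (use that(7) U in auto)
    then show ?thesis using U sp by simp
  qed
  have open_eq: "emeasure \<mu> U = emeasure \<sigma> U" if U: "open U" for U
  proof -
    obtain \<eta> :: "nat \<Rightarrow> 'a \<Rightarrow> real" where \<eta>: "\<And>n. \<eta> n \<in> bcontfun" "\<And>n x. 0 \<le> \<eta> n x" "\<And>n x. \<eta> n x \<le> indicator U x"
      "\<And>m n x. m \<le> n \<Longrightarrow> \<eta> m x \<le> \<eta> n x" "\<And>x. (\<lambda>n. \<eta> n x) \<longlonglongrightarrow> indicator U x"
      by (rule bcontfun_approx_open[OF U]) blast
    have "measure \<mu> U = measure \<sigma> U"
      using open_lim[OF fin(1) sets(1) U \<eta>(1,2,3,5)] open_lim[OF fin(2) sets(2) U \<eta>(1,2,3,5)] eq[OF \<eta>(1)]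
      by (auto intro: LIMSEQ_unique)
    then show ?thesis by (simp add: \<mu>.emeasure_eq_measure \<sigma>.emeasure_eq_measure)
  qed
  show ?thesis
  proof (rule measure_eqI_generator_eq[where E="{U. open U}" and \<Omega>=UNIV and A="\<lambda>_. UNIV"])
    show "sets \<mu> = sigma_sets UNIV {U. open U}" "sets \<sigma> = sigma_sets UNIV {U. open U}"
      using sets by (auto simp: borel_def)
  qed (auto simp: Int_stable_def open_eq)
qed

lemma Dini_compact:
  fixes f :: "nat \<Rightarrow> 'a::topological_space \<Rightarrow> real"
  assumes K: "compact K" and cont: "\<And>n. continuous_on UNIV (f n)" and dec: "\<And>n x. f (Suc n) x \<le> f n x"
    and lim: "\<And>x. (\<lambda>n. f n x) \<longlonglongrightarrow> 0" and e: "0 < e"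
  shows "\<exists>N. \<forall>n\<ge>N. \<forall>x\<in>K. f n x < e"
proof -
  have mono: "f n x \<le> f m x" if "m \<le> n" for m n x
    using that lift_Suc_antimono_le[of "\<lambda>n. f n x"] dec by auto
  have op: "open {x. f n x < e}" for n using cont by (intro open_Collect_less continuous_intros)
  have "K \<subseteq> (\<Union>n\<in>UNIV. {x. f n x < e})"
  proof
    fix x assume "x \<in> K"
    have "eventually (\<lambda>n. f n x < e) sequentially" using order_tendstoD(2)[OF lim e] .
    then show "x \<in> (\<Union>n\<in>UNIV. {x. f n x < e})" by (auto simp: eventually_sequentially)
  qed
  then obtain S where S: "finite S" "K \<subseteq> (\<Union>n\<in>S. {x. f n x < e})"
    using compactE_image[OF K, of UNIV "\<lambda>n. {x. f n x < e}"] op by metis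
  have "f n x < e" if n: "n \<ge> Max (insert 0 S)" and x: "x \<in> K" for n x
  proof -
    obtain m where m: "m \<in> S" "f m x < e" using S(2) x by auto
    then have "m \<le> n" using n S(1) by (auto intro: order_trans[OF Max_ge])
    then show ?thesis using mono[of m n x] m by simp
  qed
  then show ?thesis by blast
qed

section \<open>Slabs between level sets\<close>

text \<open>
  The function \<open>ramp a b\<close> rises linearly from \<open>0\<close> to \<open>b - a\<close> on the interval from \<open>a\<close> to \<open>b\<close>, and
  \<open>slab a b\<close> is its derivative, with the value \<open>1/2\<close> at the two corners. Writing both through absolute
  values and signs makes the chain rule \<open>graph_abs\<close> applicable.
\<close>

definition ramp :: "real \<Rightarrow> real \<Rightarrow> real \<Rightarrow> real" where
  "ramp a b y = (\<bar>y - a\<bar> - \<bar>y - b\<bar> + (b - a)) / 2"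

definition slab :: "real \<Rightarrow> real \<Rightarrow> real \<Rightarrow> real" where
  "slab a b y = (sgn (y - a) - sgn (y - b)) / 2"

lemma ramp_bounds: "a < b \<Longrightarrow> 0 \<le> ramp a b y" "a < b \<Longrightarrow> ramp a b y \<le> b - a"
  by (auto simp: ramp_def abs_if)

lemma ramp_cases: "y \<le> a \<Longrightarrow> a < b \<Longrightarrow> ramp a b y = 0" "b \<le> y \<Longrightarrow> a < b \<Longrightarrow> ramp a b y = b - a"
  by (auto simp: ramp_def abs_if)

lemma ramp_scaled_le:
  assumes "a < b" shows "\<bar>ramp a b y / (b - a) * c\<bar> \<le> \<bar>c\<bar>"
proof -
  have "\<bar>ramp a b y / (b - a)\<bar> \<le> 1" using ramp_bounds[of a b y] assms by (simp add: divide_le_eq)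
  then show ?thesis unfolding abs_mult by (rule mult_left_le_one_le[OF abs_ge_zero abs_ge_zero])
qed

text \<open>
  Here \<open>G\<close> stands for \<open>M g\<close>, and \<open>h\<close> for the adjoint applied to the field \<open>G / \<parallel>G\<parallel>\<^sup>2\<close>. One exponent
  \<open>p\<^sub>0\<close> serves for all: the Sobolev spaces decrease as the exponent grows, so an adjoint at
  \<open>p\<^sub>0\<close> can be tested with elements of every \<open>W\<^sup>1\<^sup>,\<^sup>p\<close> with \<open>p \<ge> p\<^sub>0\<close>.
\<close>

locale regular_level = closed_gradient \<nu> R
  for \<nu> :: "'a::{real_inner, banach, second_countable_topology} measure" and R +
  fixes g :: "'a \<Rightarrow> real" and G :: "'a \<Rightarrow> 'a" and h :: "'a \<Rightarrow> real" and p\<^sub>0 :: real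
  assumes p0: "1 < p\<^sub>0"
    and graph_g: "\<And>p. 1 < p \<Longrightarrow> (g, G) \<in> M_graph \<nu> R p"
    and G_nonzero: "AE x in \<nu>. G x \<noteq> 0"
    and adjoint_h: "((\<lambda>x. (1 / (norm (G x))\<^sup>2) *\<^sub>R G x), h) \<in> Mstar_graph \<nu> R p\<^sub>0"
begin

definition Psi :: "'a \<Rightarrow> 'a" where "Psi x = (1 / (norm (G x))\<^sup>2) *\<^sub>R G x"

definition Slab :: "real \<Rightarrow> real \<Rightarrow> 'a set" where "Slab a b = {x. a < g x \<and> g x \<le> b}"

lemma space_nu: "space \<nu> = UNIV"
  using sets_eq_imp_space_eq[OF sets_nu] by simp

lemma g_measurable[measurable]: "g \<in> borel_measurable \<nu>" and G_measurable[measurable]: "G \<in> borel_measurable \<nu>"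
  using graph_measurable[OF graph_g[of 2]] by auto

lemma Slab_sets[measurable]: "Slab a b \<in> sets \<nu>"
proof -
  have "{x \<in> space \<nu>. a < g x \<and> g x \<le> b} \<in> sets \<nu>" by measurable
  then show ?thesis by (simp add: Slab_def space_nu)
qed

lemma sublevel_sets[measurable]: "{x. g x < c} \<in> sets \<nu>" "{x. g x \<le> c} \<in> sets \<nu>"
  "{x. c < g x} \<in> sets \<nu>" "{x. g x = c} \<in> sets \<nu>"
proof -
  have "{x \<in> space \<nu>. g x < c} \<in> sets \<nu>" "{x \<in> space \<nu>. g x \<le> c} \<in> sets \<nu>"
    "{x \<in> space \<nu>. c < g x} \<in> sets \<nu>" "{x \<in> space \<nu>. g x = c} \<in> sets \<nu>" by measurable
  then show "{x. g x < c} \<in> sets \<nu>" "{x. g x \<le> c} \<in> sets \<nu>"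
    "{x. c < g x} \<in> sets \<nu>" "{x. g x = c} \<in> sets \<nu>" by (simp_all add: space_nu)
qed

lemma ramp_slab_measurable[measurable]:
  "(\<lambda>x. ramp a b (g x)) \<in> borel_measurable \<nu>" "(\<lambda>x. slab a b (g x)) \<in> borel_measurable \<nu>"
  by (simp_all add: ramp_def slab_def)

lemma Psi_graph: "(Psi, h) \<in> Mstar_graph \<nu> R p\<^sub>0"
  using adjoint_h by (simp add: Psi_def[abs_def])

lemma Psi_Lp: "Psi \<in> Lp \<nu> (conj_exp p\<^sub>0)" and h_Lp: "h \<in> Lp \<nu> (conj_exp p\<^sub>0)"
  using Psi_graph by (auto simp: Mstar_graph_def)

lemma Psi_measurable[measurable]: "Psi \<in> borel_measurable \<nu>" and h_measurable[measurable]: "h \<in> borel_measurable \<nu>"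
  using Psi_Lp h_Lp by (auto dest: LpD_measurable)

lemma norm_Psi_integrable: "integrable \<nu> (\<lambda>x. norm (Psi x))" and h_integrable: "integrable \<nu> h"
  using Lp_integrable[OF Psi_Lp] Lp_integrable[OF h_Lp] conj_exp_gt1[OF p0] by auto

lemma G_Psi: "AE x in \<nu>. G x \<bullet> Psi x = 1"
  using G_nonzero by eventually_elim (simp add: Psi_def dot_square_norm)

lemma graph_ramp:
  assumes p: "1 < p"
  shows "((\<lambda>x. ramp a b (g x)), (\<lambda>x. slab a b (g x) *\<^sub>R G x)) \<in> M_graph \<nu> R p"
proof -
  have p': "0 < p" "0 \<le> p" using p by auto
  have ab: "((\<lambda>x. \<bar>g x - c\<bar>), (\<lambda>x. sgn (g x - c) *\<^sub>R (G x - 0))) \<in> M_graph \<nu> R p" for c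
    by (intro graph_abs graph_diff graph_g graph_const p p')
  have "((\<lambda>x. (1/2) * (\<bar>g x - a\<bar> - \<bar>g x - b\<bar> + (b - a))), (\<lambda>x. (1/2) *\<^sub>R (sgn (g x - a) *\<^sub>R (G x - 0) - sgn (g x - b) *\<^sub>R (G x - 0) + 0))) \<in> M_graph \<nu> R p"
    by (intro graph_cmult graph_add[OF _ graph_const] graph_diff ab p')
  then show ?thesis by (simp add: ramp_def slab_def scaleR_diff_left[symmetric] diff_divide_distrib)
qed

text \<open>
  For smooth \<open>u\<close> this is the adjoint applied to \<open>u \<Psi>\<close>.
\<close>

definition dens :: "('a \<Rightarrow> real) \<Rightarrow> 'a \<Rightarrow> real" where
  "dens u x = u x * h x - R (grad u x) \<bullet> Psi x"

lemma
  assumes u: "u \<in> C1b"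
  shows integrable_u_h: "integrable \<nu> (\<lambda>x. u x * h x)"
    and integrable_Ru_Psi: "integrable \<nu> (\<lambda>x. R (grad u x) \<bullet> Psi x)"
    and integrable_Ru_Psi_norm: "integrable \<nu> (\<lambda>x. norm (R (grad u x)) * norm (Psi x))"
    and integrable_dens: "integrable \<nu> (dens u)"
proof -
  obtain A A' where A: "\<And>x. \<bar>u x\<bar> \<le> A" "\<And>x. norm (grad u x) \<le> A'" using u by (rule C1b_bounded) auto
  obtain B where B: "\<And>x. norm (R (grad u x)) \<le> B" "0 \<le> B" using u by (rule R_grad_bounded) auto
  note [measurable] = C1b_measurable[OF u] R_grad_measurable[OF u]
  show 1: "integrable \<nu> (\<lambda>x. u x * h x)"
    by (rule integrable_bounded_mult[OF C1b_measurable[OF u] A(1) h_integrable])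
  show 3: "integrable \<nu> (\<lambda>x. norm (R (grad u x)) * norm (Psi x))"
    using B by (intro integrable_bounded_mult[where A=B] norm_Psi_integrable) auto
  show 2: "integrable \<nu> (\<lambda>x. R (grad u x) \<bullet> Psi x)"
    by (rule Bochner_Integration.integrable_bound[OF 3]) (auto simp: Cauchy_Schwarz_ineq2)
  show "integrable \<nu> (dens u)"
    using 1 2 by (simp add: dens_def[abs_def])
qed

lemma C1b_integrable: "u \<in> C1b \<Longrightarrow> integrable \<nu> u"
  using Lp_integrable[OF C1b_Lp[of u 1]] by simp

text \<open>
  The chain rule gives \<open>M (ramp a b \<circ> g) = slab a b g *\<^sub>R G\<close>, and pairing with the field \<open>Psi\<close> removes
  \<open>G\<close> because \<open>\<langle>G, Psi\<rangle> = 1\<close>. The adjoint, applied to \<open>u\<close> times the ramp, does the rest.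
\<close>

lemma slab_identity:
  assumes u: "u \<in> C1b" and ab: "a < b"
  shows "(LINT x|\<nu>. slab a b (g x) * u x) = (LINT x|\<nu>. ramp a b (g x) * dens u x)"
proof -
  note [measurable] = C1b_measurable[OF u] R_grad_measurable[OF u]
  have gr: "((\<lambda>x. u x * ramp a b (g x)), (\<lambda>x. u x *\<^sub>R (slab a b (g x) *\<^sub>R G x) + ramp a b (g x) *\<^sub>R R (grad u x)))
      \<in> M_graph \<nu> R p\<^sub>0"
    using p0 by (intro graph_mult graph_ramp u) auto
  have ib: "integrable \<nu> (\<lambda>x. ramp a b (g x) * v x)" if "integrable \<nu> v" for v
    using ramp_bounds[OF ab] that by (intro integrable_bounded_mult[where A="b - a"]) auto
  have iu: "integrable \<nu> (\<lambda>x. slab a b (g x) * u x)"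
    using C1b_integrable[OF u] by (intro integrable_bounded_mult[where A=1]) (auto simp: slab_def sgn_if)
  have "(LINT x|\<nu>. slab a b (g x) * u x) + (LINT x|\<nu>. ramp a b (g x) * (R (grad u x) \<bullet> Psi x))
    = (LINT x|\<nu>. slab a b (g x) * u x + ramp a b (g x) * (R (grad u x) \<bullet> Psi x))"
    by (rule Bochner_Integration.integral_add[symmetric, OF iu ib[OF integrable_Ru_Psi[OF u]]])
  also have "\<dots> = (LINT x|\<nu>. (u x *\<^sub>R (slab a b (g x) *\<^sub>R G x) + ramp a b (g x) *\<^sub>R R (grad u x)) \<bullet> Psi x)"
    using G_Psi by (intro integral_cong_AE) (auto simp: inner_add_left elim!: eventually_mono)
  also have "\<dots> = (LINT x|\<nu>. (u x * ramp a b (g x)) * h x)"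
    by (rule adjoint_eq[OF Psi_graph gr p0])
  also have "\<dots> = (LINT x|\<nu>. ramp a b (g x) * (u x * h x))"
    by (simp add: mult_ac)
  finally have "(LINT x|\<nu>. slab a b (g x) * u x)
    = (LINT x|\<nu>. ramp a b (g x) * (u x * h x)) - (LINT x|\<nu>. ramp a b (g x) * (R (grad u x) \<bullet> Psi x))"
    by simp
  also have "\<dots> = (LINT x|\<nu>. ramp a b (g x) * (u x * h x) - ramp a b (g x) * (R (grad u x) \<bullet> Psi x))"
    by (rule Bochner_Integration.integral_diff[symmetric, OF ib[OF integrable_u_h[OF u]] ib[OF integrable_Ru_Psi[OF u]]])
  finally show ?thesis by (simp add: dens_def right_diff_distrib)
qed

text \<open>
  By \<open>slab_identity\<close> with \<open>u = 1\<close>, a slab of width \<open>2 e\<close> around the level \<open>c\<close> has mass at most \<open>2 e\<close>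
  times the norm of \<open>h\<close> in \<open>L\<^sup>1\<close>.
\<close>

lemma level_null: "AE x in \<nu>. g x \<noteq> c"
proof -
  have hi: "integrable \<nu> (\<lambda>x. \<bar>h x\<bar>)" using h_integrable by simp
  have "measure \<nu> {x. g x = c} \<le> 0"
  proof (rule field_le_epsilon)
    fix e' :: real assume "0 < e'"
    define H where "H = (LINT x|\<nu>. \<bar>h x\<bar>)"
    define e where "e = e' / (2 * (H + 1))"
    have H0: "0 \<le> H" by (simp add: H_def)
    then have e: "0 < e" using \<open>0 < e'\<close> by (simp add: e_def)
    have "measure \<nu> {x. g x = c} = (LINT x|\<nu>. indicator {x. g x = c} x)"
      by (simp add: space_nu)
    also have "\<dots> \<le> (LINT x|\<nu>. slab (c - e) (c + e) (g x) * 1)"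
    proof (rule integral_mono)
      show "integrable \<nu> (\<lambda>x. slab (c - e) (c + e) (g x) * 1)"
        by (rule integrable_const_bound[of _ 1]) (auto simp: slab_def sgn_if)
      show "indicator {x. g x = c} x \<le> slab (c - e) (c + e) (g x) * 1" for x
        using e by (auto simp: slab_def sgn_if indicator_def)
    qed (auto simp: emeasure_eq_measure)
    also have "\<dots> = (LINT x|\<nu>. ramp (c - e) (c + e) (g x) * h x)"
      using slab_identity[OF C1b_const[of 1], of "c - e" "c + e"] e by (simp add: dens_def grad_const R_zero)
    also have "\<dots> \<le> (LINT x|\<nu>. 2 * e * \<bar>h x\<bar>)"
    proof (rule integral_mono)
      have r: "\<bar>ramp (c - e) (c + e) y\<bar> \<le> 2 * e" for y
        using ramp_bounds[of "c - e" "c + e" y] e by simp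
      show "integrable \<nu> (\<lambda>x. ramp (c - e) (c + e) (g x) * h x)"
        using r by (intro integrable_bounded_mult[where A="2 * e"] h_integrable) auto
      have "\<bar>ramp (c - e) (c + e) (g x) * h x\<bar> \<le> 2 * e * \<bar>h x\<bar>" for x
        unfolding abs_mult by (intro mult_right_mono r) simp
      then show "ramp (c - e) (c + e) (g x) * h x \<le> 2 * e * \<bar>h x\<bar>" for x
        by (rule order_trans[OF abs_ge_self])
    qed (use hi in auto)
    also have "\<dots> = 2 * e * H" by (simp add: H_def)
    also have "\<dots> \<le> e'" using \<open>0 < e'\<close> H0 unfolding e_def by (simp add: field_simps)
    finally show "measure \<nu> {x. g x = c} \<le> 0 + e'" by simp
  qed
  then have "measure \<nu> {x. g x = c} = 0" by (simp add: measure_le_0_iff)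
  then have "{x. g x = c} \<in> null_sets \<nu>" by (simp add: null_sets_def emeasure_eq_measure)
  then show ?thesis by (rule AE_I') auto
qed

lemma slab_indicator: "a < b \<Longrightarrow> AE x in \<nu>. slab a b (g x) = indicator (Slab a b) x"
  using level_null[of a] level_null[of b] by eventually_elim (auto simp: slab_def sgn_if Slab_def)

definition slab_mean :: "real \<Rightarrow> real \<Rightarrow> ('a \<Rightarrow> real) \<Rightarrow> real" where
  "slab_mean a b u = (LINT x|\<nu>. indicator (Slab a b) x * u x) / (b - a)"

lemma integrable_Slab: "integrable \<nu> u \<Longrightarrow> integrable \<nu> (\<lambda>x. indicator (Slab a b) x * u x)" for u :: "'a \<Rightarrow> real"
  using integrable_mult_indicator[of "Slab a b" \<nu> u] by simp

lemma slab_mean_add: "integrable \<nu> u \<Longrightarrow> integrable \<nu> v \<Longrightarrow>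
    slab_mean a b (\<lambda>x. u x + v x) = slab_mean a b u + slab_mean a b v"
  by (simp add: slab_mean_def distrib_left integrable_Slab add_divide_distrib)

lemma slab_mean_diff: "integrable \<nu> u \<Longrightarrow> integrable \<nu> v \<Longrightarrow>
    slab_mean a b (\<lambda>x. u x - v x) = slab_mean a b u - slab_mean a b v"
  by (simp add: slab_mean_def right_diff_distrib integrable_Slab diff_divide_distrib)

lemma slab_mean_cmult: "slab_mean a b (\<lambda>x. c * u x) = c * slab_mean a b u"
proof -
  have "(\<lambda>x. indicator (Slab a b) x * (c * u x)) = (\<lambda>x. c * (indicator (Slab a b) x * u x))" by auto
  then show ?thesis by (simp add: slab_mean_def)
qed

lemma slab_mean_mono:
  assumes "integrable \<nu> u" "integrable \<nu> v" "\<And>x. u x \<le> v x" "a < b"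
  shows "slab_mean a b u \<le> slab_mean a b v"
  unfolding slab_mean_def using assms
  by (intro divide_right_mono integral_mono integrable_Slab mult_left_mono) auto

lemma slab_mean_abs_le:
  assumes "integrable \<nu> u" "a < b"
  shows "\<bar>slab_mean a b u\<bar> \<le> slab_mean a b (\<lambda>x. \<bar>u x\<bar>)"
  using slab_mean_mono[of u "\<lambda>x. \<bar>u x\<bar>" a b] slab_mean_mono[of "\<lambda>x. (-1) * \<bar>u x\<bar>" u a b] assms
  by (simp only: slab_mean_cmult) (auto simp: abs_le_iff minus_le_iff)

lemma slab_mean_C1b:
  assumes u: "u \<in> C1b" and ab: "a < b"
  shows "slab_mean a b u = (LINT x|\<nu>. (ramp a b (g x) / (b - a)) * dens u x)"
proof -
  note [measurable] = C1b_measurable[OF u] R_grad_measurable[OF u]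
  have "(LINT x|\<nu>. indicator (Slab a b) x * u x) = (LINT x|\<nu>. slab a b (g x) * u x)"
    using slab_indicator[OF ab] by (intro integral_cong_AE) (auto elim!: eventually_mono)
  also have "\<dots> = (LINT x|\<nu>. ramp a b (g x) * dens u x)" by (rule slab_identity[OF u ab])
  finally show ?thesis by (simp add: slab_mean_def)
qed

text \<open>
  The ramps divided by their heights stay between \<open>0\<close> and \<open>1\<close> and converge to the indicator of
  \<open>{g > r}\<close> off the level set, which is null.
\<close>

lemma slab_mean_C1b_tendsto:
  assumes u: "u \<in> C1b" and ab: "\<And>n. a n < b n" and lim: "a \<longlonglongrightarrow> r" "b \<longlonglongrightarrow> r"
  shows "(\<lambda>n. slab_mean (a n) (b n) u) \<longlonglongrightarrow> (LINT x|\<nu>. indicator {x. r < g x} x * dens u x)"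
  unfolding slab_mean_C1b[OF u ab]
proof (rule integral_dominated_convergence)
  have d[measurable]: "dens u \<in> borel_measurable \<nu>" using integrable_dens[OF u] by auto
  show "(\<lambda>x. indicator {x. r < g x} x * dens u x) \<in> borel_measurable \<nu>"
    "(\<lambda>x. ramp (a n) (b n) (g x) / (b n - a n) * dens u x) \<in> borel_measurable \<nu>" for n
    by measurable
  show "integrable \<nu> (\<lambda>x. \<bar>dens u x\<bar>)" using integrable_dens[OF u] by simp
  show "AE x in \<nu>. norm (ramp (a n) (b n) (g x) / (b n - a n) * dens u x) \<le> \<bar>dens u x\<bar>" for n
    using ramp_scaled_le[OF ab[of n]] by simp
  show "AE x in \<nu>. (\<lambda>n. ramp (a n) (b n) (g x) / (b n - a n) * dens u x) \<longlonglongrightarrow> indicator {x. r < g x} x * dens u x"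
    using level_null[of r]
  proof eventually_elim
    case (elim x)
    have "eventually (\<lambda>n. ramp (a n) (b n) (g x) / (b n - a n) = indicator {x. r < g x} x) sequentially"
    proof (cases "r < g x")
      case True
      with lim(2) have "eventually (\<lambda>n. b n < g x) sequentially" by (rule order_tendstoD)
      then show ?thesis
      proof eventually_elim
        case (elim n)
        then show ?case using ramp_cases(2)[of "b n" "g x" "a n"] ab[of n] True by simp
      qed
    next
      case False
      with elim have "g x < r" by simp
      with lim(1) have "eventually (\<lambda>n. g x < a n) sequentially" by (rule order_tendstoD)
      then show ?thesis
      proof eventually_elim
        case (elim n)
        then show ?case using ramp_cases(1)[of "g x" "a n" "b n"] ab[of n] False by simp
      qed
    qed
    then show ?case by (intro tendsto_mult_right tendsto_eventually)
  qed
qed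

text \<open>
  The estimate behind everything that follows: the ramp divided by its height is at
  most \<open>1\<close>, so that \<open>slab_mean_C1b\<close> controls slab averages uniformly in the slab.
\<close>

lemma slab_mean_bound_nonneg:
  assumes u: "u \<in> C1b" and nn: "\<And>x. 0 \<le> u x" and ab: "a < b"
  shows "slab_mean a b u \<le> (LINT x|\<nu>. u x * \<bar>h x\<bar> + norm (R (grad u x)) * norm (Psi x))"
proof -
  have int: "integrable \<nu> (\<lambda>x. u x * \<bar>h x\<bar> + norm (R (grad u x)) * norm (Psi x))"
    using integrable_abs[OF integrable_u_h[OF u]] integrable_Ru_Psi_norm[OF u] nn by (simp add: abs_mult)
  have d[measurable]: "dens u \<in> borel_measurable \<nu>" using integrable_dens[OF u] by auto
  have *: "\<bar>ramp a b (g x) / (b - a) * dens u x\<bar> \<le> u x * \<bar>h x\<bar> + norm (R (grad u x)) * norm (Psi x)" for x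
  proof -
    have "\<bar>ramp a b (g x) / (b - a) * dens u x\<bar> \<le> \<bar>dens u x\<bar>"
      by (rule ramp_scaled_le[OF ab])
    also have "\<dots> \<le> u x * \<bar>h x\<bar> + norm (R (grad u x)) * norm (Psi x)"
      unfolding dens_def using nn[of x]
      by (intro order_trans[OF abs_triangle_ineq4] add_mono) (auto simp: abs_mult Cauchy_Schwarz_ineq2)
    finally show ?thesis .
  qed
  show ?thesis unfolding slab_mean_C1b[OF u ab]
  proof (rule integral_mono[OF _ int])
    show "integrable \<nu> (\<lambda>x. ramp a b (g x) / (b - a) * dens u x)"
      by (rule Bochner_Integration.integrable_bound[OF int])
        (use * in \<open>auto intro!: AE_I2 order_trans[OF * abs_ge_self] simp del: times_divide_eq_left\<close>)
  qed (use * in \<open>auto intro: order_trans[OF abs_ge_self]\<close>)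
qed

text \<open>
  A seminorm which Hoelder's inequality bounds by the graph norm with exponent \<open>p\<^sub>0\<close>.
\<close>

definition graph_size :: "('a \<Rightarrow> real) \<Rightarrow> ('a \<Rightarrow> 'a) \<Rightarrow> real" where
  "graph_size u U = (LINT x|\<nu>. \<bar>u x\<bar> * \<bar>h x\<bar>) + (LINT x|\<nu>. norm (U x) * norm (Psi x))"

text \<open>
  The modulus of \<open>u\<close> is replaced by the smooth function \<open>sqrt (d\<^sup>2 + u\<^sup>2)\<close>, whose gradient is no larger
  than that of \<open>u\<close> and which exceeds \<open>\<bar>u\<bar>\<close> by at most \<open>d\<close>.
\<close>

lemma slab_mean_bound_C1b:
  assumes u: "u \<in> C1b" and ab: "a < b"
  shows "slab_mean a b (\<lambda>x. \<bar>u x\<bar>) \<le> graph_size u (\<lambda>x. R (grad u x))"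
proof (rule field_le_epsilon)
  fix e :: real assume e: "0 < e"
  define H where "H = (LINT x|\<nu>. \<bar>h x\<bar>)"
  have H: "0 \<le> H" by (simp add: H_def)
  define d where "d = e / (H + 1)"
  have d: "0 < d" using e H by (simp add: d_def)
  define v where "v x = sqrt (d\<^sup>2 + (u x)\<^sup>2 + 0\<^sup>2)" for x
  have d2: "0 < d\<^sup>2" using d by simp
  have v: "v \<in> C1b" and gv: "grad v = (\<lambda>x. (u x / sqrt (d\<^sup>2 + (u x)\<^sup>2 + 0\<^sup>2)) *\<^sub>R grad u x + (0 / sqrt (d\<^sup>2 + (u x)\<^sup>2 + 0\<^sup>2)) *\<^sub>R grad (\<lambda>_. 0) x)"
    using C1b_chain[OF C1_Lip2_sqrt[OF d2] u C1b_const[of 0]] grad_chain[OF C1_Lip2_sqrt[OF d2] u C1b_const[of 0]]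
    by (simp_all add: v_def[abs_def])
  have uv: "\<bar>u x\<bar> \<le> v x" for x by (auto simp: v_def intro!: real_le_rsqrt)
  have vu: "v x \<le> \<bar>u x\<bar> + d" for x
    unfolding v_def using d by (intro real_le_lsqrt) (auto simp: power2_sum)
  have vpos: "0 < v x" for x unfolding v_def using d2 by (simp add: add_pos_nonneg)
  have gle: "norm (R (grad v x)) \<le> norm (R (grad u x))" for x
  proof -
    have "R (grad v x) = (u x / v x) *\<^sub>R R (grad u x)" by (simp add: gv R_scaleR v_def)
    moreover have "\<bar>u x / v x\<bar> \<le> 1" using uv[of x] vpos[of x] by (simp add: divide_le_eq)
    ultimately show ?thesis using mult_right_mono[of "\<bar>u x / v x\<bar>" 1 "norm (R (grad u x))"] by simp
  qed
  have iu: "integrable \<nu> (\<lambda>x. \<bar>u x\<bar> * \<bar>h x\<bar>)" "integrable \<nu> (\<lambda>x. norm (R (grad u x)) * norm (Psi x))"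
    using integrable_abs[OF integrable_u_h[OF u]] integrable_Ru_Psi_norm[OF u] by (simp_all add: abs_mult)
  have iv: "integrable \<nu> (\<lambda>x. v x * \<bar>h x\<bar> + norm (R (grad v x)) * norm (Psi x))"
    using integrable_abs[OF integrable_u_h[OF v]] integrable_Ru_Psi_norm[OF v]
    by (simp add: abs_mult abs_of_pos[OF vpos])
  have "slab_mean a b (\<lambda>x. \<bar>u x\<bar>) \<le> slab_mean a b v"
    using uv C1b_integrable[OF u] C1b_integrable[OF v] ab by (intro slab_mean_mono) auto
  also have "\<dots> \<le> (LINT x|\<nu>. v x * \<bar>h x\<bar> + norm (R (grad v x)) * norm (Psi x))"
    using vpos by (intro slab_mean_bound_nonneg v ab) (auto intro: less_imp_le)
  also have "\<dots> \<le> (LINT x|\<nu>. (\<bar>u x\<bar> * \<bar>h x\<bar> + d * \<bar>h x\<bar>) + norm (R (grad u x)) * norm (Psi x))"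
  proof (rule integral_mono[OF iv])
    show "integrable \<nu> (\<lambda>x. (\<bar>u x\<bar> * \<bar>h x\<bar> + d * \<bar>h x\<bar>) + norm (R (grad u x)) * norm (Psi x))"
      using iu h_integrable by simp
    show "v x * \<bar>h x\<bar> + norm (R (grad v x)) * norm (Psi x) \<le> (\<bar>u x\<bar> * \<bar>h x\<bar> + d * \<bar>h x\<bar>) + norm (R (grad u x)) * norm (Psi x)" for x
      using mult_right_mono[OF vu[of x], of "\<bar>h x\<bar>"] mult_right_mono[OF gle[of x], of "norm (Psi x)"]
      by (simp add: distrib_right)
  qed
  also have "\<dots> = graph_size u (\<lambda>x. R (grad u x)) + d * H"
    using iu h_integrable by (simp add: graph_size_def H_def)
  also have "d * H \<le> e" using e H by (simp add: d_def field_simps)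
  finally show "slab_mean a b (\<lambda>x. \<bar>u x\<bar>) \<le> graph_size u (\<lambda>x. R (grad u x)) + e" by simp
qed

lemma graph_size_integrable:
  assumes "u \<in> Lp \<nu> p\<^sub>0" "U \<in> Lp \<nu> p\<^sub>0"
  shows "integrable \<nu> (\<lambda>x. \<bar>u x\<bar> * \<bar>h x\<bar>)" "integrable \<nu> (\<lambda>x. norm (U x) * norm (Psi x))"
  using integrable_mult_Lp[OF assms(1) h_Lp p0] integrable_mult_Lp[OF assms(2) Psi_Lp p0] by simp_all

lemma graph_size_tendsto_0:
  assumes "Lp_tendsto \<nu> p\<^sub>0 f u" "Lp_tendsto \<nu> p\<^sub>0 F U"
  shows "(\<lambda>n. graph_size (\<lambda>x. f n x - u x) (\<lambda>x. F n x - U x)) \<longlonglongrightarrow> 0"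
  using tendsto_add[OF Lp_tendsto_pairing[OF assms(1) h_Lp p0] Lp_tendsto_pairing[OF assms(2) Psi_Lp p0]]
  by (simp add: graph_size_def)

lemma graph_size_triangle:
  assumes u: "u \<in> Lp \<nu> p\<^sub>0" "U \<in> Lp \<nu> p\<^sub>0" and v: "v \<in> Lp \<nu> p\<^sub>0" "V \<in> Lp \<nu> p\<^sub>0"
  shows "graph_size (\<lambda>x. u x + v x) (\<lambda>x. U x + V x) \<le> graph_size u U + graph_size v V"
proof -
  have p0': "0 \<le> p\<^sub>0" using p0 by simp
  note iu = graph_size_integrable[OF u] and iv = graph_size_integrable[OF v]
    and iuv = graph_size_integrable[OF Lp_add[OF u(1) v(1) p0'] Lp_add[OF u(2) v(2) p0']]
  have "(LINT x|\<nu>. \<bar>u x + v x\<bar> * \<bar>h x\<bar>) \<le> (LINT x|\<nu>. \<bar>u x\<bar> * \<bar>h x\<bar> + \<bar>v x\<bar> * \<bar>h x\<bar>)"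
  proof (rule integral_mono[OF iuv(1)])
    show "\<bar>u x + v x\<bar> * \<bar>h x\<bar> \<le> \<bar>u x\<bar> * \<bar>h x\<bar> + \<bar>v x\<bar> * \<bar>h x\<bar>" for x
      unfolding distrib_right[symmetric] by (intro mult_right_mono) auto
  qed (use iu iv in auto)
  moreover have "(LINT x|\<nu>. norm (U x + V x) * norm (Psi x)) \<le> (LINT x|\<nu>. norm (U x) * norm (Psi x) + norm (V x) * norm (Psi x))"
  proof (rule integral_mono[OF iuv(2)])
    show "norm (U x + V x) * norm (Psi x) \<le> norm (U x) * norm (Psi x) + norm (V x) * norm (Psi x)" for x
      unfolding distrib_right[symmetric] by (intro mult_right_mono norm_triangle_ineq) auto
  qed (use iu iv in auto)
  ultimately show ?thesis using iu iv by (simp add: graph_size_def)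
qed

text \<open>
  For a fixed slab both sides are continuous along smooth approximations of \<open>u\<close> in the graph norm, the
  left one because slab averages are bounded by the norm of \<open>L\<^sup>1\<close> up to the factor \<open>1 / (b - a)\<close>.
\<close>

lemma slab_mean_bound:
  assumes u: "(u, U) \<in> M_graph \<nu> R p" and p: "p\<^sub>0 \<le> p" and ab: "a < b"
  shows "slab_mean a b (\<lambda>x. \<bar>u x\<bar>) \<le> graph_size u U"
proof -
  have p0': "0 < p\<^sub>0" "0 \<le> p\<^sub>0" "1 \<le> p\<^sub>0" using p0 by auto
  have g0: "(u, U) \<in> M_graph \<nu> R p\<^sub>0" by (rule graph_mono[OF u _ p]) (use p0 in simp)
  note uL = graph_Lp[OF g0]
  obtain f where f: "\<And>n. f n \<in> C1b" "Lp_tendsto \<nu> p\<^sub>0 f u" "Lp_tendsto \<nu> p\<^sub>0 (\<lambda>n x. R (grad (f n) x)) U"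
    using g0 by (auto simp: M_graph_def)
  let ?F = "\<lambda>n x. R (grad (f n) x)"
  have fL: "f n \<in> Lp \<nu> p\<^sub>0" "?F n \<in> Lp \<nu> p\<^sub>0" for n using C1b_Lp R_grad_Lp f(1) p0' by auto
  let ?e = "\<lambda>n. graph_size (\<lambda>x. f n x - u x) (\<lambda>x. ?F n x - U x)"
  let ?d = "\<lambda>n. (LINT x|\<nu>. norm (f n x - u x) * norm (1::real)) / (b - a)"
  have 1: "graph_size (f n) (?F n) \<le> graph_size u U + ?e n" for n
    using graph_size_triangle[OF uL Lp_diff[OF fL(1) uL(1) p0'(2)] Lp_diff[OF fL(2) uL(2) p0'(2)], of n] by simp
  have iu: "integrable \<nu> u" "integrable \<nu> (f n)" for n
    using Lp_integrable[OF uL(1) p0'(3)] C1b_integrable[OF f(1)] by auto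
  have 2: "slab_mean a b (\<lambda>x. \<bar>u x\<bar>) \<le> slab_mean a b (\<lambda>x. \<bar>f n x\<bar>) + ?d n" for n
  proof -
    have "slab_mean a b (\<lambda>x. \<bar>u x\<bar>) \<le> slab_mean a b (\<lambda>x. \<bar>f n x\<bar> + \<bar>f n x - u x\<bar>)"
      using iu ab by (intro slab_mean_mono) auto
    also have "\<dots> = slab_mean a b (\<lambda>x. \<bar>f n x\<bar>) + slab_mean a b (\<lambda>x. \<bar>f n x - u x\<bar>)"
      using iu by (intro slab_mean_add) auto
    also have "slab_mean a b (\<lambda>x. \<bar>f n x - u x\<bar>) \<le> ?d n"
      unfolding slab_mean_def using iu(1) iu(2)[of n] ab
      by (intro divide_right_mono integral_mono integrable_Slab) (auto simp: indicator_def)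
    finally show ?thesis by simp
  qed
  have "(\<lambda>_::'a. 1::real) \<in> Lp \<nu> (conj_exp p\<^sub>0)" by (simp add: Lp_def)
  from Lp_tendsto_pairing[OF f(2) this p0] have "(\<lambda>n. (LINT x|\<nu>. norm (f n x - u x) * norm (1::real))) \<longlonglongrightarrow> 0" .
  then have "?d \<longlonglongrightarrow> 0 / (b - a)" by (intro tendsto_divide tendsto_const) (use ab in auto)
  then have "(\<lambda>n. graph_size u U + ?e n + ?d n) \<longlonglongrightarrow> graph_size u U + 0 + 0 / (b - a)"
    by (intro tendsto_add tendsto_const graph_size_tendsto_0 f) 
  moreover have "slab_mean a b (\<lambda>x. \<bar>u x\<bar>) \<le> graph_size u U + ?e n + ?d n" for n
    using 1[of n] 2[of n] slab_mean_bound_C1b[OF f(1)[of n] ab] by linarith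
  ultimately show ?thesis using LIMSEQ_le_const by fastforce
qed

end

section \<open>Test functions and approximation on compact sets\<close>

lemma DERIV_max_square: "((\<lambda>y::real. (max 0 y)\<^sup>2) has_real_derivative 2 * max 0 y) (at y)"
proof -
  consider "0 < y" | "y < 0" | "y = 0" by linarith
  then show ?thesis
  proof cases
    case 1
    have "((\<lambda>y. y\<^sup>2) has_real_derivative 2 * max 0 y) (at y)"
      using 1 by (auto intro!: derivative_eq_intros)
    then show ?thesis
      by (rule has_field_derivative_transform_within_open[of _ _ _ "{0<..}"]) (use 1 in auto)
  next
    case 2
    have "((\<lambda>y. 0) has_real_derivative 2 * max 0 y) (at y)"
      using 2 by (auto intro!: derivative_eq_intros)
    then show ?thesis
      by (rule has_field_derivative_transform_within_open[of _ _ _ "{..<0}"]) (use 2 in auto)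
  next
    case 3
    have "((\<lambda>z::real. ((max 0 z)\<^sup>2 - (max 0 0)\<^sup>2) / (z - 0)) \<longlongrightarrow> 0) (at 0)"
    proof (rule Lim_null_comparison)
      have "norm (((max 0 z)\<^sup>2 - (max 0 0)\<^sup>2) / (z - 0)) \<le> \<bar>z\<bar>" for z :: real
        by (cases "0 < z") (auto simp: power2_eq_square)
      then show "eventually (\<lambda>z::real. norm (((max 0 z)\<^sup>2 - (max 0 0)\<^sup>2) / (z - 0)) \<le> \<bar>z\<bar>) (at 0)"
        by simp
      show "((\<lambda>z::real. \<bar>z\<bar>) \<longlongrightarrow> 0) (at 0)" by (rule tendsto_rabs_zero) (rule tendsto_ident_at)
    qed
    then show ?thesis using 3 by (simp add: has_field_derivative_iff)
  qed
qed

text \<open>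
  A function that vanishes exactly on the closed ball of radius \<open>\<epsilon>\<close> around \<open>c\<close>. The square makes the
  positive part continuously differentiable and lets the gradient vanish together with the function. The
  Lipschitz constant does not depend on \<open>\<epsilon>\<close>.
\<close>

definition dip :: "real \<Rightarrow> 'a::real_inner \<Rightarrow> 'a \<Rightarrow> real" where
  "dip \<epsilon> c x = (max 0 (1 / (1 + \<epsilon>\<^sup>2) - 1 / (1 + (norm (x - c))\<^sup>2)))\<^sup>2"

lemma
  shows C1b_dip: "dip \<epsilon> c \<in> C1b" and dip_grad_le: "norm (grad (dip \<epsilon> c) x) \<le> 4"
    and dip_grad_zero: "dip \<epsilon> c x = 0 \<Longrightarrow> grad (dip \<epsilon> c) x = 0"
proof -
  define z where "z x = 1 / (1 + \<epsilon>\<^sup>2) - 1 / (1 + (norm (x - c))\<^sup>2)" for x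
  define D where "D x = (2 * max 0 (z x)) *\<^sub>R ((2 / (1 + (norm (x - c))\<^sup>2)\<^sup>2) *\<^sub>R (x - c))" for x
  have pos: "1 \<le> 1 + (norm (x - c))\<^sup>2" "0 < 1 + (norm (x - c))\<^sup>2" for x :: 'a
    by (auto simp: add_pos_nonneg)
  have z1: "\<bar>max 0 (z x)\<bar> \<le> 1" for x
  proof -
    have "1 / (1 + \<epsilon>\<^sup>2) \<le> 1" "0 \<le> 1 / (1 + (norm (x - c))\<^sup>2)" by (auto simp: divide_le_eq add_pos_nonneg)
    moreover have "\<bar>max 0 (A - B)\<bar> \<le> 1" if "A \<le> 1" "0 \<le> B" for A B :: real using that by auto
    ultimately show ?thesis unfolding z_def by blast
  qed
  have "GDERIV z x :> (2 / (1 + (norm (x - c))\<^sup>2)\<^sup>2) *\<^sub>R (x - c)" for x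
  proof -
    have 1: "GDERIV (\<lambda>x. 1 + (x - c) \<bullet> (x - c)) x :> 2 *\<^sub>R (x - c)"
      unfolding gderiv_def by (auto intro!: derivative_eq_intros simp: inner_commute)
    have 2: "((\<lambda>y. 1 / (1 + \<epsilon>\<^sup>2) - 1 / y) has_real_derivative 1 / y\<^sup>2) (at y)" if "y \<noteq> 0" for y
      using that by (auto intro!: derivative_eq_intros simp: power2_eq_square add_nonneg_eq_0_iff)
    have "1 + (x - c) \<bullet> (x - c) \<noteq> 0" using pos(2)[of x] by (simp add: dot_square_norm)
    from GDERIV_DERIV_compose[OF 1 2[OF this]] show ?thesis
      by (simp add: z_def[abs_def] dot_square_norm)
  qed
  from GDERIV_DERIV_compose[OF this DERIV_max_square]
  have 1: "GDERIV (dip \<epsilon> c) x :> D x" for x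
    by (simp add: dip_def[abs_def] z_def[abs_def] D_def[abs_def])
  have 2: "continuous_on UNIV D"
    unfolding D_def[abs_def] z_def using pos by (intro continuous_intros) (auto simp: less_imp_neq[symmetric])
  have 3: "\<bar>dip \<epsilon> c x\<bar> \<le> 1" for x
    using power_mono[OF z1[of x], of 2] by (simp add: dip_def z_def)
  have 4: "norm (D x) \<le> 4" for x
  proof -
    define t where "t = norm (x - c)"
    have t: "0 \<le> t" "t \<le> (1 + t\<^sup>2)\<^sup>2"
    proof -
      have "t \<le> 1 + t\<^sup>2" using sum_squares_bound[of t 1] by (simp add: power2_eq_square) (smt (verit) zero_le_square)
      also have "\<dots> \<le> (1 + t\<^sup>2)\<^sup>2" using power_increasing[of 1 2 "1 + t\<^sup>2"] by simp
      finally show "t \<le> (1 + t\<^sup>2)\<^sup>2" .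
    qed (simp add: t_def)
    have "norm (D x) = (2 * max 0 (z x)) * (2 * (t / (1 + t\<^sup>2)\<^sup>2))"
      by (simp add: D_def t_def)
    also have "\<dots> \<le> (2 * 1) * (2 * 1)"
      using t z1[of x] by (intro mult_mono) (auto simp: divide_le_eq)
    finally show ?thesis by simp
  qed
  show "dip \<epsilon> c \<in> C1b" and g: "norm (grad (dip \<epsilon> c) x) \<le> 4"
    using C1bI[OF 1 2 3 4] 4 by simp_all
  show "grad (dip \<epsilon> c) x = 0" if "dip \<epsilon> c x = 0"
  proof -
    have "max 0 (z x) = 0" using that by (simp add: dip_def z_def)
    then show ?thesis unfolding C1bI(2)[OF 1 2 3 4] by (simp add: D_def)
  qed
qed

lemma dip_nonneg: "0 \<le> dip \<epsilon> c x"
  by (simp add: dip_def)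

lemma dip_zero:
  assumes "norm (x - c) \<le> \<epsilon>" shows "dip \<epsilon> c x = 0"
proof -
  have "1 / (1 + \<epsilon>\<^sup>2) \<le> 1 / (1 + (norm (x - c))\<^sup>2)"
    using power_mono[OF assms norm_ge_zero, of 2] by (intro divide_left_mono) (auto simp: add_pos_nonneg)
  then show ?thesis by (simp add: dip_def)
qed

lemma dip_lower:
  assumes "0 < \<epsilon>" "2 * \<epsilon> \<le> norm (x - c)"
  shows "(1 / (1 + \<epsilon>\<^sup>2) - 1 / (1 + (2 * \<epsilon>)\<^sup>2))\<^sup>2 \<le> dip \<epsilon> c x"
proof -
  have "1 / (1 + (2 * \<epsilon>)\<^sup>2) \<le> 1 / (1 + \<epsilon>\<^sup>2)"
    using power_mono[of \<epsilon> "2 * \<epsilon>" 2] assms by (intro divide_left_mono) (auto simp: add_pos_nonneg)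
  moreover have "1 / (1 + (norm (x - c))\<^sup>2) \<le> 1 / (1 + (2 * \<epsilon>)\<^sup>2)"
    using power_mono[OF assms(2), of 2] assms by (intro divide_left_mono) (auto simp: add_pos_nonneg)
  ultimately show ?thesis unfolding dip_def by (intro power_mono) auto
qed

text \<open>
  The quotient \<open>a / \<bar>b\<bar>\<close>, regularised at \<open>b = 0\<close> by \<open>d\<close> and with a numerator truncated at the order of
  \<open>k\<close>; without the truncation the partial derivative in \<open>b\<close> would be unbounded.
\<close>

lemma C1_Lip2_arctan:
  assumes d: "0 < d" and k: "0 < k"
  shows "C1_Lip2 (\<lambda>a b. k * arctan (a / k) / sqrt (d + b\<^sup>2))
    (\<lambda>a b. 1 / (1 + (a / k)\<^sup>2) / sqrt (d + b\<^sup>2))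
    (\<lambda>a b. - (k * arctan (a / k) * b / ((d + b\<^sup>2) * sqrt (d + b\<^sup>2))))"
proof -
  have pos: "0 < d + b\<^sup>2" for b :: real using d by (simp add: add_pos_nonneg)
  have pos': "0 < 1 + (a / k)\<^sup>2" for a :: real by (simp add: add_pos_nonneg)
  have der: "((\<lambda>z. k * arctan (fst z / k) / sqrt (d + (snd z)\<^sup>2)) has_derivative
     (\<lambda>z. fst z * (1 / (1 + (a / k)\<^sup>2) / sqrt (d + b\<^sup>2)) +
          snd z * (- (k * arctan (a / k) * b / ((d + b\<^sup>2) * sqrt (d + b\<^sup>2)))))) (at (a, b))" for a b
  proof -
    have 1: "((\<lambda>z. k * arctan (fst z / k)) has_derivative (\<lambda>z. fst z * (1 / (1 + (a / k)\<^sup>2)))) (at (a, b))"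
    proof -
      have "((\<lambda>a. k * arctan (a / k)) has_field_derivative 1 / (1 + (a / k)\<^sup>2)) (at (fst (a, b)))"
        using k by (auto intro!: derivative_eq_intros simp: inverse_eq_divide)
      from DERIV_compose_FDERIV[OF this has_derivative_fst[OF has_derivative_ident]]
      show ?thesis by simp
    qed
    have 2: "((\<lambda>z. inverse (sqrt (d + (snd z)\<^sup>2))) has_derivative
       (\<lambda>z. snd z * (- (b / ((d + b\<^sup>2) * sqrt (d + b\<^sup>2)))))) (at (a, b))"
    proof -
      have s: "sqrt (d + b\<^sup>2) * sqrt (d + b\<^sup>2) = d + b\<^sup>2" using pos[of b] by simp
      have "((\<lambda>z. inverse (sqrt (d + (snd z)\<^sup>2))) has_derivative
       (\<lambda>z. - (inverse (sqrt (d + b\<^sup>2)) * (snd z * b / sqrt (d + b\<^sup>2)) * inverse (sqrt (d + b\<^sup>2))))) (at (a, b))"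
        using pos[of b] by (auto intro!: derivative_eq_intros simp: fun_eq_iff field_simps)
      moreover have "- (inverse (sqrt (d + b\<^sup>2)) * (c * b / sqrt (d + b\<^sup>2)) * inverse (sqrt (d + b\<^sup>2)))
        = c * (- (b / ((d + b\<^sup>2) * sqrt (d + b\<^sup>2))))" for c
      proof -
        have "inverse (sqrt (d + b\<^sup>2)) * inverse (sqrt (d + b\<^sup>2)) = inverse (d + b\<^sup>2)"
          using s by (metis inverse_mult_distrib)
        then have "- (inverse (sqrt (d + b\<^sup>2)) * (c * b / sqrt (d + b\<^sup>2)) * inverse (sqrt (d + b\<^sup>2)))
          = - (inverse (d + b\<^sup>2) * (c * b / sqrt (d + b\<^sup>2)))" by (simp add: mult_ac)
        then show ?thesis by (simp add: divide_simps)
      qed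
      ultimately show ?thesis by simp
    qed
    show ?thesis
      using has_derivative_mult[OF 1 2] by (simp add: divide_inverse mult_ac add.commute)
  qed
  have bnd: "\<bar>1 / (1 + (a / k)\<^sup>2) / sqrt (d + b\<^sup>2)\<bar> \<le> 1 / sqrt d + 2 * k / d \<and>
    \<bar>- (k * arctan (a / k) * b / ((d + b\<^sup>2) * sqrt (d + b\<^sup>2)))\<bar> \<le> 1 / sqrt d + 2 * k / d" for a b
  proof
    have "1 / (1 + (a / k)\<^sup>2) \<le> 1" by (simp add: divide_le_eq add_pos_nonneg)
    moreover have "1 / sqrt (d + b\<^sup>2) \<le> 1 / sqrt d" using d pos[of b] by (intro divide_left_mono) auto
    ultimately have "1 / (1 + (a / k)\<^sup>2) * (1 / sqrt (d + b\<^sup>2)) \<le> 1 * (1 / sqrt d)"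
      using d pos[of b] by (intro mult_mono) auto
    moreover have "0 \<le> 2 * k / d" using d k by simp
    moreover have "0 \<le> 1 / (1 + (a / k)\<^sup>2) / sqrt (d + b\<^sup>2)" using pos[of b] by simp
    ultimately show "\<bar>1 / (1 + (a / k)\<^sup>2) / sqrt (d + b\<^sup>2)\<bar> \<le> 1 / sqrt d + 2 * k / d" by simp
    have at: "\<bar>arctan (a / k)\<bar> \<le> 2"
      using arctan_lbound[of "a / k"] arctan_ubound[of "a / k"] pi_less_4 by linarith
    have b1: "\<bar>b\<bar> / sqrt (d + b\<^sup>2) \<le> 1"
    proof -
      have "\<bar>b\<bar> \<le> sqrt (d + b\<^sup>2)" using d by (auto intro!: real_le_rsqrt)
      then show ?thesis using pos[of b] by (simp add: divide_le_eq)
    qed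
    have "1 / (d + b\<^sup>2) \<le> 1 / d" using d pos[of b] by (intro divide_left_mono) auto
    then have "(k * \<bar>arctan (a / k)\<bar>) * (\<bar>b\<bar> / sqrt (d + b\<^sup>2)) * (1 / (d + b\<^sup>2)) \<le> (k * 2) * 1 * (1 / d)"
      using at b1 d k pos[of b] by (intro mult_mono) auto
    also have "\<dots> = 2 * k / d" by simp
    finally have e1: "(k * \<bar>arctan (a / k)\<bar>) * (\<bar>b\<bar> / sqrt (d + b\<^sup>2)) * (1 / (d + b\<^sup>2)) \<le> 2 * k / d" .
    have e2: "\<bar>- (k * arctan (a / k) * b / ((d + b\<^sup>2) * sqrt (d + b\<^sup>2)))\<bar>
      = (k * \<bar>arctan (a / k)\<bar>) * (\<bar>b\<bar> / sqrt (d + b\<^sup>2)) * (1 / (d + b\<^sup>2))"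
      using pos[of b] k by (simp add: abs_mult abs_divide)
    have "0 \<le> 1 / sqrt d" using d by simp
    with e1 show "\<bar>- (k * arctan (a / k) * b / ((d + b\<^sup>2) * sqrt (d + b\<^sup>2)))\<bar> \<le> 1 / sqrt d + 2 * k / d"
      unfolding e2 by linarith
  qed
  have ne: "d + b\<^sup>2 \<noteq> 0" "1 + (a / k)\<^sup>2 \<noteq> 0" for a b :: real using pos[of b] pos'[of a] by linarith+
  have c1: "continuous_on UNIV (\<lambda>z. 1 / (1 + (fst z / k)\<^sup>2) / sqrt (d + (snd z)\<^sup>2))"
    using ne k by (intro continuous_intros) auto
  have c2: "continuous_on UNIV (\<lambda>z. - (k * arctan (fst z / k) * snd z / ((d + (snd z)\<^sup>2) * sqrt (d + (snd z)\<^sup>2))))"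
    using ne k by (intro continuous_intros) auto
  show ?thesis unfolding C1_Lip2_def using der bnd c1 c2 by blast
qed

text \<open>
  On a compact set, continuous functions are uniform limits of smooth ones by Stone and
  Weierstrass. The arctangent keeps the approximations uniformly bounded off the compact set.
\<close>

lemma C1b_approx_on_compact:
  fixes f :: "'a::real_inner \<Rightarrow> real"
  assumes K: "compact K" and f: "continuous_on UNIV f" "\<And>x. \<bar>f x\<bar> \<le> C" and e: "0 < e"
  obtains u where "u \<in> C1b" "\<And>x. x \<in> K \<Longrightarrow> \<bar>f x - u x\<bar> < e" "\<And>x. \<bar>u x\<bar> \<le> 2 * (C + 1)"
proof -
  have C: "0 \<le> C" using order_trans[OF abs_ge_zero f(2)] by auto
  \<comment> \<open>The scaling brings \<open>f\<close> into the range of the arctangent, where the tangent is its inverse.\<close>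
  define s where "s = 1 / (C + 1)"
  have s: "0 < s" using C by (simp add: s_def)
  have fs: "\<bar>f x * s\<bar> < pi / 2" for x
  proof -
    have "\<bar>f x\<bar> * s \<le> C * s" using f(2) s by (intro mult_right_mono) auto
    also have "\<dots> < 1" using C by (simp add: s_def)
    also have "1 < pi / 2" using pi_gt3 by simp
    finally show ?thesis using s by (simp add: abs_mult)
  qed
  have cos_ne: "cos (f x * s) \<noteq> 0" for x
  proof -
    have "- (pi / 2) < f x * s" "f x * s < pi / 2" using fs[of x] by linarith+
    then show ?thesis using cos_gt_zero_pi[of "f x * s"] by simp
  qed
  have cont: "continuous_on K (\<lambda>x. tan (f x * s))"
  proof (rule continuous_at_imp_continuous_on, intro ballI)
    fix x
    have "isCont f x" using f(1) by (simp add: continuous_on_eq_continuous_at)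
    then have "isCont (\<lambda>x. f x * s) x" by (intro continuous_intros)
    then show "isCont (\<lambda>x. tan (f x * s)) x" by (rule isCont_o2) (rule isCont_tan[OF cos_ne])
  qed
  interpret function_ring_on "C1b :: ('a \<Rightarrow> real) set" K
  proof
    show "compact K" by fact
    show "continuous_on K u" if "u \<in> C1b" for u :: "'a \<Rightarrow> real"
      using C1b_continuous[OF that] continuous_on_subset by blast
    show "\<exists>u\<in>C1b. u x \<noteq> u y" if "x \<noteq> y" for x y :: 'a
    proof
      show "dip (norm (x - y) / 2) x x \<noteq> dip (norm (x - y) / 2) x y"
      proof -
        have "0 < norm (x - y) / 2" using that by simp
        from dip_lower[OF this, of y x]
        have *: "(1 / (1 + (norm (x - y) / 2)\<^sup>2) - 1 / (1 + (2 * (norm (x - y) / 2))\<^sup>2))\<^sup>2 \<le> dip (norm (x - y) / 2) x y"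
          by (simp add: norm_minus_commute)
        have "(norm (x - y) / 2)\<^sup>2 < (2 * (norm (x - y) / 2))\<^sup>2"
          using that by (intro power_strict_mono) auto
        then have "1 / (1 + (2 * (norm (x - y) / 2))\<^sup>2) < 1 / (1 + (norm (x - y) / 2)\<^sup>2)"
          by (intro divide_strict_left_mono) (auto simp: add_pos_nonneg)
        then have "0 < (1 / (1 + (norm (x - y) / 2)\<^sup>2) - 1 / (1 + (2 * (norm (x - y) / 2))\<^sup>2))\<^sup>2" using that by simp
        with * have "0 < dip (norm (x - y) / 2) x y" by linarith
        moreover have "dip (norm (x - y) / 2) x x = 0" by (rule dip_zero) simp
        ultimately show ?thesis by simp
      qed
    qed (rule C1b_dip)
  qed (auto intro: C1b_add C1b_mult C1b_const)
  obtain w where w: "w \<in> C1b" "\<And>x. x \<in> K \<Longrightarrow> \<bar>tan (f x * s) - w x\<bar> < e * s"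
    using Stone_Weierstrass_basic[OF cont, of "e * s"] e s by auto
  define u where "u x = (1/s) * arctan (w x)" for x
  have "(\<lambda>x. 1 * arctan (w x / 1) / sqrt (1 + 0\<^sup>2)) \<in> C1b"
    by (rule C1b_chain[OF C1_Lip2_arctan w(1) C1b_const[of 0]]) auto
  then have u: "u \<in> C1b" unfolding u_def[abs_def] by (intro C1b_cmult) simp
  have lip: "\<bar>arctan a - arctan b\<bar> \<le> \<bar>a - b\<bar>" for a b
  proof -
    have "norm (arctan a - arctan b) \<le> 1 * norm (a - b)"
    proof (rule field_differentiable_bound[of UNIV arctan "\<lambda>x. inverse (1 + x\<^sup>2)"])
      show "(arctan has_field_derivative inverse (1 + z\<^sup>2)) (at z within UNIV)" for z
        by (simp add: DERIV_arctan)
      show "norm (inverse (1 + z\<^sup>2)) \<le> 1" for z :: real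
        by (simp add: inverse_eq_divide divide_le_eq add_pos_nonneg)
    qed auto
    then show ?thesis by simp
  qed
  show thesis
  proof (rule that[OF u])
    fix x
    show "\<bar>u x\<bar> \<le> 2 * (C + 1)"
    proof -
      have "\<bar>arctan (w x)\<bar> \<le> 2"
        using arctan_lbound[of "w x"] arctan_ubound[of "w x"] pi_less_4 by linarith
      then have "\<bar>u x\<bar> \<le> (1/s) * 2" using s unfolding u_def abs_mult by (intro mult_mono) auto
      then show ?thesis by (simp add: s_def)
    qed
    assume x: "x \<in> K"
    have "f x * s = arctan (tan (f x * s))"
      using fs[of x] by (intro arctan_tan[symmetric]) (auto simp: abs_less_iff)
    then have "\<bar>f x * s - arctan (w x)\<bar> \<le> \<bar>tan (f x * s) - w x\<bar>" using lip by metis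
    then have "\<bar>f x * s - arctan (w x)\<bar> < e * s" using w(2)[OF x] by simp
    then have "(1/s) * \<bar>f x * s - arctan (w x)\<bar> < (1/s) * (e * s)" using s by (intro mult_strict_left_mono) auto
    moreover have "f x - u x = (1/s) * (f x * s - arctan (w x))"
      using s by (simp add: u_def field_simps)
    ultimately show "\<bar>f x - u x\<bar> < e" using s by (simp add: abs_mult)
  qed
qed

section \<open>Tightness of slab averages\<close>

context regular_level
begin

text \<open>
  The minimum of the dips around finitely many points. At each point the gradient is that of one
  of them or a mean of such gradients, so that its bound does not depend on the number of points, and it
  vanishes wherever the minimum does.
\<close>

lemma min_dips:
  fixes c :: "nat \<Rightarrow> 'a"
  assumes \<epsilon>: "0 < \<epsilon>"
  defines "\<kappa> \<equiv> min 1 ((1 / (1 + \<epsilon>\<^sup>2) - 1 / (1 + (2 * \<epsilon>)\<^sup>2))\<^sup>2)"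
  shows "\<exists>v V. (v, V) \<in> M_graph \<nu> R p\<^sub>0 \<and> (\<forall>x. 0 \<le> v x \<and> v x \<le> 1 \<and> norm (V x) \<le> 4 * onorm R \<and>
    (v x = 0 \<longrightarrow> V x = 0) \<and> ((\<exists>i<N. norm (x - c i) \<le> \<epsilon>) \<longrightarrow> v x = 0) \<and>
    ((\<forall>i<N. 2 * \<epsilon> \<le> norm (x - c i)) \<longrightarrow> \<kappa> \<le> v x))"
proof (induction N)
  case 0
  have "((\<lambda>_. 1), (\<lambda>_. 0)) \<in> M_graph \<nu> R p\<^sub>0" using p0 by (intro graph_const) simp
  then show ?case using onorm_pos_le[OF linear_R] 
    by (intro exI[of _ "\<lambda>_. 1"] exI[of _ "\<lambda>_. 0"]) (auto simp: \<kappa>_def)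
next
  case (Suc N)
  then obtain v V where v: "(v, V) \<in> M_graph \<nu> R p\<^sub>0"
    and vb: "\<And>x. 0 \<le> v x" "\<And>x. v x \<le> 1" "\<And>x. norm (V x) \<le> 4 * onorm R" "\<And>x. v x = 0 \<Longrightarrow> V x = 0"
    and v0: "\<And>x i. i < N \<Longrightarrow> norm (x - c i) \<le> \<epsilon> \<Longrightarrow> v x = 0"
    and v1: "\<And>x. (\<forall>i<N. 2 * \<epsilon> \<le> norm (x - c i)) \<Longrightarrow> \<kappa> \<le> v x" by blast
  let ?w = "dip \<epsilon> (c N)" and ?W = "\<lambda>x. R (grad (dip \<epsilon> (c N)) x)"
  have w: "(?w, ?W) \<in> M_graph \<nu> R p\<^sub>0" using p0 by (intro graph_C1b C1b_dip) simp
  have W: "norm (?W x) \<le> 4 * onorm R" for x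
    using onorm[OF linear_R, of "grad (dip \<epsilon> (c N)) x"] mult_left_mono[OF dip_grad_le onorm_pos_le[OF linear_R], of \<epsilon> "c N" x]
    by (simp add: mult.commute)
  have W0: "?w x = 0 \<Longrightarrow> ?W x = 0" for x by (simp add: dip_grad_zero R_zero)
  let ?v = "\<lambda>x. min (v x) (?w x)"
  let ?V = "\<lambda>x. if v x < ?w x then V x else if ?w x < v x then ?W x else (1/2) *\<^sub>R (V x + ?W x)"
  have mean: "norm ((1/2) *\<^sub>R (V x + ?W x)) \<le> 4 * onorm R" for x
    using norm_triangle_ineq[of "V x" "?W x"] vb(3)[of x] W[of x] by simp
  have "(?v, ?V) \<in> M_graph \<nu> R p\<^sub>0" by (rule graph_min[OF v w]) (use p0 in simp)
  moreover have "norm (?V x) \<le> 4 * onorm R" for x using mean vb(3) W by simp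
  moreover have "?V x = 0" if "?v x = 0" for x
    using that vb(1)[of x] vb(4)[of x] W0[of x] dip_nonneg[of \<epsilon> "c N" x] by (auto simp: min_def split: if_splits)
  moreover have "0 \<le> ?v x" "?v x \<le> 1" for x using vb(1,2)[of x] dip_nonneg[of \<epsilon> "c N" x] by auto
  moreover have "?v x = 0" if i: "i < Suc N" "norm (x - c i) \<le> \<epsilon>" for x i
    using i v0[of i x] dip_zero[of x "c N" \<epsilon>] vb(1)[of x] dip_nonneg[of \<epsilon> "c N" x] by (cases "i = N") auto
  moreover have "\<kappa> \<le> ?v x" if "\<forall>i<Suc N. 2 * \<epsilon> \<le> norm (x - c i)" for x
    using that v1[of x] dip_lower[OF \<epsilon>, of x "c N"] by (auto simp: \<kappa>_def)
  ultimately show ?case by blast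
qed

lemma slab_mean_indicator: "A \<in> sets \<nu> \<Longrightarrow> slab_mean a b (indicator A) = measure \<nu> (Slab a b \<inter> A) / (b - a)"
  by (simp add: slab_mean_def space_nu flip: indicator_inter_arith)

text \<open>
  With centres from a dense sequence the minima of the dips tend to zero pointwise, and so do their
  gradients, both being eventually zero at every point. Hence the bound \<open>slab_mean_bound\<close> tends to zero
  as well, and a lower bound for the minimum off the doubled balls turns it into smallness of measure.
\<close>

lemma finite_net_slab_mean:
  assumes \<epsilon>: "0 < \<epsilon>" and \<delta>: "0 < \<delta>"
  shows "\<exists>S. finite S \<and> (\<forall>a b. a < b \<longrightarrow> slab_mean a b (indicator {x. \<forall>c\<in>S. 2 * \<epsilon> \<le> norm (x - c)}) \<le> \<delta>)"
proof -
  obtain D :: "'a set" where D: "countable D" "\<And>X. open X \<Longrightarrow> X \<noteq> {} \<Longrightarrow> \<exists>d\<in>D. d \<in> X"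
    using countable_dense_setE by blast
  have "D \<noteq> {}" using D(2)[of UNIV] by auto
  define c where "c = from_nat_into D"
  have dense: "\<exists>i. norm (x - c i) \<le> \<epsilon>" for x
  proof -
    obtain d where d: "d \<in> D" "d \<in> ball x \<epsilon>" using D(2)[of "ball x \<epsilon>"] \<epsilon> by auto
    then obtain i where "c i = d" using from_nat_into_surj[OF D(1)] by (auto simp: c_def)
    then show ?thesis using d(2) by (auto simp: dist_norm intro!: exI[of _ i])
  qed
  define \<kappa> where "\<kappa> = min 1 ((1 / (1 + \<epsilon>\<^sup>2) - 1 / (1 + (2 * \<epsilon>)\<^sup>2))\<^sup>2)"
  have \<kappa>: "0 < \<kappa>"
  proof -
    have "\<epsilon>\<^sup>2 < (2 * \<epsilon>)\<^sup>2" using \<epsilon> by (intro power_strict_mono) auto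
    then have "1 / (1 + (2 * \<epsilon>)\<^sup>2) < 1 / (1 + \<epsilon>\<^sup>2)"
      by (intro divide_strict_left_mono) (auto simp: add_pos_nonneg)
    then show ?thesis using \<epsilon> by (simp add: \<kappa>_def)
  qed
  obtain v V where v: "\<And>N. (v N, V N) \<in> M_graph \<nu> R p\<^sub>0"
    and vb: "\<And>N x. 0 \<le> v N x" "\<And>N x. v N x \<le> 1" "\<And>N x. norm (V N x) \<le> 4 * onorm R" "\<And>N x. v N x = 0 \<Longrightarrow> V N x = 0"
    and v0: "\<And>N x i. i < N \<Longrightarrow> norm (x - c i) \<le> \<epsilon> \<Longrightarrow> v N x = 0"
    and v1: "\<And>N x. (\<forall>i<N. 2 * \<epsilon> \<le> norm (x - c i)) \<Longrightarrow> \<kappa> \<le> v N x"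
    using min_dips[OF \<epsilon>, of _ c] unfolding \<kappa>_def[symmetric] by metis
  note [measurable] = graph_measurable[OF v]
  have ev: "eventually (\<lambda>N. v N x = 0 \<and> V N x = 0) sequentially" for x
  proof -
    obtain i where i: "norm (x - c i) \<le> \<epsilon>" using dense by blast
    show ?thesis unfolding eventually_sequentially
      using v0[OF _ i] vb(4) by (intro exI[of _ "Suc i"]) auto
  qed
  have "(\<lambda>N. graph_size (v N) (V N)) \<longlonglongrightarrow> (LINT x|\<nu>. 0) + (LINT x|\<nu>. 0)"
    unfolding graph_size_def
  proof (intro tendsto_add integral_dominated_convergence)
    show "integrable \<nu> (\<lambda>x. \<bar>h x\<bar>)" using h_integrable by simp
    show "integrable \<nu> (\<lambda>x. 4 * onorm R * norm (Psi x))" using norm_Psi_integrable by simp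
    show "AE x in \<nu>. norm (\<bar>v N x\<bar> * \<bar>h x\<bar>) \<le> \<bar>h x\<bar>" for N
      using vb(1,2) by (auto simp: abs_mult intro!: mult_left_le_one_le)
    show "AE x in \<nu>. norm (norm (V N x) * norm (Psi x)) \<le> 4 * onorm R * norm (Psi x)" for N
      using vb(3) by (auto intro!: mult_right_mono)
    show "AE x in \<nu>. (\<lambda>N. \<bar>v N x\<bar> * \<bar>h x\<bar>) \<longlonglongrightarrow> 0"
      by (intro AE_I2 tendsto_eventually eventually_mono[OF ev]) auto
    show "AE x in \<nu>. (\<lambda>N. norm (V N x) * norm (Psi x)) \<longlonglongrightarrow> 0"
      by (intro AE_I2 tendsto_eventually eventually_mono[OF ev]) auto
  qed auto
  then have "eventually (\<lambda>N. graph_size (v N) (V N) < \<kappa> * \<delta>) sequentially"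
    using \<kappa> \<delta> by (intro order_tendstoD(2)[of _ 0]) auto
  then obtain N where N: "graph_size (v N) (V N) < \<kappa> * \<delta>" by (auto simp: eventually_sequentially)
  define A where "A = {x. \<forall>d\<in>c ` {..<N}. 2 * \<epsilon> \<le> norm (x - d)}"
  have "A = (\<Inter>d\<in>c ` {..<N}. {x. 2 * \<epsilon> \<le> norm (x - d)})" by (auto simp: A_def)
  then have "closed A" by (auto intro!: closed_INT closed_Collect_le continuous_intros)
  then have [measurable]: "A \<in> sets \<nu>" by (simp add: sets_nu)
  have "slab_mean a b (indicator A) \<le> \<delta>" if ab: "a < b" for a b
  proof -
    have "\<kappa> * slab_mean a b (indicator A) = slab_mean a b (\<lambda>x. \<kappa> * indicator A x)"
      by (rule slab_mean_cmult[symmetric])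
    also have "\<dots> \<le> slab_mean a b (\<lambda>x. \<bar>v N x\<bar>)"
    proof (rule slab_mean_mono[OF _ _ _ ab])
      show "integrable \<nu> (\<lambda>x. \<kappa> * indicator A x)" by (simp add: emeasure_eq_measure)
      show "integrable \<nu> (\<lambda>x. \<bar>v N x\<bar>)"
        by (rule integrable_const_bound[of _ 1]) (use vb(1,2) in auto)
      show "\<kappa> * indicator A x \<le> \<bar>v N x\<bar>" for x using v1[of N x] vb(1)[of N x] by (auto simp: indicator_def A_def)
    qed
    also have "\<dots> \<le> graph_size (v N) (V N)" by (rule slab_mean_bound[OF v order_refl ab])
    also have "\<dots> \<le> \<kappa> * \<delta>" using N by simp
    finally show ?thesis using \<kappa> by simp
  qed
  then show ?thesis by (intro exI[of _ "c ` {..<N}"]) (auto simp: A_def)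
qed

text \<open>
  Finite unions of balls with radii tending to zero intersect in a totally bounded closed set, and a
  geometric series sums up the mass that is lost at each radius.
\<close>

lemma tight_slab_mean:
  assumes \<delta>: "0 < \<delta>"
  obtains K where "compact K" "\<And>a b. a < b \<Longrightarrow> slab_mean a b (indicator (- K)) \<le> \<delta>"
proof -
  define \<epsilon> where "\<epsilon> k = 1 / real (Suc k)" for k
  have \<epsilon>: "0 < \<epsilon> k" for k by (simp add: \<epsilon>_def)
  have "\<exists>S. finite S \<and> (\<forall>a b. a < b \<longrightarrow> slab_mean a b (indicator {x. \<forall>c\<in>S. \<epsilon> k \<le> norm (x - c)}) \<le> \<delta> * (1/2) ^ Suc k)" for k
    using finite_net_slab_mean[of "\<epsilon> k / 2" "\<delta> * (1/2) ^ Suc k"] \<epsilon> \<delta> by simp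
  then have "\<exists>S. \<forall>k. finite (S k) \<and>
    (\<forall>a b. a < b \<longrightarrow> slab_mean a b (indicator {x. \<forall>c\<in>S k. \<epsilon> k \<le> norm (x - c)}) \<le> \<delta> * (1/2) ^ Suc k)"
    by (intro choice allI)
  then obtain S where "\<forall>k. finite (S k) \<and>
    (\<forall>a b. a < b \<longrightarrow> slab_mean a b (indicator {x. \<forall>c\<in>S k. \<epsilon> k \<le> norm (x - c)}) \<le> \<delta> * (1/2) ^ Suc k)" ..
  then have S: "\<And>k. finite (S k)"
    "\<And>k a b. a < b \<Longrightarrow> slab_mean a b (indicator {x. \<forall>c\<in>S k. \<epsilon> k \<le> norm (x - c)}) \<le> \<delta> * (1/2) ^ Suc k" by simp_all
  define A where "A k = {x. \<forall>c\<in>S k. \<epsilon> k \<le> norm (x - c)}" for k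
  define K where "K = (\<Inter>k. \<Union>c\<in>S k. cball c (\<epsilon> k))"
  have "closed K" unfolding K_def using S(1) by (intro closed_INT ballI closed_UN) auto
  have "compact K"
    unfolding compact_eq_totally_bounded complete_eq_closed
  proof (intro conjI allI impI)
    show "closed K" by fact
    fix e :: real assume e: "0 < e"
    then obtain k where k: "\<epsilon> k < e" unfolding \<epsilon>_def using nat_approx_posE by blast
    have "K \<subseteq> (\<Union>c\<in>S k. ball c e)"
    proof
      fix x assume "x \<in> K"
      then obtain c where "c \<in> S k" "dist c x \<le> \<epsilon> k" by (auto simp: K_def)
      then have "c \<in> S k" "x \<in> ball c e" using k by auto
      then show "x \<in> (\<Union>c\<in>S k. ball c e)" by blast
    qed
    then show "\<exists>T. finite T \<and> K \<subseteq> (\<Union>c\<in>T. ball c e)" using S(1) by blast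
  qed
  moreover have "slab_mean a b (indicator (- K)) \<le> \<delta>" if ab: "a < b" for a b
  proof -
    have "A k = (\<Inter>c\<in>S k. {x. \<epsilon> k \<le> norm (x - c)})" for k by (auto simp: A_def)
    then have Acl: "closed (A k)" for k by (auto intro!: closed_INT closed_Collect_le continuous_intros)
    then have [measurable]: "A k \<in> sets \<nu>" for k by (simp add: sets_nu)
    have [measurable]: "- K \<in> sets \<nu>" using \<open>closed K\<close> by (simp add: sets_nu open_Compl)
    have sub: "- K \<subseteq> (\<Union>k. A k)"
    proof
      fix x assume "x \<in> - K"
      then obtain k where k: "\<forall>c\<in>S k. x \<notin> cball c (\<epsilon> k)" unfolding K_def by blast
      have "x \<in> A k" unfolding A_def
      proof (intro CollectI ballI)
        fix c assume "c \<in> S k"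
        then have "\<not> dist c x \<le> \<epsilon> k" using k by simp
        then show "\<epsilon> k \<le> norm (x - c)" by (simp add: dist_norm norm_minus_commute)
      qed
      then show "x \<in> (\<Union>k. A k)" by blast
    qed
    have Ak: "measure \<nu> (Slab a b \<inter> A k) \<le> (b - a) * \<delta> * (1/2) ^ Suc k" for k
    proof -
      have "measure \<nu> (Slab a b \<inter> A k) / (b - a) \<le> \<delta> * (1/2) ^ Suc k"
        using S(2)[OF ab, of k] slab_mean_indicator[of "A k" a b] unfolding A_def[symmetric] by simp
      then show ?thesis using ab by (simp add: pos_divide_le_eq mult_ac)
    qed
    have sums: "(\<lambda>k. (b - a) * \<delta> * (1/2) ^ Suc k) sums ((b - a) * \<delta> * 1)"
      by (intro sums_mult power_half_series)
    then have sm: "summable (\<lambda>k. measure \<nu> (Slab a b \<inter> A k))"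
      by (intro summable_comparison_test'[OF sums_summable[OF sums]]) (use Ak in auto)
    have "measure \<nu> (Slab a b \<inter> - K) \<le> measure \<nu> (\<Union>k. Slab a b \<inter> A k)"
      using sub by (intro finite_measure_mono) auto
    also have "\<dots> \<le> (\<Sum>k. measure \<nu> (Slab a b \<inter> A k))"
      by (intro finite_measure_subadditive_countably sm) auto
    also have "\<dots> \<le> (\<Sum>k. (b - a) * \<delta> * (1/2) ^ Suc k)"
      by (intro suminf_le Ak sm sums_summable[OF sums])
    also have "\<dots> = (b - a) * \<delta>" using sums_unique[OF sums] by simp
    finally show ?thesis using ab by (simp add: slab_mean_indicator pos_divide_le_eq mult.commute)
  qed
  ultimately show thesis by (rule that)
qed

end

text \<open>
  Completeness of \<open>L\<^sup>1\<close> with a rate. A subsequence converges almost everywhere, and Fatou's lemma passes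
  to the limit in its distance from the whole sequence.
\<close>

lemma L1_limit:
  fixes f :: "nat \<Rightarrow> 'a \<Rightarrow> real"
  assumes f: "\<And>n. integrable M (f n)" and le: "\<And>i j. (LINT x|M. \<bar>f i x - f j x\<bar>) \<le> e i + e j" and e: "e \<longlonglongrightarrow> 0"
  obtains \<tau> where "integrable M \<tau>" "\<And>n. (LINT x|M. \<bar>f n x - \<tau> x\<bar>) \<le> e n"
proof -
  note [measurable] = borel_measurable_integrable[OF f]
  have "\<exists>N. \<forall>i\<ge>N. \<forall>j\<ge>N. (LINT x|M. norm (f i x - f j x)) < d" if d: "0 < d" for d
  proof -
    have "eventually (\<lambda>n. e n < d / 2) sequentially" using order_tendstoD(2)[OF e, of "d / 2"] d by simp
    then obtain N where N: "\<And>n. n \<ge> N \<Longrightarrow> e n < d / 2" by (auto simp: eventually_sequentially)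
    show ?thesis
    proof (intro exI allI impI)
      fix i j assume "N \<le> i" "N \<le> j"
      then show "(LINT x|M. norm (f i x - f j x)) < d" using le[of i j] N[of i] N[of j] by simp
    qed
  qed
  then obtain s where s: "strict_mono s" "AE x in M. Cauchy (\<lambda>i. f (s i) x)"
    using cauchy_L1_AE_cauchy_subseq[of M f] f by blast
  define \<tau> where "\<tau> x = lim (\<lambda>i. f (s i) x)" for x
  have [measurable]: "\<tau> \<in> borel_measurable M" unfolding \<tau>_def[abs_def] by measurable
  have lim: "AE x in M. (\<lambda>i. f (s i) x) \<longlonglongrightarrow> \<tau> x"
    using s(2) by eventually_elim (simp add: \<tau>_def Cauchy_convergent convergent_LIMSEQ_iff[symmetric])
  have nn: "(\<integral>\<^sup>+x. ennreal \<bar>f n x - \<tau> x\<bar> \<partial>M) \<le> ennreal (e n)" for n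
  proof -
    have "(\<integral>\<^sup>+x. ennreal \<bar>f n x - \<tau> x\<bar> \<partial>M) = (\<integral>\<^sup>+x. liminf (\<lambda>i. ennreal \<bar>f n x - f (s i) x\<bar>) \<partial>M)"
    proof (rule nn_integral_cong_AE)
      show "AE x in M. ennreal \<bar>f n x - \<tau> x\<bar> = liminf (\<lambda>i. ennreal \<bar>f n x - f (s i) x\<bar>)"
        using lim
      proof eventually_elim
        case (elim x)
        then have "(\<lambda>i. ennreal \<bar>f n x - f (s i) x\<bar>) \<longlonglongrightarrow> ennreal \<bar>f n x - \<tau> x\<bar>"
          by (intro tendsto_ennrealI tendsto_intros)
        then show ?case by (intro lim_imp_Liminf[symmetric]) auto
      qed
    qed
    also have "\<dots> \<le> liminf (\<lambda>i. \<integral>\<^sup>+x. ennreal \<bar>f n x - f (s i) x\<bar> \<partial>M)"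
      by (rule nn_integral_liminf) measurable
    also have "\<dots> \<le> liminf (\<lambda>i. ennreal (e n + e (s i)))"
    proof (rule Liminf_mono, rule always_eventually, rule allI)
      fix i
      have "(\<integral>\<^sup>+x. ennreal \<bar>f n x - f (s i) x\<bar> \<partial>M) = ennreal (LINT x|M. \<bar>f n x - f (s i) x\<bar>)"
        using f by (intro nn_integral_eq_integral) auto
      then show "(\<integral>\<^sup>+x. ennreal \<bar>f n x - f (s i) x\<bar> \<partial>M) \<le> ennreal (e n + e (s i))"
        using le[of n "s i"] by (simp add: ennreal_leI)
    qed
    also have "\<dots> = ennreal (e n)"
    proof (rule lim_imp_Liminf)
      have "(\<lambda>i. e n + e (s i)) \<longlonglongrightarrow> e n + 0"
        using LIMSEQ_subseq_LIMSEQ[OF e s(1)] by (intro tendsto_intros) (simp add: o_def)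
      then show "(\<lambda>i. ennreal (e n + e (s i))) \<longlonglongrightarrow> ennreal (e n)" by (intro tendsto_ennrealI) simp
    qed simp
    finally show ?thesis .
  qed
  have int: "integrable M (\<lambda>x. f n x - \<tau> x)" for n
  proof (rule integrableI_bounded)
    show "(\<integral>\<^sup>+x. ennreal (norm (f n x - \<tau> x)) \<partial>M) < \<infinity>"
      using le_less_trans[OF nn[of n]] by simp
  qed measurable
  show thesis
  proof (rule that)
    show "integrable M \<tau>" using Bochner_Integration.integrable_diff[OF f[of 0] int[of 0]] by simp
    fix n
    have "0 \<le> e n" using le[of n n] by simp
    moreover have "ennreal (LINT x|M. \<bar>f n x - \<tau> x\<bar>) \<le> ennreal (e n)"
      using nn[of n] int[of n] by (subst nn_integral_eq_integral[symmetric]) auto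
    ultimately show "(LINT x|M. \<bar>f n x - \<tau> x\<bar>) \<le> e n" by simp
  qed
qed

section \<open>The surface measure\<close>

context regular_level
begin

lemma bcontfun_integrable: "f \<in> bcontfun \<Longrightarrow> integrable \<nu> (f :: 'a \<Rightarrow> real)"
proof -
  assume f: "f \<in> bcontfun"
  then obtain C where C: "continuous_on UNIV f" "\<And>x. \<bar>f x\<bar> \<le> C" "0 \<le> C" by (rule bcontfunD) auto
  then show ?thesis by (intro integrable_const_bound[of _ C] continuous_measurable) auto
qed

lemma C1b_bcontfun: "f \<in> C1b \<Longrightarrow> f \<in> bcontfun"
  using C1b_continuous[of f] by (auto simp: bcontfun_def C1b_def)

definition total_bound :: real where "total_bound = graph_size (\<lambda>_. 1) (\<lambda>_. 0)"

lemma slab_mean_const_le: "a < b \<Longrightarrow> 0 \<le> c \<Longrightarrow> slab_mean a b (\<lambda>_. c) \<le> c * total_bound"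
proof -
  assume ab: "a < b" and c: "0 \<le> c"
  have "slab_mean a b (\<lambda>_. \<bar>1\<bar>) \<le> total_bound"
    unfolding total_bound_def by (rule slab_mean_bound[OF graph_const order_refl ab]) (use p0 in simp)
  then have "c * slab_mean a b (\<lambda>_. 1) \<le> c * total_bound" using c by (intro mult_left_mono) simp_all
  then show ?thesis using slab_mean_cmult[of a b c "\<lambda>_. 1"] by simp
qed

lemma total_bound_nonneg: "0 \<le> total_bound"
  by (simp add: total_bound_def graph_size_def)

lemma slab_mean_le_split:
  assumes f: "integrable \<nu> f" and K: "compact K" and ab: "a < b"
    and fK: "\<And>x. x \<in> K \<Longrightarrow> f x \<le> \<eta>" and fC: "\<And>x. f x \<le> C" and pos: "0 \<le> \<eta>" "0 \<le> C"
  shows "slab_mean a b f \<le> \<eta> * total_bound + C * slab_mean a b (indicator (- K))"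
proof -
  have [measurable]: "- K \<in> sets \<nu>" using compact_imp_closed[OF K] by (simp add: sets_nu open_Compl)
  have i: "integrable \<nu> (\<lambda>x. C * indicator (- K) x)" by (simp add: emeasure_eq_measure)
  have "slab_mean a b f \<le> slab_mean a b (\<lambda>x. \<eta> + C * indicator (- K) x)"
    using fK fC pos i by (intro slab_mean_mono f ab) (auto simp: indicator_def intro: add_increasing)
  also have "\<dots> = slab_mean a b (\<lambda>_. \<eta>) + C * slab_mean a b (indicator (- K))"
    using i by (simp add: slab_mean_add slab_mean_cmult)
  finally show ?thesis using slab_mean_const_le[OF ab pos(1)] by simp
qed

text \<open>
  On a compact set that carries almost all of the slab averages \<open>f\<close> is close to a smooth function, and
  off that set both functions are bounded.
\<close>

lemma slab_mean_approx:
  assumes f: "f \<in> bcontfun" and e: "0 < e"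
  obtains u where "u \<in> C1b" "\<And>a b. a < b \<Longrightarrow> \<bar>slab_mean a b f - slab_mean a b u\<bar> \<le> e"
proof -
  obtain C where C: "continuous_on UNIV f" "\<And>x. \<bar>f x\<bar> \<le> C" "0 \<le> C" using f by (rule bcontfunD) auto
  define D where "D = 3 * C + 2"
  have D: "0 < D" using C by (simp add: D_def)
  obtain K where K: "compact K" "\<And>a b. a < b \<Longrightarrow> slab_mean a b (indicator (- K)) \<le> e / (2 * D)"
    using tight_slab_mean[of "e / (2 * D)"] e D by auto
  define \<eta> where "\<eta> = e / (2 * (total_bound + 1))"
  have \<eta>: "0 < \<eta>" using e total_bound_nonneg by (simp add: \<eta>_def)
  obtain u where u: "u \<in> C1b" "\<And>x. x \<in> K \<Longrightarrow> \<bar>f x - u x\<bar> < \<eta>" "\<And>x. \<bar>u x\<bar> \<le> 2 * (C + 1)"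
    using C1b_approx_on_compact[OF K(1) C(1,2) \<eta>] by metis
  show thesis
  proof (rule that[OF u(1)])
    fix a b :: real assume ab: "a < b"
    note iu = bcontfun_integrable[OF f] C1b_integrable[OF u(1)]
    have "\<bar>slab_mean a b f - slab_mean a b u\<bar> = \<bar>slab_mean a b (\<lambda>x. f x - u x)\<bar>"
      using iu by (simp add: slab_mean_diff)
    also have "\<dots> \<le> slab_mean a b (\<lambda>x. \<bar>f x - u x\<bar>)" using iu by (intro slab_mean_abs_le ab) auto
    also have "\<dots> \<le> \<eta> * total_bound + D * slab_mean a b (indicator (- K))"
    proof (rule slab_mean_le_split[OF _ K(1) ab])
      show "\<bar>f x - u x\<bar> \<le> D" for x using C(2)[of x] u(3)[of x] by (simp add: D_def abs_le_iff)
    qed (use iu u(2) \<eta> D in \<open>auto intro: less_imp_le\<close>)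
    also have "\<dots> \<le> e / 2 + e / 2"
    proof (rule add_mono)
      show "\<eta> * total_bound \<le> e / 2" using e total_bound_nonneg by (simp add: \<eta>_def field_simps)
      have "D * slab_mean a b (indicator (- K)) \<le> D * (e / (2 * D))" using K(2)[OF ab] D by (intro mult_left_mono) auto
      then show "D * slab_mean a b (indicator (- K)) \<le> e / 2" using D by simp
    qed
    finally show "\<bar>slab_mean a b f - slab_mean a b u\<bar> \<le> e" by simp
  qed
qed

definition lower :: "real \<Rightarrow> nat \<Rightarrow> real" where "lower r n = r - 1 / real (Suc n)"

lemma lower_less: "lower r n < r" by (simp add: lower_def)

lemma lower_tendsto: "lower r \<longlonglongrightarrow> r"
proof -
  have "(\<lambda>n. r - 1 / real (Suc n)) \<longlonglongrightarrow> r - 0" by (intro tendsto_intros LIMSEQ_Suc[OF lim_1_over_n])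
  then show ?thesis by (simp add: lower_def[abs_def])
qed

text \<open>
  Slabs below the level suffice to define the limit; by \<open>slab_mean_tendsto\<close> below, all slabs that
  shrink to the level give the same value.
\<close>

definition surf :: "real \<Rightarrow> ('a \<Rightarrow> real) \<Rightarrow> real" where
  "surf r f = lim (\<lambda>n. slab_mean (lower r n) r f)"

text \<open>
  Up to an error that is uniform in the slab, \<open>f\<close> may be replaced by a smooth function, for which
  convergence is known.
\<close>

lemma slab_mean_tendsto_lower:
  assumes f: "f \<in> bcontfun" shows "(\<lambda>n. slab_mean (lower r n) r f) \<longlonglongrightarrow> surf r f"
proof -
  have "Cauchy (\<lambda>n. slab_mean (lower r n) r f)"
  proof (rule CauchyI)
    fix e :: real assume e: "0 < e"
    obtain u where u: "u \<in> C1b" "\<And>a b. a < b \<Longrightarrow> \<bar>slab_mean a b f - slab_mean a b u\<bar> \<le> e / 4"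
      by (rule slab_mean_approx[OF f, of "e / 4"]) (use e in auto)
    have cau: "Cauchy (\<lambda>n. slab_mean (lower r n) r u)"
      using slab_mean_C1b_tendsto[OF u(1) lower_less lower_tendsto tendsto_const] by (rule LIMSEQ_imp_Cauchy)
    obtain N where N: "\<And>m n. m \<ge> N \<Longrightarrow> n \<ge> N \<Longrightarrow> norm (slab_mean (lower r m) r u - slab_mean (lower r n) r u) < e / 4"
      using CauchyD[OF cau, of "e / 4"] e by auto
    have "norm (slab_mean (lower r m) r f - slab_mean (lower r n) r f) < e" if "m \<ge> N" "n \<ge> N" for m n
      using N[OF that] u(2)[OF lower_less, of r m] u(2)[OF lower_less, of r n] e unfolding real_norm_def by linarith
    then show "\<exists>M. \<forall>m\<ge>M. \<forall>n\<ge>M. norm (slab_mean (lower r m) r f - slab_mean (lower r n) r f) < e" by blast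
  qed
  then show ?thesis by (simp add: surf_def Cauchy_convergent convergent_LIMSEQ_iff[symmetric])
qed

lemma slab_mean_tendsto:
  assumes f: "f \<in> bcontfun" and ab: "\<And>n. a n < b n" and lim: "a \<longlonglongrightarrow> r" "b \<longlonglongrightarrow> r"
  shows "(\<lambda>n. slab_mean (a n) (b n) f) \<longlonglongrightarrow> surf r f"
proof (rule LIMSEQ_I)
  fix e :: real assume e: "0 < e"
  obtain u where u: "u \<in> C1b" "\<And>a b. a < b \<Longrightarrow> \<bar>slab_mean a b f - slab_mean a b u\<bar> \<le> e / 4"
    by (rule slab_mean_approx[OF f, of "e / 4"]) (use e in auto)
  define Q where "Q = (LINT x|\<nu>. indicator {x. r < g x} x * dens u x)"
  have 1: "(\<lambda>n. slab_mean (lower r n) r u) \<longlonglongrightarrow> Q"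
    unfolding Q_def by (rule slab_mean_C1b_tendsto[OF u(1) lower_less lower_tendsto tendsto_const])
  have "\<bar>surf r f - Q\<bar> \<le> e / 4"
  proof (rule LIMSEQ_le_const2)
    show "(\<lambda>n. \<bar>slab_mean (lower r n) r f - slab_mean (lower r n) r u\<bar>) \<longlonglongrightarrow> \<bar>surf r f - Q\<bar>"
      by (intro tendsto_intros slab_mean_tendsto_lower f 1)
  qed (use u(2)[OF lower_less] in auto)
  have lim': "(\<lambda>n. slab_mean (a n) (b n) u) \<longlonglongrightarrow> Q"
    unfolding Q_def by (rule slab_mean_C1b_tendsto[OF u(1) ab lim])
  obtain N where N: "\<And>n. n \<ge> N \<Longrightarrow> norm (slab_mean (a n) (b n) u - Q) < e / 4"
    using LIMSEQ_D[OF lim', of "e / 4"] e by auto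
  have "norm (slab_mean (a n) (b n) f - surf r f) < e" if "n \<ge> N" for n
    using N[OF that] \<open>\<bar>surf r f - Q\<bar> \<le> e / 4\<close> u(2)[OF ab, of n] e unfolding real_norm_def by linarith
  then show "\<exists>N. \<forall>n\<ge>N. norm (slab_mean (a n) (b n) f - surf r f) < e" by blast
qed

text \<open>
  Only the continuity along decreasing sequences needs an argument: by Dini the convergence is uniform on
  a compact set, and tightness bounds the contribution of its complement.
\<close>

lemma daniell_surf: "daniell_functional (surf r)"
proof
  fix f g' :: "'a \<Rightarrow> real" assume f: "f \<in> bcontfun" and g': "g' \<in> bcontfun"
  have "(\<lambda>n. slab_mean (lower r n) r f + slab_mean (lower r n) r g') \<longlonglongrightarrow> surf r f + surf r g'"
    by (intro tendsto_add slab_mean_tendsto_lower f g')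
  then show "surf r (\<lambda>x. f x + g' x) = surf r f + surf r g'"
    using slab_mean_tendsto_lower[OF bcontfun_add[OF f g'], of r] bcontfun_integrable[OF f] bcontfun_integrable[OF g']
    by (simp add: slab_mean_add LIMSEQ_unique)
next
  fix f :: "'a \<Rightarrow> real" and c assume f: "f \<in> bcontfun"
  have "(\<lambda>n. c * slab_mean (lower r n) r f) \<longlonglongrightarrow> c * surf r f"
    by (intro tendsto_intros slab_mean_tendsto_lower f)
  then show "surf r (\<lambda>x. c * f x) = c * surf r f"
    using slab_mean_tendsto_lower[OF bcontfun_mult[OF const_bcontfun[of c] f], of r]
    by (simp add: slab_mean_cmult LIMSEQ_unique)
next
  fix f :: "'a \<Rightarrow> real" assume f: "f \<in> bcontfun" "\<And>x. 0 \<le> f x"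
  have "0 \<le> slab_mean (lower r n) r f" for n
    unfolding slab_mean_def using lower_less[of r n] f(2)
    by (intro divide_nonneg_pos Bochner_Integration.integral_nonneg) auto
  then show "0 \<le> surf r f" by (intro LIMSEQ_le_const[OF slab_mean_tendsto_lower[OF f(1)]]) auto
next
  fix f :: "nat \<Rightarrow> 'a \<Rightarrow> real"
  assume f: "\<And>n. f n \<in> bcontfun" and dec: "\<And>n x. f (Suc n) x \<le> f n x" and lim: "\<And>x. (\<lambda>n. f n x) \<longlonglongrightarrow> 0"
  have mono: "f n x \<le> f m x" if "m \<le> n" for m n x
    using that lift_Suc_antimono_le[of "\<lambda>n. f n x"] dec by auto
  have nn: "0 \<le> f n x" for n x
    by (rule LIMSEQ_le_const2[OF lim[of x]]) (use mono in auto)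
  obtain C where C: "continuous_on UNIV (f 0)" "\<And>x. \<bar>f 0 x\<bar> \<le> C" "0 \<le> C" using f[of 0] by (rule bcontfunD) auto
  have fC: "f n x \<le> C" for n x using mono[of 0 n x] C(2)[of x] by simp
  show "(\<lambda>n. surf r (f n)) \<longlonglongrightarrow> 0"
  proof (rule LIMSEQ_I)
    fix e' :: real assume "0 < e'"
    define e where "e = e' / 2"
    have e: "0 < e" using \<open>0 < e'\<close> by (simp add: e_def)
    define \<eta> where "\<eta> = e / (2 * (total_bound + 1))"
    have \<eta>: "0 < \<eta>" using e total_bound_nonneg by (simp add: \<eta>_def)
    obtain K where K: "compact K" "\<And>a b. a < b \<Longrightarrow> slab_mean a b (indicator (- K)) \<le> e / (2 * (C + 1))"
      using tight_slab_mean[of "e / (2 * (C + 1))"] e C(3) by auto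
    obtain N where N: "\<And>n x. n \<ge> N \<Longrightarrow> x \<in> K \<Longrightarrow> f n x < \<eta>"
      using Dini_compact[OF K(1) bcontfun_continuous[OF f] dec lim \<eta>] by metis
    have "surf r (f n) \<le> e" if n: "n \<ge> N" for n
    proof (rule LIMSEQ_le_const2[OF slab_mean_tendsto_lower[OF f]], intro exI allI impI)
      fix k
      have "slab_mean (lower r k) r (f n) \<le> \<eta> * total_bound + C * slab_mean (lower r k) r (indicator (- K))"
        using N[OF n] fC \<eta> C(3) by (intro slab_mean_le_split bcontfun_integrable f K(1) lower_less) (auto intro: less_imp_le)
      also have "\<dots> \<le> e / 2 + e / 2"
      proof (rule add_mono)
        show "\<eta> * total_bound \<le> e / 2" using e total_bound_nonneg by (simp add: \<eta>_def field_simps)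
        have "C * slab_mean (lower r k) r (indicator (- K)) \<le> C * (e / (2 * (C + 1)))"
          using K(2)[OF lower_less] C(3) by (intro mult_left_mono) auto
        also have "\<dots> \<le> e / 2" using e C(3) by (simp add: field_simps)
        finally show "C * slab_mean (lower r k) r (indicator (- K)) \<le> e / 2" .
      qed
      finally show "slab_mean (lower r k) r (f n) \<le> e" by simp
    qed
    moreover have "0 \<le> surf r (f n)" for n
    proof -
      have "0 \<le> slab_mean (lower r k) r (f n)" for k
        unfolding slab_mean_def using lower_less[of r k] nn
        by (intro divide_nonneg_pos Bochner_Integration.integral_nonneg) auto
      then show ?thesis by (intro LIMSEQ_le_const[OF slab_mean_tendsto_lower[OF f]]) auto
    qed
    ultimately have "norm (surf r (f n) - 0) < e'" if "n \<ge> N" for n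
      using that \<open>0 < e'\<close> by (simp add: e_def) (smt (verit) field_sum_of_halves)
    then show "\<exists>N. \<forall>n\<ge>N. norm (surf r (f n) - 0) < e'" by blast
  qed
qed

text \<open>
  Difference quotients of the distribution function at \<open>r\<close>, from the left or from the right, are slab
  averages.
\<close>

lemma distribution_has_derivative:
  assumes f: "f \<in> bcontfun"
  shows "((\<lambda>\<rho>. LINT x:{x. g x \<le> \<rho>}|\<nu>. f x) has_real_derivative surf r f) (at r)"
proof -
  let ?F = "\<lambda>\<rho>. LINT x:{x. g x \<le> \<rho>}|\<nu>. f x"
  have int: "integrable \<nu> (\<lambda>x. indicator {x. g x \<le> c} x * f x)" for c
    using integrable_mult_indicator[of "{x. g x \<le> c}" \<nu> f] bcontfun_integrable[OF f] by simp
  have F: "(?F b - ?F a) / (b - a) = slab_mean a b f" if "a < b" for a b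
  proof -
    have "?F b - ?F a = (LINT x|\<nu>. indicator {x. g x \<le> b} x * f x - indicator {x. g x \<le> a} x * f x)"
      using int by (simp add: set_lebesgue_integral_def)
    also have "(\<lambda>x. indicator {x. g x \<le> b} x * f x - indicator {x. g x \<le> a} x * f x) = (\<lambda>x. indicator (Slab a b) x * f x)"
      using that by (auto simp: fun_eq_iff indicator_def Slab_def)
    finally show ?thesis by (simp add: slab_mean_def)
  qed
  show ?thesis unfolding has_field_derivative_iff tendsto_at_iff_sequentially
  proof (intro allI impI)
    fix X :: "nat \<Rightarrow> real" assume X: "\<forall>i. X i \<in> UNIV - {r}" "X \<longlonglongrightarrow> r"
    have eq: "(?F (X n) - ?F r) / (X n - r) = slab_mean (min r (X n)) (max r (X n)) f" for n
    proof (cases "X n < r")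
      case True
      have "(?F (X n) - ?F r) / (X n - r) = (?F r - ?F (X n)) / (r - X n)"
        using True by (simp add: field_simps)
      then show ?thesis using F[OF True] True by simp
    next
      case False
      then have "r < X n" using X(1) by (metis DiffD2 insertI1 linorder_neqE_linordered_idom)
      then show ?thesis using F by simp
    qed
    have "(\<lambda>n. slab_mean (min r (X n)) (max r (X n)) f) \<longlonglongrightarrow> surf r f"
    proof (rule slab_mean_tendsto[OF f])
      show "min r (X n) < max r (X n)" for n using X(1)[rule_format, of n] by auto
      show "(\<lambda>n. min r (X n)) \<longlonglongrightarrow> r" using tendsto_min[OF tendsto_const X(2), of r] by simp
      show "(\<lambda>n. max r (X n)) \<longlonglongrightarrow> r" using tendsto_max[OF tendsto_const X(2), of r] by simp
    qed
    then show "((\<lambda>y. (?F y - ?F r) / (y - r)) \<circ> X) \<longlonglongrightarrow> surf r f" by (simp add: o_def eq)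
  qed
qed

abbreviation surface :: "real \<Rightarrow> 'a measure" where "surface r \<equiv> surface_measure \<nu> g r"

lemma surface_rep_measure: "surface r = daniell_functional.rep_measure (surf r)"
proof -
  interpret D: daniell_functional "surf r" by (rule daniell_surf)
  show ?thesis unfolding surface_measure_def
  proof (rule the_equality)
    show "sets D.rep_measure = sets borel \<and> finite_measure D.rep_measure \<and>
     (\<forall>\<phi>\<in>bcontfun. ((\<lambda>\<rho>. LINT x:{x. g x \<le> \<rho>}|\<nu>. \<phi> x) has_real_derivative (LINT x|D.rep_measure. \<phi> x)) (at r))"
      using D.sets_rep_measure D.finite_measure_rep_measure distribution_has_derivative by (simp add: D.integral_rep_measure)
    fix \<sigma> :: "'a measure"
    assume \<sigma>: "sets \<sigma> = sets borel \<and> finite_measure \<sigma> \<and>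
     (\<forall>\<phi>\<in>bcontfun. ((\<lambda>\<rho>. LINT x:{x. g x \<le> \<rho>}|\<nu>. \<phi> x) has_real_derivative (LINT x|\<sigma>. \<phi> x)) (at r))"
    show "\<sigma> = D.rep_measure"
    proof (rule finite_borel_measure_eqI)
      fix f :: "'a \<Rightarrow> real" assume f: "f \<in> bcontfun"
      then have "((\<lambda>\<rho>. LINT x:{x. g x \<le> \<rho>}|\<nu>. f x) has_real_derivative (LINT x|\<sigma>. f x)) (at r)"
        using \<sigma> by blast
      then have "(LINT x|\<sigma>. f x) = surf r f"
        using distribution_has_derivative[OF f] by (rule DERIV_unique)
      then show "(LINT x|\<sigma>. f x) = (LINT x|D.rep_measure. f x)" by (simp add: D.integral_rep_measure f)
    qed (use \<sigma> D.sets_rep_measure D.finite_measure_rep_measure in auto)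
  qed
qed

lemma sets_surface: "sets (surface r) = sets borel"
  and finite_surface: "finite_measure (surface r)"
  and integral_surface: "f \<in> bcontfun \<Longrightarrow> (LINT x|surface r. f x) = surf r f"
proof -
  interpret D: daniell_functional "surf r" by (rule daniell_surf)
  show "sets (surface r) = sets borel" "finite_measure (surface r)"
    "f \<in> bcontfun \<Longrightarrow> (LINT x|surface r. f x) = surf r f"
    by (simp_all add: surface_rep_measure D.sets_rep_measure D.finite_measure_rep_measure D.integral_rep_measure)
qed

lemma bcontfun_surface_integrable:
  assumes f: "f \<in> bcontfun" shows "integrable (surface r) (f :: 'a \<Rightarrow> real)"
proof -
  interpret S: finite_measure "surface r" by (rule finite_surface)
  obtain C where C: "continuous_on UNIV f" "\<And>x. \<bar>f x\<bar> \<le> C" "0 \<le> C" using f by (rule bcontfunD) auto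
  have "f \<in> borel_measurable (surface r)"
    using borel_measurable_continuous_onI[OF C(1)] by (simp add: measurable_cong_sets[OF sets_surface refl])
  then show ?thesis using C by (intro S.integrable_const_bound[of _ C]) auto
qed

section \<open>The trace on a level set\<close>

lemma surface_integral_bound:
  assumes u: "u \<in> C1b"
  shows "(LINT x|surface r. \<bar>u x\<bar>) \<le> graph_size u (\<lambda>x. R (grad u x))"
proof -
  have ub: "(\<lambda>x. \<bar>u x\<bar>) \<in> bcontfun"
  proof -
    have "(\<lambda>x. \<bar>u x\<bar>) = (\<lambda>x. max (u x) (-1 * u x))" by (auto simp: fun_eq_iff max_def)
    then show ?thesis
      using bcontfun_max[OF C1b_bcontfun[OF u] C1b_bcontfun[OF C1b_cmult[OF u, of "-1"]]] by simp
  qed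
  have "slab_mean (lower r n) r (\<lambda>x. \<bar>u x\<bar>) \<le> graph_size u (\<lambda>x. R (grad u x))" for n
    by (rule slab_mean_bound_C1b[OF u lower_less])
  then have "surf r (\<lambda>x. \<bar>u x\<bar>) \<le> graph_size u (\<lambda>x. R (grad u x))"
    by (intro LIMSEQ_le_const2[OF slab_mean_tendsto_lower[OF ub]]) auto
  then show ?thesis using integral_surface[OF ub] by simp
qed

text \<open>
  The value of \<open>M_op\<close> at \<open>u n - f\<close> is a representative of \<open>R \<nabla>(u n) - F\<close> by closability, so the norm that
  is written with \<open>M_op\<close> measures convergence of the values and of the gradients.
\<close>

lemma W1_norm_tendsto_iff:
  assumes f: "(f, F) \<in> M_graph \<nu> R p" and p: "1 < p" and u: "\<And>n. u n \<in> C1b"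
  shows "(\<lambda>n. W1_norm \<nu> R p (\<lambda>x. u n x - f x)) \<longlonglongrightarrow> 0 \<longleftrightarrow>
    Lp_tendsto \<nu> p u f \<and> Lp_tendsto \<nu> p (\<lambda>n x. R (grad (u n) x)) F"
proof -
  have p': "0 < p" "0 \<le> p" using p by auto
  let ?A = "\<lambda>n. Lp_norm \<nu> p (\<lambda>x. u n x - f x)" and ?B = "\<lambda>n. Lp_norm \<nu> p (\<lambda>x. R (grad (u n) x) - F x)"
  have "Lp_norm \<nu> p (M_op \<nu> R p (\<lambda>x. u n x - f x)) = ?B n" for n
  proof -
    have d: "((\<lambda>x. u n x - f x), (\<lambda>x. R (grad (u n) x) - F x)) \<in> M_graph \<nu> R p"
      by (intro graph_diff graph_C1b u f p')
    note [measurable] = graph_measurable[OF d] graph_measurable[OF graph_M_op[OF graph_W1[OF d]]]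
    have "(LINT x|\<nu>. norm (M_op \<nu> R p (\<lambda>x. u n x - f x) x) powr p) = (LINT x|\<nu>. norm (R (grad (u n) x) - F x) powr p)"
      using M_op_eq[OF d p] by (intro integral_cong_AE) (auto elim!: eventually_mono)
    then show ?thesis by (simp add: Lp_norm_def)
  qed
  then have W: "W1_norm \<nu> R p (\<lambda>x. u n x - f x) = ?A n + ?B n" for n by (simp add: W1_norm_def)
  have nn: "0 \<le> ?A n" "0 \<le> ?B n" for n by (auto simp: Lp_norm_def)
  have "(\<lambda>n. ?A n + ?B n) \<longlonglongrightarrow> 0 \<longleftrightarrow> ?A \<longlonglongrightarrow> 0 \<and> ?B \<longlonglongrightarrow> 0"
  proof
    assume *: "(\<lambda>n. ?A n + ?B n) \<longlonglongrightarrow> 0"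
    show "?A \<longlonglongrightarrow> 0 \<and> ?B \<longlonglongrightarrow> 0"
      using nn by (intro conjI tendsto_sandwich[OF _ _ tendsto_const *]) auto
  next
    assume "?A \<longlonglongrightarrow> 0 \<and> ?B \<longlonglongrightarrow> 0"
    then show "(\<lambda>n. ?A n + ?B n) \<longlonglongrightarrow> 0" using tendsto_add[of ?A 0 _ ?B 0] by simp
  qed
  then show ?thesis
    using C1b_Lp[OF u p'(2)] R_grad_Lp[OF u p'(2)] graph_Lp[OF f] by (simp add: W Lp_tendsto_def)
qed

text \<open>
  By \<open>surface_integral_bound\<close>, smooth functions that are close in the graph norm are close in \<open>L\<^sup>1\<close> of the
  surface measure. Hence approximating sequences converge there, and any two of them to the same limit.
\<close>

lemma trace_exists:
  assumes f: "(f, F) \<in> M_graph \<nu> R p" and p: "p\<^sub>0 \<le> p"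
  shows "\<exists>\<tau>. integrable (surface r) \<tau> \<and>
     (\<forall>u. (\<forall>n. u n \<in> C1b) \<and> (\<lambda>n. W1_norm \<nu> R p (\<lambda>x. u n x - f x)) \<longlonglongrightarrow> 0 \<longrightarrow>
        (\<lambda>n. LINT x|surface r. \<bar>u n x - \<tau> x\<bar>) \<longlonglongrightarrow> 0)"
proof -
  have p1: "1 < p" using p p0 by simp
  have p0': "0 < p\<^sub>0" "0 \<le> p\<^sub>0" using p0 by auto
  note f0 = graph_mono[OF f p0'(1) p]
  define err where "err u = graph_size (\<lambda>x. u x - f x) (\<lambda>x. R (grad u x) - F x)" for u
  have err_lim: "(\<lambda>n. err (u n)) \<longlonglongrightarrow> 0"
    if u: "\<And>n. u n \<in> C1b" "Lp_tendsto \<nu> p u f" "Lp_tendsto \<nu> p (\<lambda>n x. R (grad (u n) x)) F" for u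
    unfolding err_def using u p p0'(1) by (intro graph_size_tendsto_0 Lp_tendsto_mono_exponent[OF _ p0'(1) p]) 
  have err_le: "(LINT x|surface r. \<bar>u x - v x\<bar>) \<le> err u + err v" if u: "u \<in> C1b" and v: "v \<in> C1b" for u v
  proof -
    have uv: "(\<lambda>x. u x + (-1) * v x) \<in> C1b" "grad (\<lambda>x. u x + (-1) * v x) = (\<lambda>x. grad u x + (-1) *\<^sub>R grad v x)"
      using C1b_add[OF u C1b_cmult[OF v, of "-1"]] grad_add[OF u C1b_cmult[OF v, of "-1"]] grad_cmult[OF v, of "-1"] by simp_all
    have "(LINT x|surface r. \<bar>u x - v x\<bar>) \<le> graph_size (\<lambda>x. u x - v x) (\<lambda>x. R (grad u x) - R (grad v x))"
      using surface_integral_bound[OF uv(1), of r] by (simp only: uv(2)) (simp add: linear_simps(2)[OF linear_R])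
    also have "\<dots> = graph_size (\<lambda>x. (u x - f x) + (f x - v x)) (\<lambda>x. (R (grad u x) - F x) + (F x - R (grad v x)))"
      by simp
    also have "\<dots> \<le> graph_size (\<lambda>x. u x - f x) (\<lambda>x. R (grad u x) - F x) + graph_size (\<lambda>x. f x - v x) (\<lambda>x. F x - R (grad v x))"
      by (intro graph_size_triangle Lp_diff C1b_Lp R_grad_Lp u v graph_Lp[OF f0] p0')
    also have "graph_size (\<lambda>x. f x - v x) (\<lambda>x. F x - R (grad v x)) = err v"
      unfolding err_def graph_size_def by (simp only: abs_minus_commute norm_minus_commute)
    finally show ?thesis by (simp add: err_def)
  qed
  obtain w where w: "\<And>n. w n \<in> C1b" "Lp_tendsto \<nu> p w f" "Lp_tendsto \<nu> p (\<lambda>n x. R (grad (w n) x)) F"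
    using f by (auto simp: M_graph_def)
  obtain \<tau> where \<tau>: "integrable (surface r) \<tau>" "\<And>n. (LINT x|surface r. \<bar>w n x - \<tau> x\<bar>) \<le> err (w n)"
  proof (rule L1_limit)
    show "integrable (surface r) (w n)" for n by (intro bcontfun_surface_integrable C1b_bcontfun w)
    show "(LINT x|surface r. \<bar>w i x - w j x\<bar>) \<le> err (w i) + err (w j)" for i j by (intro err_le w)
    show "(\<lambda>n. err (w n)) \<longlonglongrightarrow> 0" by (rule err_lim[OF w])
  qed blast
  show ?thesis
  proof (intro exI conjI allI impI)
    show "integrable (surface r) \<tau>" by fact
    fix u assume u: "(\<forall>n. u n \<in> C1b) \<and> (\<lambda>n. W1_norm \<nu> R p (\<lambda>x. u n x - f x)) \<longlonglongrightarrow> 0"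
    then have uC: "\<And>n. u n \<in> C1b" by blast
    have ul: "Lp_tendsto \<nu> p u f" "Lp_tendsto \<nu> p (\<lambda>n x. R (grad (u n) x)) F"
      using u W1_norm_tendsto_iff[where u=u, OF f p1 uC] by blast+
    have iu: "integrable (surface r) (u n)" "integrable (surface r) (w n)" for n
      by (intro bcontfun_surface_integrable C1b_bcontfun uC w)+
    have le: "(LINT x|surface r. \<bar>u n x - \<tau> x\<bar>) \<le> err (u n) + err (w n) + err (w n)" for n
    proof -
      have "(LINT x|surface r. \<bar>u n x - \<tau> x\<bar>) \<le> (LINT x|surface r. \<bar>u n x - w n x\<bar> + \<bar>w n x - \<tau> x\<bar>)"
        using iu \<tau>(1) by (intro integral_mono) auto
      also have "\<dots> = (LINT x|surface r. \<bar>u n x - w n x\<bar>) + (LINT x|surface r. \<bar>w n x - \<tau> x\<bar>)"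
        using iu \<tau>(1) by simp
      finally show ?thesis using err_le[OF uC w(1), of n n] \<tau>(2)[of n] by linarith
    qed
    have "(\<lambda>n. err (u n) + err (w n) + err (w n)) \<longlonglongrightarrow> 0 + 0 + 0"
      by (intro tendsto_add err_lim[OF uC ul] err_lim[OF w])
    then have lim: "(\<lambda>n. err (u n) + err (w n) + err (w n)) \<longlonglongrightarrow> 0" by simp
    show "(\<lambda>n. LINT x|surface r. \<bar>u n x - \<tau> x\<bar>) \<longlonglongrightarrow> 0"
    proof (rule tendsto_sandwich[OF _ _ tendsto_const lim])
      show "eventually (\<lambda>n. (LINT x|surface r. \<bar>u n x - \<tau> x\<bar>) \<le> err (u n) + err (w n) + err (w n)) sequentially"
        using le by simp
    qed simp
  qed
qed

lemma
  assumes f: "(f, F) \<in> M_graph \<nu> R p" and p: "p\<^sub>0 \<le> p"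
  shows trace_integrable: "integrable (surface r) (trace_op \<nu> R (surface r) p f)"
    and trace_tendsto: "\<And>u. (\<And>n. u n \<in> C1b) \<Longrightarrow> Lp_tendsto \<nu> p u f \<Longrightarrow> Lp_tendsto \<nu> p (\<lambda>n x. R (grad (u n) x)) F \<Longrightarrow>
      (\<lambda>n. LINT x|surface r. \<bar>u n x - trace_op \<nu> R (surface r) p f x\<bar>) \<longlonglongrightarrow> 0"
proof -
  have p1: "1 < p" using p p0 by simp
  note T = someI_ex[OF trace_exists[OF f p, of r], folded trace_op_def]
  show "integrable (surface r) (trace_op \<nu> R (surface r) p f)" using T by blast
  show "(\<lambda>n. LINT x|surface r. \<bar>u n x - trace_op \<nu> R (surface r) p f x\<bar>) \<longlonglongrightarrow> 0"
    if "\<And>n. u n \<in> C1b" "Lp_tendsto \<nu> p u f" "Lp_tendsto \<nu> p (\<lambda>n x. R (grad (u n) x)) F" for u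
  proof -
    have "(\<lambda>n. W1_norm \<nu> R p (\<lambda>x. u n x - f x)) \<longlonglongrightarrow> 0"
      using that(2,3) by (simp add: W1_norm_tendsto_iff[where u=u, OF f p1 that(1)])
    then show ?thesis using that(1) by (intro T[THEN conjunct2, rule_format]) simp
  qed
qed

text \<open>
  Slab averages of a Sobolev function, which need not be continuous, converge to the surface
  integral of its trace, because the slab averages of smooth approximations
  converge uniformly in the slab.
\<close>

lemma slab_mean_tendsto_trace:
  assumes f: "(f, F) \<in> M_graph \<nu> R p" and p: "p\<^sub>0 \<le> p" and \<phi>: "\<phi> \<in> C1b"
  shows "(\<lambda>n. slab_mean (lower r n) r (\<lambda>x. \<phi> x * f x))
    \<longlonglongrightarrow> (LINT x|surface r. \<phi> x * trace_op \<nu> R (surface r) p f x)"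
proof -
  let ?T = "trace_op \<nu> R (surface r) p f"
  have p0': "0 < p\<^sub>0" "0 \<le> p\<^sub>0" "1 \<le> p\<^sub>0" using p0 by auto
  note f0 = graph_mono[OF f p0'(1) p]
  obtain A A' where A: "\<And>x. \<bar>\<phi> x\<bar> \<le> A" "\<And>x. norm (grad \<phi> x) \<le> A'" using \<phi> by (rule C1b_bounded) auto
  have A0: "0 \<le> A" using order_trans[OF abs_ge_zero A(1)] by auto
  obtain u where u: "\<And>n. u n \<in> C1b" "Lp_tendsto \<nu> p u f" "Lp_tendsto \<nu> p (\<lambda>n x. R (grad (u n) x)) F"
    using f by (auto simp: M_graph_def)
  define err where "err k = graph_size (\<lambda>x. u k x - f x) (\<lambda>x. R (grad (u k) x) - F x)" for k
  define err' where "err' k = (LINT x|surface r. \<bar>u k x - ?T x\<bar>)" for k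
  have "err \<longlonglongrightarrow> 0"
    unfolding err_def using u by (intro graph_size_tendsto_0 Lp_tendsto_mono_exponent[OF _ p0'(1) p]) 
  have "err' \<longlonglongrightarrow> 0" unfolding err'_def by (rule trace_tendsto[OF f p u])
  have if': "integrable \<nu> f" by (rule Lp_integrable[OF graph_Lp(1)[OF f0] p0'(3)])
  note iphi = integrable_bounded_mult[OF C1b_measurable[OF \<phi>] A(1)]
  have 1: "\<bar>slab_mean a b (\<lambda>x. \<phi> x * f x) - slab_mean a b (\<lambda>x. \<phi> x * u k x)\<bar> \<le> A * err k" if ab: "a < b" for a b k
  proof -
    have d: "((\<lambda>x. u k x - f x), (\<lambda>x. R (grad (u k) x) - F x)) \<in> M_graph \<nu> R p\<^sub>0"
      by (intro graph_diff graph_C1b u f0 p0')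
    have iu: "integrable \<nu> (u k)" by (rule C1b_integrable[OF u(1)])
    have "\<bar>slab_mean a b (\<lambda>x. \<phi> x * f x) - slab_mean a b (\<lambda>x. \<phi> x * u k x)\<bar>
      = \<bar>slab_mean a b (\<lambda>x. \<phi> x * u k x - \<phi> x * f x)\<bar>"
      using iphi[OF if'] iphi[OF iu] by (simp add: slab_mean_diff abs_minus_commute)
    also have "\<dots> \<le> slab_mean a b (\<lambda>x. \<bar>\<phi> x * u k x - \<phi> x * f x\<bar>)"
      using iphi[OF if'] iphi[OF iu] by (intro slab_mean_abs_le ab) auto
    also have "\<dots> \<le> slab_mean a b (\<lambda>x. A * \<bar>u k x - f x\<bar>)"
    proof (rule slab_mean_mono[OF _ _ _ ab])
      show "integrable \<nu> (\<lambda>x. \<bar>\<phi> x * u k x - \<phi> x * f x\<bar>)" "integrable \<nu> (\<lambda>x. A * \<bar>u k x - f x\<bar>)"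
        using iphi[OF if'] iphi[OF iu] if' iu by auto
      show "\<bar>\<phi> x * u k x - \<phi> x * f x\<bar> \<le> A * \<bar>u k x - f x\<bar>" for x
        using A(1) by (auto simp: abs_mult right_diff_distrib[symmetric] intro!: mult_right_mono)
    qed
    also have "\<dots> = A * slab_mean a b (\<lambda>x. \<bar>u k x - f x\<bar>)" by (rule slab_mean_cmult)
    also have "\<dots> \<le> A * err k" unfolding err_def using A0
      by (intro mult_left_mono slab_mean_bound[OF d order_refl ab])
    finally show ?thesis .
  qed
  have 2: "(\<lambda>n. slab_mean (lower r n) r (\<lambda>x. \<phi> x * u k x)) \<longlonglongrightarrow> (LINT x|surface r. \<phi> x * u k x)" for k
    using slab_mean_tendsto_lower[OF C1b_bcontfun[OF C1b_mult[OF \<phi> u(1)]], of r k]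
      integral_surface[OF C1b_bcontfun[OF C1b_mult[OF \<phi> u(1)]], of r k] by simp
  have 3: "\<bar>(LINT x|surface r. \<phi> x * u k x) - (LINT x|surface r. \<phi> x * ?T x)\<bar> \<le> A * err' k" for k
  proof -
    note iT = trace_integrable[OF f p, of r]
    have ms: "\<phi> \<in> borel_measurable (surface r)"
      by (rule borel_measurable_integrable[OF bcontfun_surface_integrable[OF C1b_bcontfun[OF \<phi>]]])
    note iphi' = integrable_bounded_mult[OF ms A(1)]
    have iu: "integrable (surface r) (u k)" by (intro bcontfun_surface_integrable C1b_bcontfun u)
    have "\<bar>(LINT x|surface r. \<phi> x * u k x) - (LINT x|surface r. \<phi> x * ?T x)\<bar>
      = \<bar>LINT x|surface r. \<phi> x * u k x - \<phi> x * ?T x\<bar>"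
      using iphi'[OF iu] iphi'[OF iT] by simp
    also have "\<dots> \<le> (LINT x|surface r. \<bar>\<phi> x * u k x - \<phi> x * ?T x\<bar>)" by (rule integral_abs_bound)
    also have "\<dots> \<le> (LINT x|surface r. A * \<bar>u k x - ?T x\<bar>)"
    proof (rule integral_mono)
      show "integrable (surface r) (\<lambda>x. \<bar>\<phi> x * u k x - \<phi> x * ?T x\<bar>)" "integrable (surface r) (\<lambda>x. A * \<bar>u k x - ?T x\<bar>)"
        using iphi'[OF iu] iphi'[OF iT] iu iT by auto
      show "\<bar>\<phi> x * u k x - \<phi> x * ?T x\<bar> \<le> A * \<bar>u k x - ?T x\<bar>" for x
        using A(1) by (auto simp: abs_mult right_diff_distrib[symmetric] intro!: mult_right_mono)
    qed
    finally show ?thesis by (simp add: err'_def)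
  qed
  show ?thesis
  proof (rule LIMSEQ_I)
    fix e :: real assume e: "0 < e"
    have "(\<lambda>k. A * err k) \<longlonglongrightarrow> A * 0" "(\<lambda>k. A * err' k) \<longlonglongrightarrow> A * 0"
      by (intro tendsto_mult_left; fact)+
    then have "eventually (\<lambda>k. A * err k < e / 4) sequentially" "eventually (\<lambda>k. A * err' k < e / 4) sequentially"
      using e by (auto intro!: order_tendstoD(2)[of _ 0])
    then have "eventually (\<lambda>k. A * err k < e / 4 \<and> A * err' k < e / 4) sequentially" by eventually_elim auto
    then obtain k where k: "A * err k < e / 4" "A * err' k < e / 4" by (auto simp: eventually_sequentially)
    obtain N where N: "\<And>n. n \<ge> N \<Longrightarrow> norm (slab_mean (lower r n) r (\<lambda>x. \<phi> x * u k x) - (LINT x|surface r. \<phi> x * u k x)) < e / 4"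
      using LIMSEQ_D[OF 2[of k], of "e / 4"] e by auto
    have "norm (slab_mean (lower r n) r (\<lambda>x. \<phi> x * f x) - (LINT x|surface r. \<phi> x * ?T x)) < e" if "n \<ge> N" for n
      using N[OF that] 1[OF lower_less, of r n k] 3[of k] k e unfolding real_norm_def by linarith
    then show "\<exists>N. \<forall>n\<ge>N. norm (slab_mean (lower r n) r (\<lambda>x. \<phi> x * f x) - (LINT x|surface r. \<phi> x * ?T x)) < e" by blast
  qed
qed

end

section \<open>Sobolev vector fields: the norm and the direction\<close>

lemma orthonormal_sum_norm:
  fixes e :: "nat \<Rightarrow> 'a::real_inner"
  assumes e: "\<And>i j. e i \<bullet> e j = (if i = j then 1 else (0::real))"
  shows "(norm (x - (\<Sum>i<N. (x \<bullet> e i) *\<^sub>R e i)))\<^sup>2 = (norm x)\<^sup>2 - (\<Sum>i<N. (x \<bullet> e i)\<^sup>2)"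
    and "j < N \<Longrightarrow> (x - (\<Sum>i<N. (x \<bullet> e i) *\<^sub>R e i)) \<bullet> e j = 0"
proof -
  let ?P = "\<Sum>i<N. (x \<bullet> e i) *\<^sub>R e i"
  have Pe: "?P \<bullet> e j = x \<bullet> e j" if "j < N" for j
  proof -
    have "?P \<bullet> e j = (\<Sum>i<N. (x \<bullet> e i) * (e i \<bullet> e j))" by (simp add: inner_sum_left)
    also have "\<dots> = (\<Sum>i<N. if i = j then x \<bullet> e i else 0)" by (intro sum.cong) (auto simp: e)
    finally show ?thesis using that by simp
  qed
  then show "j < N \<Longrightarrow> (x - ?P) \<bullet> e j = 0" by (simp add: inner_diff_left)
  have PP: "?P \<bullet> ?P = (\<Sum>i<N. (x \<bullet> e i)\<^sup>2)"
  proof -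
    have "z \<bullet> ?P = (\<Sum>i<N. (x \<bullet> e i) * (z \<bullet> e i))" for z by (simp add: inner_sum_right)
    then have "?P \<bullet> ?P = (\<Sum>i<N. (x \<bullet> e i) * (?P \<bullet> e i))" .
    also have "\<dots> = (\<Sum>i<N. (x \<bullet> e i)\<^sup>2)" by (rule sum.cong) (auto simp: Pe power2_eq_square)
    finally show ?thesis .
  qed
  have xP: "x \<bullet> ?P = (\<Sum>i<N. (x \<bullet> e i)\<^sup>2)" by (simp add: inner_sum_right power2_eq_square)
  show "(norm (x - ?P))\<^sup>2 = (norm x)\<^sup>2 - (\<Sum>i<N. (x \<bullet> e i)\<^sup>2)"
    unfolding power2_norm_eq_inner using PP xP by (simp add: inner_diff_left inner_diff_right inner_commute)
qed

text \<open>
  Partial sums of the expansion are best approximations from the span of finitely many basis vectors, and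
  these spans are dense together.
\<close>

lemma orthonormal_basis_Parseval:
  assumes b: "orthonormal_basis e"
  shows "(\<lambda>i. (x \<bullet> e i)\<^sup>2) sums (norm x)\<^sup>2"
proof -
  have e: "\<And>i j. e i \<bullet> e j = (if i = j then 1 else 0)" and cl: "closure (span (range e)) = UNIV"
    using b by (auto simp: orthonormal_basis_def)
  note P = orthonormal_sum_norm[of e, OF e]
  show ?thesis unfolding sums_def
  proof (rule LIMSEQ_I)
    fix d :: real assume d: "0 < d"
    have "x \<in> closure (span (range e))" using cl by simp
    then obtain y where y: "y \<in> span (range e)" "dist y x < sqrt d"
      using d closure_approachable[of x "span (range e)"] by (meson real_sqrt_gt_zero)
    obtain T c where T: "finite T" "T \<subseteq> range e" "y = (\<Sum>a\<in>T. c a *\<^sub>R a)"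
      using y(1) by (auto simp: span_explicit)
    obtain I where I: "finite I" "T = e ` I" using finite_subset_image[OF T(1,2)] by auto
    obtain N where N: "I \<subseteq> {..<N}" using I(1) finite_nat_iff_bounded by blast
    have "norm ((\<Sum>i<n. (x \<bullet> e i)\<^sup>2) - (norm x)\<^sup>2) < d" if n: "n \<ge> N" for n
    proof -
      let ?P = "\<Sum>i<n. (x \<bullet> e i) *\<^sub>R e i"
      have orth: "(x - ?P) \<bullet> z = 0" if z: "z \<in> span (e ` {..<n})" for z
        using z by (induction rule: span_induct_alt) (auto simp: inner_add_right P(2))
      have "y \<in> span (e ` {..<n})"
        unfolding T(3) using N n I(2) by (intro span_sum span_scale span_base) auto
      moreover have "?P \<in> span (e ` {..<n})" by (intro span_sum span_scale span_base) auto
      ultimately have 0: "(x - ?P) \<bullet> (?P - y) = 0" by (intro orth span_diff)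
      have "(norm (x - y))\<^sup>2 = (norm ((x - ?P) + (?P - y)))\<^sup>2" by simp
      also have "\<dots> = (norm (x - ?P))\<^sup>2 + (norm (?P - y))\<^sup>2"
        unfolding power2_norm_eq_inner inner_add_left inner_add_right using 0 inner_commute[of "x - ?P" "?P - y"] by simp
      finally have "(norm (x - ?P))\<^sup>2 \<le> (norm (x - y))\<^sup>2" by simp
      also have "\<dots> < d"
        using power_strict_mono[OF y(2), of 2] d by (simp add: dist_norm norm_minus_commute)
      finally show ?thesis using P(1)[of x n] zero_le_power2[of "norm (x - ?P)"] by (simp add: abs_real_def)
    qed
    then show "\<exists>N. \<forall>n\<ge>N. norm ((\<Sum>i<n. (x \<bullet> e i)\<^sup>2) - (norm x)\<^sup>2) < d" by blast
  qed
qed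

lemma norm_sum_scaleR_le:
  fixes D :: "nat \<Rightarrow> 'a::real_normed_vector"
  shows "norm (\<Sum>j\<in>A. f j *\<^sub>R D j) \<le> sqrt (\<Sum>j\<in>A. (f j)\<^sup>2) * sqrt (\<Sum>j\<in>A. (norm (D j))\<^sup>2)"
proof -
  have "norm (\<Sum>j\<in>A. f j *\<^sub>R D j) \<le> (\<Sum>j\<in>A. \<bar>f j\<bar> * \<bar>norm (D j)\<bar>)"
    by (rule order_trans[OF norm_sum]) simp
  also have "\<dots> \<le> L2_set f A * L2_set (\<lambda>j. norm (D j)) A" by (rule L2_set_mult_ineq)
  finally show ?thesis by (simp add: L2_set_def)
qed

lemma summable_scaleR_squares:
  fixes D :: "nat \<Rightarrow> 'a::banach"
  assumes f: "summable (\<lambda>j. (f j)\<^sup>2)" and D: "summable (\<lambda>j. (norm (D j))\<^sup>2)"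
  shows "summable (\<lambda>j. f j *\<^sub>R D j)"
proof (rule summable_comparison_test'[of "\<lambda>j. (f j)\<^sup>2 + (norm (D j))\<^sup>2" 0])
  show "summable (\<lambda>j. (f j)\<^sup>2 + (norm (D j))\<^sup>2)" using f D by (rule summable_add)
  fix j
  have "2 * (\<bar>f j\<bar> * norm (D j)) \<le> (f j)\<^sup>2 + (norm (D j))\<^sup>2"
    using sum_squares_bound[of "\<bar>f j\<bar>" "norm (D j)"] by simp
  moreover have "0 \<le> \<bar>f j\<bar> * norm (D j)" by simp
  ultimately show "norm (f j *\<^sub>R D j) \<le> (f j)\<^sup>2 + (norm (D j))\<^sup>2"
    unfolding norm_scaleR by linarith
qed

lemma arctan_scaled_tendsto: "(\<lambda>n. real (Suc n) * arctan (y / real (Suc n))) \<longlonglongrightarrow> y"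
proof (cases "y = 0")
  case False
  have "((\<lambda>z. arctan z / z) \<longlongrightarrow> 1) (at 0)"
    using DERIV_arctan[of 0] by (simp add: has_field_derivative_iff)
  moreover have "filterlim (\<lambda>n. y / real (Suc n)) (at 0) sequentially"
  proof (rule filterlim_atI)
    show "(\<lambda>n. y / real (Suc n)) \<longlonglongrightarrow> 0"
      using tendsto_mult_right[OF LIMSEQ_Suc[OF lim_1_over_n], of y] by simp
  qed (use False in auto)
  ultimately have "(\<lambda>n. arctan (y / real (Suc n)) / (y / real (Suc n))) \<longlonglongrightarrow> 1"
    by (rule filterlim_compose)
  then have "(\<lambda>n. y * (arctan (y / real (Suc n)) / (y / real (Suc n)))) \<longlonglongrightarrow> y * 1"
    by (rule tendsto_mult_left)
  moreover have "y * (arctan (y / real (Suc n)) / (y / real (Suc n))) = real (Suc n) * arctan (y / real (Suc n))" for n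
    using False by (simp del: of_nat_Suc)
  ultimately show ?thesis by simp
qed simp

lemma abs_arctan_le: "\<bar>arctan x\<bar> \<le> \<bar>x\<bar>"
proof -
  have "norm (arctan x - arctan 0) \<le> 1 * norm (x - 0)"
  proof (rule field_differentiable_bound[of UNIV arctan "\<lambda>x. inverse (1 + x\<^sup>2)"])
    show "(arctan has_field_derivative inverse (1 + z\<^sup>2)) (at z within UNIV)" for z
      by (simp add: DERIV_arctan)
    show "norm (inverse (1 + z\<^sup>2)) \<le> 1" for z :: real
      by (simp add: inverse_eq_divide divide_le_eq add_pos_nonneg)
  qed auto
  then show ?thesis by simp
qed

context closed_gradient
begin

text \<open>
  Components are added one at a time by the chain rule for two variables. Every step adds \<open>d\<close> under the
  root, which keeps it away from its singularity; this is where the term \<open>real N * d\<close> comes from.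
\<close>

lemma graph_sqrt_sum_squares:
  fixes f :: "nat \<Rightarrow> 'a \<Rightarrow> real" and D :: "nat \<Rightarrow> 'a \<Rightarrow> 'a"
  assumes f: "\<And>i. (f i, D i) \<in> M_graph \<nu> R p" and p: "0 < p" and d: "0 < d"
  shows "((\<lambda>x. sqrt (real N * d + (\<Sum>j<N. (f j x)\<^sup>2))),
    (\<lambda>x. (1 / sqrt (real N * d + (\<Sum>j<N. (f j x)\<^sup>2))) *\<^sub>R (\<Sum>j<N. f j x *\<^sub>R D j x))) \<in> M_graph \<nu> R p"
proof (induction N)
  case 0
  then show ?case using graph_const[of p 0] p by simp
next
  case (Suc N)
  let ?s = "\<lambda>x. real N * d + (\<Sum>j<N. (f j x)\<^sup>2)" and ?S = "\<lambda>x. \<Sum>j<N. f j x *\<^sub>R D j x"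
  have s0: "0 \<le> ?s x" for x using d by (intro add_nonneg_nonneg sum_nonneg) auto
  have canc: "sqrt (?s x) *\<^sub>R ((1 / sqrt (?s x)) *\<^sub>R ?S x) = ?S x" for x
  proof (cases "N = 0")
    case False
    then have "0 < ?s x" using d by (intro add_pos_nonneg sum_nonneg) auto
    then show ?thesis by simp
  qed simp
  have eq: "d + (sqrt (?s x))\<^sup>2 + (f N x)\<^sup>2 = real (Suc N) * d + (\<Sum>j<Suc N. (f j x)\<^sup>2)" for x
    using s0[of x] by (simp add: algebra_simps)
  have gr: "(sqrt (?s x) / sqrt (real (Suc N) * d + (\<Sum>j<Suc N. (f j x)\<^sup>2))) *\<^sub>R ((1 / sqrt (?s x)) *\<^sub>R ?S x)
     + (f N x / sqrt (real (Suc N) * d + (\<Sum>j<Suc N. (f j x)\<^sup>2))) *\<^sub>R D N x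
     = (1 / sqrt (real (Suc N) * d + (\<Sum>j<Suc N. (f j x)\<^sup>2))) *\<^sub>R (\<Sum>j<Suc N. f j x *\<^sub>R D j x)" for x
  proof -
    let ?q = "sqrt (real (Suc N) * d + (\<Sum>j<Suc N. (f j x)\<^sup>2))"
    have "(sqrt (?s x) / ?q) *\<^sub>R ((1 / sqrt (?s x)) *\<^sub>R ?S x) = (1 / ?q) *\<^sub>R (sqrt (?s x) *\<^sub>R ((1 / sqrt (?s x)) *\<^sub>R ?S x))"
      by (simp only: scaleR_scaleR) (simp add: mult_ac)
    also have "\<dots> = (1 / ?q) *\<^sub>R ?S x" by (simp only: canc)
    finally show ?thesis by (simp only: sum.lessThan_Suc scaleR_add_right scaleR_scaleR) simp
  qed
  from graph_chain[OF Suc.IH f[of N] C1_Lip2_sqrt[OF d] p] show ?case by (simp only: eq gr)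
qed

text \<open>
  The regularised norms of the first \<open>N\<close> components converge to the norm by Parseval's identity. By
  Cauchy and Schwarz their gradients are dominated by the Hilbert--Schmidt norm of the derivative, and
  they converge where \<open>F\<close> does not vanish.
\<close>

lemma graph_norm_field:
  fixes F :: "'a \<Rightarrow> 'a" and D :: "nat \<Rightarrow> 'a \<Rightarrow> 'a"
  assumes e: "orthonormal_basis e" and F: "\<And>i. ((\<lambda>x. F x \<bullet> e i), D i) \<in> M_graph \<nu> R p" and p: "0 < p"
    and FL: "F \<in> Lp \<nu> p" and nz: "AE x in \<nu>. F x \<noteq> 0"
    and sm: "AE x in \<nu>. summable (\<lambda>i. (norm (D i x))\<^sup>2)"
    and S: "(\<lambda>x. sqrt (\<Sum>i. (norm (D i x))\<^sup>2)) \<in> Lp \<nu> p"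
  obtains E where "((\<lambda>x. norm (F x)), E) \<in> M_graph \<nu> R p"
    "AE x in \<nu>. norm (E x) \<le> sqrt (\<Sum>i. (norm (D i x))\<^sup>2)"
proof -
  \<comment> \<open>Small enough for \<open>N * d N\<close> to tend to zero.\<close>
  define d where "d N = 1 / (real (Suc N))\<^sup>2" for N
  have d: "0 < d N" for N by (simp add: d_def)
  have Nd: "real N * d N \<le> 1 / real (Suc N)" for N
  proof -
    have "real N / (real (Suc N))\<^sup>2 \<le> real (Suc N) / (real (Suc N))\<^sup>2" by (intro divide_right_mono) auto
    also have "\<dots> = 1 / real (Suc N)" by (simp add: power2_eq_square del: of_nat_Suc)
    finally show ?thesis by (simp add: d_def)
  qed
  then have Nd1: "real N * d N \<le> 1" for N by (rule order_trans) simp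
  have Nd0: "0 \<le> real N * d N" for N using d[of N] by simp
  have Ndlim: "(\<lambda>N. real N * d N) \<longlonglongrightarrow> 0"
    by (rule tendsto_sandwich[OF _ _ tendsto_const LIMSEQ_Suc[OF lim_1_over_n]]) (use Nd Nd0 in auto)
  define q where "q N x = sqrt (real N * d N + (\<Sum>j<N. (F x \<bullet> e j)\<^sup>2))" for N x
  define V where "V N x = (1 / q N x) *\<^sub>R (\<Sum>j<N. (F x \<bullet> e j) *\<^sub>R D j x)" for N x
  define E where "E x = lim (\<lambda>N. V N x)" for x
  have qV: "(q N, V N) \<in> M_graph \<nu> R p" for N
    using graph_sqrt_sum_squares[OF F p d[of N], of N] by (simp add: q_def[abs_def] V_def[abs_def])
  have Vm[measurable]: "V N \<in> borel_measurable \<nu>" "q N \<in> borel_measurable \<nu>" for N using graph_measurable[OF qV] by auto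
  have [measurable]: "E \<in> borel_measurable \<nu>" unfolding E_def[abs_def] by (rule borel_measurable_lim_metric) simp
  have [measurable]: "F \<in> borel_measurable \<nu>" using FL by (rule LpD_measurable)
  note Pars = orthonormal_basis_Parseval[OF e]
  have sum_le: "(\<Sum>j<N. (x \<bullet> e j)\<^sup>2) \<le> (norm x)\<^sup>2" for N x
    unfolding sums_unique[OF Pars[of x]] by (intro sum_le_suminf sums_summable[OF Pars]) auto
  have qlim: "(\<lambda>N. q N x) \<longlonglongrightarrow> norm (F x)" for x
  proof -
    have "(\<lambda>N. q N x) \<longlonglongrightarrow> sqrt (0 + (norm (F x))\<^sup>2)"
      unfolding q_def using Pars[of "F x"] Ndlim by (intro tendsto_intros) (auto simp: sums_def)
    then show ?thesis by simp
  qed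
  have Vle: "norm (V N x) \<le> sqrt (\<Sum>i. (norm (D i x))\<^sup>2)" if s: "summable (\<lambda>i. (norm (D i x))\<^sup>2)" for N x
  proof (cases "q N x = 0")
    case True
    then show ?thesis by (simp add: V_def suminf_nonneg s)
  next
    case False
    have q0: "0 < q N x"
    proof -
      have "0 \<le> q N x" unfolding q_def using Nd0 by (intro real_sqrt_ge_zero add_nonneg_nonneg sum_nonneg) auto
      with False show ?thesis by simp
    qed
    have "norm (\<Sum>j<N. (F x \<bullet> e j) *\<^sub>R D j x) \<le> sqrt (\<Sum>j<N. (F x \<bullet> e j)\<^sup>2) * sqrt (\<Sum>j<N. (norm (D j x))\<^sup>2)"
      by (rule norm_sum_scaleR_le)
    also have "\<dots> \<le> q N x * sqrt (\<Sum>i. (norm (D i x))\<^sup>2)"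
      unfolding q_def using Nd0 s
      by (intro mult_mono real_sqrt_le_mono sum_le_suminf) (auto intro!: sum_nonneg add_nonneg_nonneg)
    finally show ?thesis using q0 by (simp add: V_def divide_le_eq mult.commute)
  qed
  have conv: "(\<lambda>N. V N x) \<longlonglongrightarrow> E x" if s: "summable (\<lambda>i. (norm (D i x))\<^sup>2)" and n: "F x \<noteq> 0" for x
  proof -
    have "summable (\<lambda>j. (F x \<bullet> e j) *\<^sub>R D j x)" by (rule summable_scaleR_squares[OF sums_summable[OF Pars] s])
    then have "(\<lambda>N. \<Sum>j<N. (F x \<bullet> e j) *\<^sub>R D j x) \<longlonglongrightarrow> (\<Sum>j. (F x \<bullet> e j) *\<^sub>R D j x)" by (rule summable_LIMSEQ)
    then have "(\<lambda>N. V N x) \<longlonglongrightarrow> (1 / norm (F x)) *\<^sub>R (\<Sum>j. (F x \<bullet> e j) *\<^sub>R D j x)"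
      unfolding V_def using qlim[of x] n by (intro tendsto_intros) auto
    then show ?thesis by (simp add: E_def limI)
  qed
  have "((\<lambda>x. norm (F x)), E) \<in> M_graph \<nu> R p"
  proof (rule graph_closed[OF qV _ _ p])
    show "Lp_tendsto \<nu> p q (\<lambda>x. norm (F x))"
    proof (rule Lp_tendsto_dominated[OF _ _ _ p])
      show "(\<lambda>x. 1 + norm (F x)) \<in> Lp \<nu> p"
        using p by (intro Lp_add Lp_norm_fun FL Lp_bounded[where C=1]) auto
      have "norm (q N x) \<le> 1 + norm (F x)" for N x
      proof -
        have "q N x \<le> 1 + norm (F x)" unfolding q_def
        proof (rule real_le_lsqrt)
          have "real N * d N + (\<Sum>j<N. (F x \<bullet> e j)\<^sup>2) \<le> 1 + (norm (F x))\<^sup>2 + 2 * norm (F x)"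
            using Nd1[of N] sum_le[of "F x" N] norm_ge_zero[of "F x"] by linarith
          then show "real N * d N + (\<Sum>j<N. (F x \<bullet> e j)\<^sup>2) \<le> (1 + norm (F x))\<^sup>2"
            by (simp add: power2_sum)
        qed auto
        moreover have "0 \<le> q N x" unfolding q_def using Nd0 by (intro real_sqrt_ge_zero add_nonneg_nonneg sum_nonneg) auto
        ultimately show ?thesis by simp
      qed
      then show "AE x in \<nu>. norm (q N x) \<le> 1 + norm (F x)" for N by simp
    qed (use qlim in auto)
    show "Lp_tendsto \<nu> p V E"
    proof (rule Lp_tendsto_dominated[OF _ _ S p])
      show "AE x in \<nu>. norm (V N x) \<le> sqrt (\<Sum>i. (norm (D i x))\<^sup>2)" for N
        using sm by eventually_elim (rule Vle)
      show "AE x in \<nu>. (\<lambda>N. V N x) \<longlonglongrightarrow> E x"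
        using sm nz by eventually_elim (rule conv)
    qed auto
  qed
  moreover have "AE x in \<nu>. norm (E x) \<le> sqrt (\<Sum>i. (norm (D i x))\<^sup>2)"
    using sm nz by eventually_elim (auto intro!: LIMSEQ_le_const2[OF tendsto_norm[OF conv]] Vle)
  ultimately show thesis by (rule that)
qed

text \<open>
  Quotients with a nonvanishing denominator whose reciprocal is highly integrable. Truncating the
  numerator by a scaled arctangent makes the approximating functions of the pair globally
  Lipschitz; the bound \<open>\<bar>f\<bar> \<le> n\<close> keeps their gradients dominated.
\<close>

lemma graph_quotient:
  fixes f n :: "'a \<Rightarrow> real"
  assumes f: "(f, D) \<in> M_graph \<nu> R q" and n: "(n, E) \<in> M_graph \<nu> R q" and p: "1 \<le> p" "p < q"
    and fn: "\<And>x. \<bar>f x\<bar> \<le> n x" and nz: "AE x in \<nu>. n x \<noteq> 0"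
    and inv: "\<And>b. 1 < b \<Longrightarrow> (\<lambda>x. 1 / n x) \<in> Lp \<nu> b"
  shows "((\<lambda>x. f x / n x), (\<lambda>x. (1 / n x) *\<^sub>R D x - (f x / (n x)\<^sup>2) *\<^sub>R E x)) \<in> M_graph \<nu> R p"
proof -
  have p': "0 < p" and q: "0 < q" using p by auto
  note [measurable] = graph_measurable[OF f] graph_measurable[OF n]
  define k where "k m = real (Suc m)" for m
  define d where "d m = 1 / real (Suc m)" for m
  have kd: "0 < k m" "0 < d m" for m by (auto simp: k_def d_def)
  have dlim: "d \<longlonglongrightarrow> 0" unfolding d_def by (rule LIMSEQ_Suc[OF lim_1_over_n])
  define T where "T m x = k m * arctan (f x / k m)" for m x
  define s where "s m x = sqrt (d m + (n x)\<^sup>2)" for m x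
  have n0: "0 \<le> n x" for x using order_trans[OF abs_ge_zero fn] .
  have [measurable]: "T m \<in> borel_measurable \<nu>" "s m \<in> borel_measurable \<nu>" for m
    unfolding T_def[abs_def] s_def[abs_def] by measurable
  have T_le: "\<bar>T m x\<bar> \<le> \<bar>f x\<bar>" for m x
  proof -
    have "\<bar>T m x\<bar> = k m * \<bar>arctan (f x / k m)\<bar>" using kd(1)[of m] by (simp add: T_def abs_mult)
    also have "\<dots> \<le> k m * \<bar>f x / k m\<bar>" using kd(1)[of m] by (intro mult_left_mono abs_arctan_le) auto
    also have "\<dots> = \<bar>f x\<bar>" using kd(1)[of m] by simp
    finally show ?thesis .
  qed
  have T_lim: "(\<lambda>m. T m x) \<longlonglongrightarrow> f x" for x
    unfolding T_def k_def by (rule arctan_scaled_tendsto)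
  have s_ge: "n x \<le> s m x" "0 < s m x" for m x
    unfolding s_def using kd[of m] n0 by (auto intro!: real_le_rsqrt simp: add_pos_nonneg)
  have s_lim: "(\<lambda>m. s m x) \<longlonglongrightarrow> n x" for x
  proof -
    have "(\<lambda>m. s m x) \<longlonglongrightarrow> sqrt (0 + (n x)\<^sup>2)" unfolding s_def by (intro tendsto_intros dlim)
    then show ?thesis using n0[of x] by simp
  qed
  define K1 where "K1 m x = 1 / (1 + (f x / k m)\<^sup>2) / s m x" for m x
  define K2 where "K2 m x = - (T m x * n x / ((d m + (n x)\<^sup>2) * s m x))" for m x
  have [measurable]: "K1 m \<in> borel_measurable \<nu>" "K2 m \<in> borel_measurable \<nu>" for m
    unfolding K1_def[abs_def] K2_def[abs_def] by measurable
  have gr: "((\<lambda>x. T m x / s m x), (\<lambda>x. K1 m x *\<^sub>R D x + K2 m x *\<^sub>R E x)) \<in> M_graph \<nu> R p" for m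
    using graph_mono[OF graph_chain[OF f n C1_Lip2_arctan[OF kd(2)[of m] kd(1)[of m]] q] p'] p
    by (simp add: T_def s_def K1_def K2_def)
  have K1_le: "\<bar>K1 m x\<bar> \<le> 1 / n x" if "0 < n x" for m x
  proof -
    have "1 / (1 + (f x / k m)\<^sup>2) \<le> 1" by (simp add: divide_le_eq add_pos_nonneg)
    moreover have "1 / s m x \<le> 1 / n x" using s_ge(1)[of x m] s_ge(2)[of m x] that by (intro divide_left_mono) auto
    ultimately have "1 / (1 + (f x / k m)\<^sup>2) * (1 / s m x) \<le> 1 * (1 / n x)"
      using s_ge(2)[of m x] by (intro mult_mono) auto
    moreover have "0 \<le> K1 m x" unfolding K1_def using s_ge(2)[of m x] by simp
    ultimately show ?thesis by (simp add: K1_def)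
  qed
  have ss: "s m x * s m x = d m + (n x)\<^sup>2" for m x
    unfolding s_def using kd(2)[of m] by (simp add: add_nonneg_nonneg)
  have K2_le: "\<bar>K2 m x\<bar> \<le> 1 / n x" if "0 < n x" for m x
  proof -
    have "\<bar>K2 m x\<bar> = (\<bar>T m x\<bar> / s m x) * (n x / s m x) * (1 / s m x)"
      unfolding K2_def ss[symmetric] using s_ge(2)[of m x] that by (simp add: abs_mult)
    also have "\<dots> \<le> 1 * 1 * (1 / n x)"
    proof (intro mult_mono)
      show "\<bar>T m x\<bar> / s m x \<le> 1" using T_le[of m x] fn[of x] s_ge(1)[of x m] s_ge(2)[of m x] by (simp add: divide_le_eq)
      show "n x / s m x \<le> 1" using s_ge(1)[of x m] s_ge(2)[of m x] by (simp add: divide_le_eq)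
      show "1 / s m x \<le> 1 / n x" using s_ge(1)[of x m] s_ge(2)[of m x] that by (intro divide_left_mono) auto
    qed (use s_ge(2)[of m x] that in auto)
    finally show ?thesis by simp
  qed
  have K1_lim: "(\<lambda>m. K1 m x) \<longlonglongrightarrow> 1 / n x" if "0 < n x" for x
  proof -
    have "(\<lambda>m. f x / k m) \<longlonglongrightarrow> 0"
      using tendsto_mult_right[OF LIMSEQ_Suc[OF lim_1_over_n], of "f x"] by (simp add: k_def)
    then have "(\<lambda>m. K1 m x) \<longlonglongrightarrow> 1 / (1 + 0\<^sup>2) / n x"
      unfolding K1_def using that by (intro tendsto_intros s_lim) auto
    then show ?thesis by simp
  qed
  have K2_lim: "(\<lambda>m. K2 m x) \<longlonglongrightarrow> - (f x / (n x)\<^sup>2)" if "0 < n x" for x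
  proof -
    have "(\<lambda>m. K2 m x) \<longlonglongrightarrow> - (f x * n x / ((0 + (n x)\<^sup>2) * n x))"
      unfolding K2_def using that by (intro tendsto_intros s_lim T_lim dlim) auto
    then show ?thesis using that by (simp add: power2_eq_square)
  qed
  have W: "(\<lambda>x. (norm (D x) + norm (E x)) * (1 / n x)) \<in> Lp \<nu> p"
    using q by (intro Lp_mult_exponents[OF _ inv p] Lp_add Lp_norm_fun graph_Lp(2)[OF f] graph_Lp(2)[OF n]) auto
  have pos: "AE x in \<nu>. 0 < n x" using nz by eventually_elim (use n0 in \<open>simp add: order_less_le\<close>)
  show ?thesis
  proof (rule graph_closed[OF gr _ _ p'])
    show "Lp_tendsto \<nu> p (\<lambda>m x. T m x / s m x) (\<lambda>x. f x / n x)"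
    proof (rule Lp_tendsto_dominated[OF _ _ _ p'])
      show "(\<lambda>_. 1::real) \<in> Lp \<nu> p" using p' by (intro Lp_bounded[where C=1]) auto
      have "norm (T m x / s m x) \<le> 1" for m x
        using T_le[of m x] fn[of x] s_ge(1)[of x m] s_ge(2)[of m x] by (simp add: divide_le_eq)
      then show "AE x in \<nu>. norm (T m x / s m x) \<le> 1" for m by simp
      show "AE x in \<nu>. (\<lambda>m. T m x / s m x) \<longlonglongrightarrow> f x / n x"
        using nz by eventually_elim (intro tendsto_intros T_lim s_lim)
    qed auto
    show "Lp_tendsto \<nu> p (\<lambda>m x. K1 m x *\<^sub>R D x + K2 m x *\<^sub>R E x) (\<lambda>x. (1 / n x) *\<^sub>R D x - (f x / (n x)\<^sup>2) *\<^sub>R E x)"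
    proof (rule Lp_tendsto_dominated[OF _ _ W p'])
      show "AE x in \<nu>. norm (K1 m x *\<^sub>R D x + K2 m x *\<^sub>R E x) \<le> (norm (D x) + norm (E x)) * (1 / n x)" for m
        using pos
      proof eventually_elim
        case (elim x)
        have "norm (K1 m x *\<^sub>R D x + K2 m x *\<^sub>R E x) \<le> (1 / n x) * norm (D x) + (1 / n x) * norm (E x)"
          unfolding norm_scaleR[symmetric]
          using K1_le[OF elim, of m] K2_le[OF elim, of m]
          by (intro order_trans[OF norm_triangle_ineq] add_mono) (auto intro!: mult_right_mono simp del: times_divide_eq_left)
        then show ?case by (simp add: distrib_left mult.commute)
      qed
      show "AE x in \<nu>. (\<lambda>m. K1 m x *\<^sub>R D x + K2 m x *\<^sub>R E x) \<longlonglongrightarrow> (1 / n x) *\<^sub>R D x - (f x / (n x)\<^sup>2) *\<^sub>R E x"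
        using pos
      proof eventually_elim
        case (elim x)
        have "(\<lambda>m. K1 m x *\<^sub>R D x + K2 m x *\<^sub>R E x) \<longlonglongrightarrow> (1 / n x) *\<^sub>R D x + (- (f x / (n x)\<^sup>2)) *\<^sub>R E x"
          by (intro tendsto_intros K1_lim K2_lim elim)
        then show ?case by simp
      qed
    qed auto
  qed
qed

end

section \<open>The variational formula\<close>

context closed_gradient
begin

text \<open>
  A representative of the gradient for the exponent \<open>2\<close> works for all exponents: it is one for smaller
  exponents, and those for larger exponents are also gradients for the exponent \<open>2\<close>, hence equal to it
  almost everywhere.
\<close>

lemma graph_M_all:
  assumes f: "\<And>p. 1 < p \<Longrightarrow> f \<in> W1 \<nu> R p" and p: "1 < p"
  shows "(f, M_all \<nu> R f) \<in> M_graph \<nu> R p"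
proof -
  let ?G = "M_op \<nu> R 2 f"
  have G2: "(f, ?G) \<in> M_graph \<nu> R 2" by (intro graph_M_op f) simp
  have "(f, ?G) \<in> M_graph \<nu> R p" if p: "1 < p" for p
  proof (cases "p \<le> 2")
    case True
    then show ?thesis using graph_mono[OF G2, of p] p by simp
  next
    case False
    have Gp: "(f, M_op \<nu> R p f) \<in> M_graph \<nu> R p" by (intro graph_M_op f p)
    have "(f, M_op \<nu> R p f) \<in> M_graph \<nu> R 2" using graph_mono[OF Gp, of 2] False by simp
    then have "AE x in \<nu>. M_op \<nu> R p f x = ?G x" by (rule graph_unique[OF _ G2]) auto
    then show ?thesis
      using graph_measurable[OF G2] p by (intro graph_AE_cong[OF Gp]) auto
  qed
  then have "\<forall>p>1. (f, M_all \<nu> R f) \<in> M_graph \<nu> R p"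
    unfolding M_all_def by (intro someI[of "\<lambda>G. \<forall>p>1. (f, G) \<in> M_graph \<nu> R p" ?G]) blast
  with p show ?thesis by blast
qed

end

context regular_level
begin

lemma slab_mean_mono_AE:
  assumes "integrable \<nu> u" "integrable \<nu> v" "AE x in \<nu>. u x \<le> v x" "a < b"
  shows "slab_mean a b u \<le> slab_mean a b v"
  unfolding slab_mean_def
proof (intro divide_right_mono integral_mono_AE integrable_Slab assms)
  show "AE x in \<nu>. indicator (Slab a b) x * u x \<le> indicator (Slab a b) x * v x"
    using assms(3) by eventually_elim (auto intro: mult_left_mono)
qed (use assms in auto)

text \<open>
  The divergence theorem on a sublevel set: the indicator of \<open>{g < r}\<close> is approximated by
  piecewise linear functions of \<open>g\<close>, whose gradients integrate to slab averages of \<open>- \<langle>G, H\<rangle>\<close> when they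
  are paired with \<open>H\<close>.
\<close>

lemma sublevel_integral:
  assumes Hk: "(H, k) \<in> Mstar_graph \<nu> R s" and s: "1 < s"
  shows "(\<lambda>n. - slab_mean (lower r n) r (\<lambda>x. G x \<bullet> H x)) \<longlonglongrightarrow> (LINT x:{x. g x < r}|\<nu>. k x)"
proof -
  have HL: "H \<in> Lp \<nu> (conj_exp s)" and kL: "k \<in> Lp \<nu> (conj_exp s)" using Hk by (auto simp: Mstar_graph_def)
  note [measurable] = LpD_measurable[OF HL] LpD_measurable[OF kL]
  have ik: "integrable \<nu> k" using Lp_integrable[OF kL] conj_exp_gt1[OF s] by simp
  define \<alpha> where "\<alpha> n x = 1 - (1 / (r - lower r n)) * ramp (lower r n) r (g x)" for n x
  have eq: "- slab_mean (lower r n) r (\<lambda>x. G x \<bullet> H x) = (LINT x|\<nu>. \<alpha> n x * k x)" for n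
  proof -
    have lr: "0 < r - lower r n" using lower_less[of r n] by simp
    have "(\<alpha> n, (\<lambda>x. 0 - (1 / (r - lower r n)) *\<^sub>R (slab (lower r n) r (g x) *\<^sub>R G x))) \<in> M_graph \<nu> R s"
      unfolding \<alpha>_def[abs_def] using s by (intro graph_diff graph_const graph_cmult graph_ramp) auto
    from adjoint_eq[OF Hk this s]
    have "(LINT x|\<nu>. \<alpha> n x * k x) = (LINT x|\<nu>. - (1 / (r - lower r n)) * (slab (lower r n) r (g x) * (G x \<bullet> H x)))"
      by simp
    also have "\<dots> = (LINT x|\<nu>. - (1 / (r - lower r n)) * (indicator (Slab (lower r n) r) x * (G x \<bullet> H x)))"
    proof (rule integral_cong_AE)
      show "AE x in \<nu>. - (1 / (r - lower r n)) * (slab (lower r n) r (g x) * (G x \<bullet> H x))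
        = - (1 / (r - lower r n)) * (indicator (Slab (lower r n) r) x * (G x \<bullet> H x))"
        using slab_indicator[OF lower_less, of r n] by eventually_elim simp
    qed measurable
    also have "\<dots> = - slab_mean (lower r n) r (\<lambda>x. G x \<bullet> H x)" by (simp add: slab_mean_def)
    finally show ?thesis by simp
  qed
  have "(\<lambda>n. LINT x|\<nu>. \<alpha> n x * k x) \<longlonglongrightarrow> (LINT x|\<nu>. indicator {x. g x < r} x * k x)"
  proof (rule integral_dominated_convergence)
    show "integrable \<nu> (\<lambda>x. \<bar>k x\<bar>)" using ik by simp
    have \<alpha>01: "0 \<le> \<alpha> n x" "\<alpha> n x \<le> 1" for n x
      using ramp_bounds[OF lower_less, of r n "g x"] lower_less[of r n] by (auto simp: \<alpha>_def divide_le_eq)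
    show "AE x in \<nu>. norm (\<alpha> n x * k x) \<le> \<bar>k x\<bar>" for n
      using \<alpha>01 by (auto simp: abs_mult intro!: mult_left_le_one_le)
    have "(\<lambda>n. \<alpha> n x) \<longlonglongrightarrow> indicator {x. g x < r} x" for x
    proof (cases "g x < r")
      case True
      then have "eventually (\<lambda>n. g x < lower r n) sequentially" by (rule order_tendstoD(1)[OF lower_tendsto])
      then have "eventually (\<lambda>n. \<alpha> n x = indicator {x. g x < r} x) sequentially"
      proof eventually_elim
        case (elim n)
        then show ?case using ramp_cases(1)[of "g x" "lower r n" r] lower_less[of r n] True by (simp add: \<alpha>_def)
      qed
      then show ?thesis by (rule tendsto_eventually)
    next
      case False
      have "\<alpha> n x = indicator {x. g x < r} x" for n
        using ramp_cases(2)[of r "g x" "lower r n"] lower_less[of r n] False by (simp add: \<alpha>_def)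
      then show ?thesis by simp
    qed
    then show "AE x in \<nu>. (\<lambda>n. \<alpha> n x * k x) \<longlonglongrightarrow> indicator {x. g x < r} x * k x"
      by (intro AE_I2 tendsto_mult_right)
  qed (auto simp: \<alpha>_def[abs_def])
  then show ?thesis by (simp add: eq set_lebesgue_integral_def)
qed

end

text \<open>
  The situation of the theorem. With the adjoint taken at the exponent \<open>conj_exp q\<close>, the function \<open>h\<close> lies
  in \<open>L\<^sup>q\<close> like the derivatives of \<open>G\<close>, and the products that occur have a second factor that lies in
  \<open>L\<^sup>p\<close> for every \<open>p\<close>.
\<close>

locale surface_level = regular_level \<nu> R g G h "conj_exp q"
  for \<nu> :: "'a::{real_inner, banach, second_countable_topology} measure" and R g G h and q :: real +
  fixes e :: "nat \<Rightarrow> 'a"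
  assumes q2: "2 < q"
    and basis: "orthonormal_basis e"
    and G_W1_vec: "G \<in> W1_vec \<nu> R e q"
    and Psi_Lp_all: "\<And>b. 1 < b \<Longrightarrow> Psi \<in> Lp \<nu> b"
begin

definition direction :: "'a \<Rightarrow> 'a" where "direction x = - ((1 / norm (G x)) *\<^sub>R G x)"

definition HS_norm :: "'a \<Rightarrow> real" where
  "HS_norm x = sqrt (\<Sum>i. (norm (M_op \<nu> R q (\<lambda>y. G y \<bullet> e i) x))\<^sup>2)"

definition M_norm :: "'a \<Rightarrow> 'a" where
  "M_norm = (SOME E. ((\<lambda>x. norm (G x)), E) \<in> M_graph \<nu> R q \<and> (AE x in \<nu>. norm (E x) \<le> HS_norm x))"

lemma conj_q: "1 < conj_exp q" "conj_exp q < q"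
proof -
  show "1 < conj_exp q" using q2 by (intro conj_exp_gt1) simp
  have "q < q * (q - 1)" using q2 by simp
  then show "conj_exp q < q" using q2 by (simp add: conj_exp_def divide_less_eq)
qed

lemma h_Lp_q: "h \<in> Lp \<nu> q"
  using h_Lp conj_exp_conj_exp[of q] q2 by simp

lemma G_Lp: "1 < b \<Longrightarrow> G \<in> Lp \<nu> b"
  using graph_Lp(2)[OF graph_g] .

lemma component_graph: "((\<lambda>x. G x \<bullet> e i), M_op \<nu> R q (\<lambda>y. G y \<bullet> e i)) \<in> M_graph \<nu> R q"
  using G_W1_vec by (intro graph_M_op) (simp add: W1_vec_def)

lemma HS_norm_Lp: "HS_norm \<in> Lp \<nu> q" and summable_components: "AE x in \<nu>. summable (\<lambda>i. (norm (M_op \<nu> R q (\<lambda>y. G y \<bullet> e i) x))\<^sup>2)"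
  using G_W1_vec by (simp_all add: W1_vec_def HS_norm_def[abs_def])

lemma M_norm_graph: "((\<lambda>x. norm (G x)), M_norm) \<in> M_graph \<nu> R q"
  and M_norm_le: "AE x in \<nu>. norm (M_norm x) \<le> HS_norm x"
proof -
  obtain E where "((\<lambda>x. norm (G x)), E) \<in> M_graph \<nu> R q" "AE x in \<nu>. norm (E x) \<le> HS_norm x"
    using graph_norm_field[OF basis component_graph _ G_Lp G_nonzero summable_components HS_norm_Lp[unfolded HS_norm_def[abs_def]]] q2
    unfolding HS_norm_def by force
  then have "((\<lambda>x. norm (G x)), M_norm) \<in> M_graph \<nu> R q \<and> (AE x in \<nu>. norm (M_norm x) \<le> HS_norm x)"
    unfolding M_norm_def by (intro someI[of "\<lambda>E. ((\<lambda>x. norm (G x)), E) \<in> M_graph \<nu> R q \<and> (AE x in \<nu>. norm (E x) \<le> HS_norm x)"]) simp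
  then show "((\<lambda>x. norm (G x)), M_norm) \<in> M_graph \<nu> R q" "AE x in \<nu>. norm (M_norm x) \<le> HS_norm x" by simp_all
qed

lemma norm_Psi: "norm (Psi x) = 1 / norm (G x)"
  by (simp add: Psi_def power2_eq_square)

lemma inverse_norm_Lp: "1 < b \<Longrightarrow> (\<lambda>x. 1 / norm (G x)) \<in> Lp \<nu> b"
  using Lp_norm_fun[OF Psi_Lp_all[of b]] by (simp add: norm_Psi)

lemma direction_eq: "direction x = - (norm (G x) *\<^sub>R Psi x)"
  by (simp add: direction_def Psi_def power2_eq_square)

lemma norm_direction_le: "norm (direction x) \<le> 1"
  by (simp add: direction_def)

lemma direction_measurable[measurable]: "direction \<in> borel_measurable \<nu>"
  unfolding direction_def[abs_def] by measurable

text \<open>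
  The components are quotients as in \<open>graph_quotient\<close>. Summing the squares of their gradients with
  Parseval's identity gives the bound \<open>2 \<parallel>D G\<parallel> / \<parallel>G\<parallel>\<close>, where \<open>\<parallel>D G\<parallel>\<close> is the Hilbert--Schmidt norm
  \<open>HS_norm\<close>; the reciprocal of \<open>\<parallel>G\<parallel>\<close> is the norm of \<open>Psi\<close> and costs an arbitrarily small loss of
  integrability, hence \<open>t < q\<close>.
\<close>

lemma direction_W1_vec:
  assumes t: "1 < t" "t < q"
  shows "direction \<in> W1_vec \<nu> R e t"
proof -
  have e: "\<And>i j. e i \<bullet> e j = (if i = j then 1 else 0)" using basis by (simp add: orthonormal_basis_def)
  let ?D = "\<lambda>i. M_op \<nu> R q (\<lambda>y. G y \<bullet> e i)"
  let ?n = "\<lambda>x. norm (G x)"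
  let ?V = "\<lambda>i x. (1 / ?n x) *\<^sub>R ?D i x - ((G x \<bullet> e i) / (?n x)\<^sup>2) *\<^sub>R M_norm x"
  have fn: "\<bar>G x \<bullet> e i\<bar> \<le> norm (G x)" for x i
  proof -
    have "norm (e i) = 1" by (simp add: norm_eq_sqrt_inner e)
    then show ?thesis using Cauchy_Schwarz_ineq2[of "G x" "e i"] by simp
  qed
  have comp: "((\<lambda>x. direction x \<bullet> e i), (\<lambda>x. (-1) *\<^sub>R ?V i x)) \<in> M_graph \<nu> R t" for i
  proof -
    have "((\<lambda>x. (-1) * ((G x \<bullet> e i) / ?n x)), (\<lambda>x. (-1) *\<^sub>R ?V i x)) \<in> M_graph \<nu> R t"
      using t G_nonzero by (intro graph_cmult graph_quotient[OF component_graph M_norm_graph] fn inverse_norm_Lp) auto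
    then show ?thesis by (simp add: direction_def)
  qed
  have "AE x in \<nu>. \<forall>i. M_op \<nu> R t (\<lambda>y. direction y \<bullet> e i) x = (-1) *\<^sub>R ?V i x"
    unfolding AE_all_countable using M_op_eq[OF comp t(1)] by simp
  then have bound: "AE x in \<nu>. summable (\<lambda>i. (norm (M_op \<nu> R t (\<lambda>y. direction y \<bullet> e i) x))\<^sup>2) \<and>
    sqrt (\<Sum>i. (norm (M_op \<nu> R t (\<lambda>y. direction y \<bullet> e i) x))\<^sup>2) \<le> 2 * (HS_norm x * (1 / ?n x))"
    using summable_components M_norm_le G_nonzero
  proof eventually_elim
    case (elim x)
    let ?m = "\<lambda>i. (norm (M_op \<nu> R t (\<lambda>y. direction y \<bullet> e i) x))\<^sup>2"
    let ?b = "\<lambda>i. 2 * ((1 / ?n x)\<^sup>2 * (norm (?D i x))\<^sup>2 + (norm (M_norm x) / (?n x)\<^sup>2)\<^sup>2 * (G x \<bullet> e i)\<^sup>2)"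
    have n: "0 < ?n x" using elim by simp
    have S0: "0 \<le> HS_norm x" using elim by (simp add: HS_norm_def suminf_nonneg)
    have D: "(\<lambda>i. (norm (?D i x))\<^sup>2) sums (HS_norm x)\<^sup>2"
      using elim by (simp add: HS_norm_def suminf_nonneg summable_sums)
    have b: "?b sums (2 * ((1 / ?n x)\<^sup>2 * (HS_norm x)\<^sup>2 + (norm (M_norm x) / (?n x)\<^sup>2)\<^sup>2 * (?n x)\<^sup>2))"
      by (intro sums_mult sums_add D orthonormal_basis_Parseval[OF basis])
    have sq: "(a + b)\<^sup>2 \<le> 2 * (a\<^sup>2 + b\<^sup>2)" for a b :: real
      using sum_squares_bound[of a b] by (simp add: power2_sum)
    have mb: "?m i \<le> ?b i" for i
    proof -
      have "norm (M_op \<nu> R t (\<lambda>y. direction y \<bullet> e i) x) = norm ((-1) *\<^sub>R ?V i x)" using elim by (simp only:)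
      also have "\<dots> = norm (?V i x)" unfolding norm_scaleR by simp
      also have "\<dots> \<le> (1 / ?n x) * norm (?D i x) + (norm (M_norm x) / (?n x)\<^sup>2) * \<bar>G x \<bullet> e i\<bar>"
        using n by (intro order_trans[OF norm_triangle_ineq4] add_mono) (auto simp: abs_mult mult.commute)
      finally have "?m i \<le> ((1 / ?n x) * norm (?D i x) + (norm (M_norm x) / (?n x)\<^sup>2) * \<bar>G x \<bullet> e i\<bar>)\<^sup>2"
        by (intro power_mono) auto
      also have "\<dots> \<le> 2 * (((1 / ?n x) * norm (?D i x))\<^sup>2 + ((norm (M_norm x) / (?n x)\<^sup>2) * \<bar>G x \<bullet> e i\<bar>)\<^sup>2)"
        by (rule sq)
      finally show ?thesis unfolding power_mult_distrib power2_abs .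
    qed
    have sm: "summable ?m"
      by (rule summable_comparison_test'[OF sums_summable[OF b], of 0]) (use mb in auto)
    have "(\<Sum>i. ?m i) \<le> 2 * ((1 / ?n x)\<^sup>2 * (HS_norm x)\<^sup>2 + (norm (M_norm x) / (?n x)\<^sup>2)\<^sup>2 * (?n x)\<^sup>2)"
      unfolding sums_unique[OF b] by (intro suminf_le mb sm sums_summable[OF b])
    also have "\<dots> = 2 * ((1 / ?n x)\<^sup>2 * ((HS_norm x)\<^sup>2 + (norm (M_norm x))\<^sup>2))"
      using n by (simp add: power_divide field_simps power2_eq_square)
    also have "\<dots> \<le> 2 * ((1 / ?n x)\<^sup>2 * ((HS_norm x)\<^sup>2 + (HS_norm x)\<^sup>2))"
      using elim by (intro mult_left_mono add_left_mono power_mono) auto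
    also have "\<dots> = (2 * (HS_norm x * (1 / ?n x)))\<^sup>2" by (simp add: power_mult_distrib power_divide)
    finally have "sqrt (\<Sum>i. ?m i) \<le> 2 * (HS_norm x * (1 / ?n x))"
      using S0 n by (intro real_le_lsqrt) auto
    with sm show ?case by simp
  qed
  have [measurable]: "M_op \<nu> R t (\<lambda>y. direction y \<bullet> e i) \<in> borel_measurable \<nu>" for i
    using graph_measurable(2)[OF graph_M_op[OF graph_W1[OF comp]]] .
  have "(\<lambda>x. sqrt (\<Sum>i. (norm (M_op \<nu> R t (\<lambda>y. direction y \<bullet> e i) x))\<^sup>2)) \<in> Lp \<nu> t"
  proof (rule Lp_dominated)
    show "(\<lambda>x. 2 * (HS_norm x * (1 / ?n x))) \<in> Lp \<nu> t"
      using t by (intro Lp_cmult Lp_mult_exponents[OF HS_norm_Lp inverse_norm_Lp]) auto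
    show "AE x in \<nu>. norm (sqrt (\<Sum>i. (norm (M_op \<nu> R t (\<lambda>y. direction y \<bullet> e i) x))\<^sup>2)) \<le> 2 * (HS_norm x * (1 / ?n x))"
      using bound by eventually_elim (simp add: suminf_nonneg)
    show "0 \<le> t" using t by simp
  qed measurable
  then show ?thesis unfolding W1_vec_def using bound graph_W1[OF comp] by (auto elim: eventually_mono)
qed

text \<open>
  Since \<open>direction = - \<parallel>G\<parallel> Psi\<close>, the product rule of the adjoint predicts the value
  \<open>- (\<parallel>G\<parallel> h - \<langle>M \<parallel>G\<parallel>, Psi\<rangle>)\<close>. It lies in \<open>L\<^sup>p\<close> for all \<open>p < q\<close>, and \<open>conj_exp s < q\<close> is the
  condition on \<open>s\<close>.
\<close>

lemma direction_Mstar: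
  assumes s: "conj_exp q < s"
  shows "direction \<in> Mstar_dom \<nu> R s"
proof -
  have s1: "1 < s" using conj_q s by simp
  have cs: "1 < conj_exp s" "conj_exp s < q"
    using conj_exp_gt1[OF s1] conj_exp_less_iff[of q s] s s1 q2 by auto
  let ?n = "\<lambda>x. norm (G x)"
  let ?k = "\<lambda>x. - (?n x * h x - M_norm x \<bullet> Psi x)"
  note [measurable] = graph_measurable[OF M_norm_graph]
  have nh: "(\<lambda>x. ?n x * h x) \<in> Lp \<nu> (conj_exp s)"
    using Lp_mult_exponents[OF h_Lp_q Lp_norm_fun[OF G_Lp], of "conj_exp s"] cs by (simp add: mult.commute)
  have EP: "(\<lambda>x. norm (M_norm x) * norm (Psi x)) \<in> Lp \<nu> (conj_exp s)"
    using cs by (intro Lp_mult_exponents[OF Lp_norm_fun[OF graph_Lp(2)[OF M_norm_graph]] Lp_norm_fun[OF Psi_Lp_all]]) auto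
  have EP': "(\<lambda>x. M_norm x \<bullet> Psi x) \<in> Lp \<nu> (conj_exp s)"
    by (rule Lp_dominated[OF _ EP]) (use cs in \<open>auto simp: Cauchy_Schwarz_ineq2\<close>)
  have "(direction, ?k) \<in> Mstar_graph \<nu> R s"
  proof (rule Mstar_graphI[OF s1])
    show "direction \<in> Lp \<nu> (conj_exp s)"
      using cs norm_direction_le by (intro Lp_bounded[where C=1]) auto
    show "?k \<in> Lp \<nu> (conj_exp s)" using cs by (intro Lp_minus Lp_diff nh EP') auto
    fix u :: "'a \<Rightarrow> real" assume u: "u \<in> C1b"
    obtain A A' where A: "\<And>x. \<bar>u x\<bar> \<le> A" "\<And>x. norm (grad u x) \<le> A'" using u by (rule C1b_bounded) auto
    obtain B where B: "\<And>x. norm (R (grad u x)) \<le> B" "0 \<le> B" using u by (rule R_grad_bounded) auto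
    note [measurable] = C1b_measurable[OF u] R_grad_measurable[OF u]
    have ub: "integrable \<nu> (\<lambda>x. u x * w x)" if "w \<in> Lp \<nu> (conj_exp s)" for w
      using cs by (intro integrable_bounded_mult[OF _ A(1)] Lp_integrable[OF that]) auto
    have i1: "integrable \<nu> (\<lambda>x. R (grad u x) \<bullet> direction x)"
    proof (rule integrable_const_bound[of _ B])
      have "\<bar>R (grad u x) \<bullet> direction x\<bar> \<le> B * 1" for x
        using B norm_direction_le[of x] by (intro order_trans[OF Cauchy_Schwarz_ineq2] mult_mono) auto
      then show "AE x in \<nu>. norm (R (grad u x) \<bullet> direction x) \<le> B" by simp
    qed measurable
    have "((\<lambda>x. u x * ?n x), (\<lambda>x. u x *\<^sub>R M_norm x + ?n x *\<^sub>R R (grad u x))) \<in> M_graph \<nu> R (conj_exp q)"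
      using conj_q by (intro graph_mult graph_mono[OF M_norm_graph] u) auto
    from adjoint_eq[OF Psi_graph this conj_q(1)]
    have "(LINT x|\<nu>. (u x *\<^sub>R M_norm x + ?n x *\<^sub>R R (grad u x)) \<bullet> Psi x) = (LINT x|\<nu>. u x * ?n x * h x)" .
    moreover have "(u x *\<^sub>R M_norm x + ?n x *\<^sub>R R (grad u x)) \<bullet> Psi x = u x * (M_norm x \<bullet> Psi x) - R (grad u x) \<bullet> direction x" for x
      by (simp add: direction_eq inner_add_left)
    ultimately have "(LINT x|\<nu>. u x * (M_norm x \<bullet> Psi x)) - (LINT x|\<nu>. R (grad u x) \<bullet> direction x) = (LINT x|\<nu>. u x * (?n x * h x))"
      using ub[OF EP'] i1 by (simp add: mult.assoc)
    moreover have "(LINT x|\<nu>. u x * ?k x) = (LINT x|\<nu>. u x * (M_norm x \<bullet> Psi x)) - (LINT x|\<nu>. u x * (?n x * h x))"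
      using ub[OF EP'] ub[OF nh] by (simp add: right_diff_distrib)
    ultimately show "(LINT x|\<nu>. R (grad u x) \<bullet> direction x) = (LINT x|\<nu>. u x * ?k x)" by simp
  qed
  then show ?thesis unfolding Mstar_dom_def by blast
qed

lemma sublevel_functional:
  assumes F: "F \<in> Mstar_dom \<nu> R s" and s: "1 < s" and u: "u \<in> C1b"
  shows "(\<lambda>n. - slab_mean (lower r n) r (\<lambda>x. u x * (G x \<bullet> F x))) \<longlonglongrightarrow> (LINT x:{x. g x < r}|\<nu>. Mstar \<nu> R s (\<lambda>y. u y *\<^sub>R F y) x)"
proof -
  have "(\<lambda>y. u y *\<^sub>R F y) \<in> Mstar_dom \<nu> R s"
    using Mstar_graph_mult[OF Mstar_graph_Mstar[OF F] u s] unfolding Mstar_dom_def by blast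
  from sublevel_integral[OF Mstar_graph_Mstar[OF this] s] show ?thesis by simp
qed

lemma sublevel_trace_limit:
  assumes u: "u \<in> C1b"
  shows "(\<lambda>n. slab_mean (lower r n) r (\<lambda>x. u x * norm (G x)))
    \<longlonglongrightarrow> (LINT x|surface r. u x * trace_op \<nu> R (surface r) q (\<lambda>y. norm (G y)) x)"
  by (rule slab_mean_tendsto_trace[OF M_norm_graph _ u]) (use conj_q in simp)

text \<open>
  Cauchy and Schwarz give \<open>- \<langle>G, F\<rangle> \<le> \<parallel>G\<parallel>\<close> for fields of norm at most one, and slab averages preserve
  inequalities.
\<close>

lemma sublevel_functional_le:
  assumes F: "F \<in> Mstar_dom \<nu> R s" and s: "1 < s" and u: "u \<in> C1b" "\<And>x. 0 \<le> u x"
    and le: "AE x in \<nu>. norm (F x) \<le> 1"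
  shows "(LINT x:{x. g x < r}|\<nu>. Mstar \<nu> R s (\<lambda>y. u y *\<^sub>R F y) x)
    \<le> (LINT x|surface r. u x * trace_op \<nu> R (surface r) q (\<lambda>y. norm (G y)) x)"
proof (rule LIMSEQ_le[OF sublevel_functional[OF F s u(1)] sublevel_trace_limit[OF u(1)]], intro exI allI impI)
  fix n
  obtain A A' where A: "\<And>x. \<bar>u x\<bar> \<le> A" "\<And>x. norm (grad u x) \<le> A'" using u(1) by (rule C1b_bounded) auto
  have Gi: "integrable \<nu> (\<lambda>x. norm (G x))" using Lp_integrable[OF G_Lp[of 2]] by simp
  have [measurable]: "F \<in> borel_measurable \<nu>"
    using Mstar_graph_Mstar[OF F] by (auto simp: Mstar_graph_def dest: LpD_measurable)
  have GF: "AE x in \<nu>. \<bar>G x \<bullet> F x\<bar> \<le> norm (G x)"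
    using le
  proof eventually_elim
    case (elim x)
    have "\<bar>G x \<bullet> F x\<bar> \<le> norm (G x) * norm (F x)" by (rule Cauchy_Schwarz_ineq2)
    also have "\<dots> \<le> norm (G x)" using elim by (intro mult_right_le_one_le) auto
    finally show ?case .
  qed
  note ii = integrable_bounded_mult[OF C1b_measurable[OF u(1)] A(1)]
  have GFi: "integrable \<nu> (\<lambda>x. G x \<bullet> F x)"
    by (rule Bochner_Integration.integrable_bound[OF Gi]) (use GF in auto)
  have "- slab_mean (lower r n) r (\<lambda>x. u x * (G x \<bullet> F x)) = slab_mean (lower r n) r (\<lambda>x. (-1) * (u x * (G x \<bullet> F x)))"
    by (simp only: slab_mean_cmult)
  also have "\<dots> \<le> slab_mean (lower r n) r (\<lambda>x. u x * norm (G x))"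
  proof (rule slab_mean_mono_AE[OF _ _ _ lower_less])
    show "integrable \<nu> (\<lambda>x. (-1) * (u x * (G x \<bullet> F x)))" using ii[OF GFi] by simp
    show "integrable \<nu> (\<lambda>x. u x * norm (G x))" by (rule ii[OF Gi])
    show "AE x in \<nu>. (-1) * (u x * (G x \<bullet> F x)) \<le> u x * norm (G x)"
      using GF
    proof eventually_elim
      case (elim x)
      then have "u x * (- (G x \<bullet> F x)) \<le> u x * norm (G x)" using u(2)[of x] by (intro mult_left_mono) auto
      then show ?case by simp
    qed
  qed
  finally show "- slab_mean (lower r n) r (\<lambda>x. u x * (G x \<bullet> F x)) \<le> slab_mean (lower r n) r (\<lambda>x. u x * norm (G x))" .
qed

text \<open>
  Equality in Cauchy and Schwarz: \<open>- \<langle>G, direction\<rangle> = \<parallel>G\<parallel>\<close>.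
\<close>

lemma sublevel_functional_direction:
  assumes s: "conj_exp q < s" and u: "u \<in> C1b"
  shows "(LINT x:{x. g x < r}|\<nu>. Mstar \<nu> R s (\<lambda>y. u y *\<^sub>R direction y) x)
    = (LINT x|surface r. u x * trace_op \<nu> R (surface r) q (\<lambda>y. norm (G y)) x)"
proof (rule LIMSEQ_unique)
  have s1: "1 < s" using conj_q s by simp
  show "(\<lambda>n. - slab_mean (lower r n) r (\<lambda>x. u x * (G x \<bullet> direction x)))
    \<longlonglongrightarrow> (LINT x:{x. g x < r}|\<nu>. Mstar \<nu> R s (\<lambda>y. u y *\<^sub>R direction y) x)"
    by (rule sublevel_functional[OF direction_Mstar[OF s] s1 u])
  have "G x \<bullet> direction x = (-1) * norm (G x)" for x
    by (simp add: direction_def dot_square_norm power2_eq_square)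
  then have "- slab_mean (lower r n) r (\<lambda>x. u x * (G x \<bullet> direction x)) = slab_mean (lower r n) r (\<lambda>x. u x * norm (G x))" for n
    using slab_mean_cmult[of "lower r n" r "-1" "\<lambda>x. u x * norm (G x)"] by simp
  then show "(\<lambda>n. - slab_mean (lower r n) r (\<lambda>x. u x * (G x \<bullet> direction x)))
    \<longlonglongrightarrow> (LINT x|surface r. u x * trace_op \<nu> R (surface r) q (\<lambda>y. norm (G y)) x)"
    using sublevel_trace_limit[OF u, of r] by simp
qed

end

theorem theorem5p3:
  fixes \<nu> :: "'a::{real_inner, banach, second_countable_topology} measure"
    and R :: "'a \<Rightarrow> 'a" and e :: "nat \<Rightarrow> 'a"
    and g \<phi> :: "'a \<Rightarrow> real" and q r s t :: real
  defines "Mg \<equiv> M_all \<nu> R g"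
    and "adm \<equiv> {F \<in> W1_vec \<nu> R e t \<inter> Mstar_dom \<nu> R s. AE x in \<nu>. norm (F x) \<le> 1}"
    and "J \<equiv> \<lambda>F. LINT x:{x. g x < r}|\<nu>. Mstar \<nu> R s (\<lambda>y. \<phi> y *\<^sub>R F y) x"
    and "\<sigma> \<equiv> surface_measure \<nu> g r"
  assumes "infinite_dimensional TYPE('a)"
    and "prob_space \<nu>" and "sets \<nu> = sets borel" and "nondegenerate \<nu>"
    and "bounded_linear R"
    and "\<And>p. 1 < p \<Longrightarrow> closable_grad \<nu> R p"
    and "orthonormal_basis e"
    and "g \<in> borel_measurable borel"
    and "\<And>p. 1 < p \<Longrightarrow> g \<in> W1 \<nu> R p"
    and "AE x in \<nu>. Mg x \<noteq> 0"
    and "\<And>p. 1 < p \<Longrightarrow> (\<lambda>x. (1 / (norm (Mg x))\<^sup>2) *\<^sub>R Mg x) \<in> Mstar_dom \<nu> R p"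
    and "2 < q" and "Mg \<in> W1_vec \<nu> R e q"
    and "\<phi> \<in> C1b" and "\<And>x. 0 \<le> \<phi> x"
    and "conj_exp q < t" and "t < q" and "conj_exp q < s"
  shows "(LINT x|\<sigma>. \<phi> x * trace_op \<nu> R \<sigma> q (\<lambda>y. norm (Mg y)) x)
             = J (\<lambda>x. - ((1 / norm (Mg x)) *\<^sub>R Mg x))
         \<and> (\<lambda>x. - ((1 / norm (Mg x)) *\<^sub>R Mg x)) \<in> adm
         \<and> (\<forall>F\<in>adm. J F \<le> (LINT x|\<sigma>. \<phi> x * trace_op \<nu> R \<sigma> q (\<lambda>y. norm (Mg y)) x))"
proof -
  interpret closed_gradient \<nu> R
    by (intro closed_gradient.intro closed_gradient_axioms.intro assms(6,7,9,10))
  have q1: "1 < q" using assms(16) by simp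
  have cq: "1 < conj_exp q" by (rule conj_exp_gt1[OF q1])
  let ?\<Psi> = "\<lambda>x. (1 / (norm (Mg x))\<^sup>2) *\<^sub>R Mg x"
  interpret regular_level \<nu> R g Mg "Mstar \<nu> R (conj_exp q) ?\<Psi>" "conj_exp q"
  proof
    show "1 < conj_exp q" by fact
    show "(g, Mg) \<in> M_graph \<nu> R p" if "1 < p" for p
      unfolding Mg_def using assms(13) that by (rule graph_M_all)
    show "AE x in \<nu>. Mg x \<noteq> 0" by fact
    show "(?\<Psi>, Mstar \<nu> R (conj_exp q) ?\<Psi>) \<in> Mstar_graph \<nu> R (conj_exp q)"
      by (rule Mstar_graph_Mstar[OF assms(15)[OF cq]])
  qed
  interpret surface_level \<nu> R g Mg "Mstar \<nu> R (conj_exp q) ?\<Psi>" q e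
  proof
    show "2 < q" "orthonormal_basis e" "Mg \<in> W1_vec \<nu> R e q" by fact+
    show "Psi \<in> Lp \<nu> b" if b: "1 < b" for b
    proof -
      have "?\<Psi> \<in> Lp \<nu> (conj_exp (conj_exp b))"
        using Mstar_graph_Mstar[OF assms(15)[OF conj_exp_gt1[OF b]]] by (simp add: Mstar_graph_def)
      then show ?thesis using conj_exp_conj_exp[OF b] by (simp add: Psi_def[abs_def])
    qed
  qed
  have s1: "1 < s" and t1: "1 < t" using cq assms(20,22) by auto
  have d: "(\<lambda>x. - ((1 / norm (Mg x)) *\<^sub>R Mg x)) = direction" by (simp add: direction_def[abs_def])
  have "direction \<in> adm"
    unfolding adm_def using direction_W1_vec[OF t1 assms(21)] direction_Mstar[OF assms(22)] norm_direction_le by auto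
  moreover have "(LINT x|\<sigma>. \<phi> x * trace_op \<nu> R \<sigma> q (\<lambda>y. norm (Mg y)) x) = J direction"
    unfolding J_def \<sigma>_def by (rule sublevel_functional_direction[OF assms(22,18), symmetric])
  moreover have "J F \<le> (LINT x|\<sigma>. \<phi> x * trace_op \<nu> R \<sigma> q (\<lambda>y. norm (Mg y)) x)" if "F \<in> adm" for F
    unfolding J_def \<sigma>_def using that assms(18,19) by (intro sublevel_functional_le s1) (auto simp: adm_def)
  ultimately show ?thesis unfolding d by blast
qed

end
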